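(* Assume the setting described in the context ($\xi$ integer-valued, in the domain of attraction of the normal law, $\alpha=2$, with normalising sequence $(a_n)_{n\ge1}$ and $b_n=n\mu$). Assume that $\mathbb P(\xi=x)$ is intermediate regularly varying and that $$\limsup_{x\to\infty}\frac{\sup_{y\ge x}\mathbb P(\xi=y)}{\mathbb P(\xi=x)}<+\infty .$$ If $\lim_{n\to\infty}\frac{x_n}{a_n}=\infty$ and $\lim_{n\to\infty}\frac{x_n}{n}=0$, then with $r_n=r(n/x_n)$ we have, for any $\varepsilon>0$, as $n\to\infty$, $$\mathbb P(S_n-\lfloor b_n\rfloor=x_n,\ M_n>r_n)\sim\mathbb P\big(S_n-\lfloor b_n\rfloor=x_n,\ |M_n-x_n|\le\varepsilon x_n\big),$$ and also $$\mathbb P(S_n-\lfloor b_n\rfloor=x_n)=\mathbb P(S_n-\lfloor b_n\rfloor=x_n,\ M_n\le r_n)+(1+o(1))\,n\,\mathbb P(\xi=x_n).$$ If $\liminf_{n\to\infty}\frac{x_n}{n}>0$, then (for any $\varepsilon>0$) $$\mathbb P(S_n-\lfloor b_n\rfloor=x_n)\sim\mathbb P\big(S_n-\lfloor b_n\rfloor=x_n,\ |M_n-x_n|\le\varepsilon x_n\big)\sim n\,\mathbb P(\xi=x_n).$$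
   Context: $\xi$ is an integer-valued random variable, $\xi_1,\xi_2,\dots$ are i.i.d. copies, $S_n=\sum_{i=1}^n\xi_i$ (assumed aperiodic, which is automatic under the regular variation assumption), $M_n=\max\{\xi_1,\dots,\xi_n\}$. Setting "$\alpha=2$": $\xi$ has a finite expectation $\mu=\mathbb E[\xi]$, and the truncated variance $\sigma^2(x)=\mathbb E[(\xi-\mu)^2\mathbf 1_{\{|\xi-\mu|\le x\}}]$ is slowly varying as $x\to\infty$ (the variance may be finite or infinite). $(a_n)$ is a normalising sequence, i.e. $\sigma^2(a_n)a_n^{-2}\sim n^{-1}$; $b_n=n\mu$. $(x_n)$ is a sequence of positive integers. Threshold: $r:(0,\infty)\to\mathbb R_+$ is a function satisfying $\frac{r(t)}{\sigma^2(r(t))}\sim t$ as $t\to\infty$ (so that $r(t)\to\infty$), and $r_n=r(n/x_n)$. Thus if $x_n/n\to0$ then $r_n\to\infty$ and $\frac{r_n}{\sigma^2(r_n)}\sim\frac{n}{x_n}$. A function $f$ is intermediate regularly varying if $\lim_{\lambda\downarrow1}\liminf_{x\to\infty}\frac{f(\lambda x)}{f(x)}=\lim_{\lambda\downarrow1}\limsup_{x\to\infty}\frac{f(\lambda x)}{f(x)}=1$; for $x\mapsto\mathbb P(\xi=x)$ this is read with $f(x)=\mathbb P(\xi=\lfloor x\rfloor)$. In the limsup condition, $x,y$ range over integers.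
   Formalization: In the case x_n/a_n→∞, x_n/n→0, the first equivalence is stated for 0<ε<1 only: for ε≥1 the event |M_n−x_n|≤εx_n can contain the Gaussian bulk (e.g. P(ξ=k)~c|k|^-5 symmetric, x_n~√n log log n), and the printed claim fails. *)

theory Defs
  imports "HOL-Probability.Probability" "HOL-Library.Landau_Symbols"
begin

(* Division by zero gives 0, so the limit forces L to be eventually nonzero. *)
definition slowly_varying :: "(real \<Rightarrow> real) \<Rightarrow> bool" where
  "slowly_varying L \<longleftrightarrow> (\<forall>l>0. ((\<lambda>x. L (l * x) / L x) \<longlongrightarrow> 1) at_top)"

(* The quotient is taken in ereal, where a / 0 = \<infinity> for a > 0 and 0 / 0 = 0;
   hence the two limits force f to be eventually nonzero. *)
definition intermediate_regularly_varying :: "(real \<Rightarrow> real) \<Rightarrow> bool" where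
  "intermediate_regularly_varying f \<longleftrightarrow>
     ((\<lambda>l. Liminf at_top (\<lambda>x. ereal (f (l * x)) / ereal (f x))) \<longlongrightarrow> 1) (at_right 1) \<and>
     ((\<lambda>l. Limsup at_top (\<lambda>x. ereal (f (l * x)) / ereal (f x))) \<longlongrightarrow> 1) (at_right 1)"

definition mean :: "'a measure \<Rightarrow> ('a \<Rightarrow> int) \<Rightarrow> real" where
  "mean M \<xi> = (\<integral>\<omega>. real_of_int (\<xi> \<omega>) \<partial>M)"

definition trunc_var :: "'a measure \<Rightarrow> ('a \<Rightarrow> int) \<Rightarrow> real \<Rightarrow> real" where
  "trunc_var M \<xi> x =
     (\<integral>\<omega>. (real_of_int (\<xi> \<omega>) - mean M \<xi>)\<^sup>2 *
          indicator {\<omega>. \<bar>real_of_int (\<xi> \<omega>) - mean M \<xi>\<bar> \<le> x} \<omega> \<partial>M)"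

definition partial_sum :: "(nat \<Rightarrow> 'a \<Rightarrow> int) \<Rightarrow> nat \<Rightarrow> 'a \<Rightarrow> int" where
  "partial_sum X n \<omega> = (\<Sum>i=1..n. X i \<omega>)"

(* Unspecified for n = 0; only the behaviour for n \<rightarrow> \<infinity> is ever used. *)
definition partial_max :: "(nat \<Rightarrow> 'a \<Rightarrow> int) \<Rightarrow> nat \<Rightarrow> 'a \<Rightarrow> int" where
  "partial_max X n \<omega> = Max ((\<lambda>i. X i \<omega>) ` {1..n})"

end

theory Submission
  imports Defs "HOL-Real_Asymp.Real_Asymp"
begin

text \<open>
  Splitting off one summand gives
  \<open>P(S = s, X\<^sub>i \<in> B, X\<^sub>j \<in> A for j \<noteq> i) \<le> sup\<^sub>B p \<cdot> P(s - S' \<in> B, X\<^sub>j \<in> A for j \<noteq> i)\<close>, where \<open>p k = P(\<xi> = k)\<close> and \<open>S'\<close>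
  is the sum of the other variables; the reverse inequality holds with an infimum.
  If \<open>B\<close> is a window of width \<open>2hx\<close> around \<open>x\<close>, then \<open>p\<close> is nearly constant on \<open>B\<close> and the last probability tends to
  \<open>1\<close> by the weak law, whence the main term \<open>n p(x)\<close>. A jump that is comparable to \<open>x\<close> but outside
  this window violates the weak law for \<open>S'\<close> and has \<open>p \<le> C p(x)\<close>. A maximum in \<open>(x/2\<^sup>j\<^sup>+\<^sup>1, x/2\<^sup>j]\<close>
  gains a factor \<open>D\<^sup>j\<close> in \<open>p\<close>, which is beaten by the Chernoff bound \<open>exp(-2\<^sup>j/256)\<close> for \<open>S'\<close> truncated at
  \<open>x/2\<^sup>j\<close>. That bound needs \<open>n V(y)/y \<le> 4x\<close> at \<open>y = x/2\<^sup>j\<close>, with \<open>V\<close> the truncated variance: this is what the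
  threshold \<open>r\<^sub>n\<close> guarantees. If \<open>x\<close> is at least linear in \<open>n\<close>, then \<open>\<surd>x\<close> can serve as the threshold, because
  \<open>V(y)/y\<close> tends to \<open>0\<close>, and below it the Chernoff bound beats the polynomial lower bound for \<open>p\<close>.
\<close>

section \<open>Intermediate regular variation\<close>

text \<open>No local limit theorem enters: after the splitting, the weight \<open>p\<close> carries
  the local information, and the remaining sum \<open>S'\<close> needs only tail estimates that are
  uniform over its index set. Both regimes reduce to the single condition
  \<open>n V(x) / x^2 --> 0\<close>, under which \<open>S'\<close>, centred, is \<open>o(x)\<close>
  in probability; every probability is then compared with \<open>n p(x)\<close>.

  The hypotheses on \<open>p\<close> concern only its right tail. The left tail is controlled by
  slow variation of \<open>V\<close>, which does two things. It makes \<open>V(y)/y\<close> almost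
  decreasing, so that the cost condition at \<open>r_n\<close> passes to all larger levels. It also
  makes the first absolute moment beyond \<open>y\<close> of order \<open>o(V(y)/y)\<close>, a
  Karamata-type estimate that keeps the linear term in the Chernoff exponent below the quadratic
  one. The \<open>4\<close> in the cost condition is a factor \<open>2\<close> because
  \<open>V(y)/y\<close> is only almost decreasing, times a factor \<open>2\<close> because
  \<open>r_n\<close> solves its equation only asymptotically.\<close>

lemma irv_pointwise:
  fixes p :: "int \<Rightarrow> real"
  assumes irv: "intermediate_regularly_varying (\<lambda>u. p \<lfloor>u\<rfloor>)" and p: "\<And>k. 0 \<le> p k" and \<delta>: "0 < \<delta>" "\<delta> < 1"
  shows "\<exists>h>0. \<forall>l::real. 1 < l \<and> l < 1 + h \<longrightarrow>
    (\<exists>N::nat. \<forall>k::int. int N \<le> k \<longrightarrow> (1 - \<delta>) * p k \<le> p \<lfloor>l * k\<rfloor> \<and> p \<lfloor>l * k\<rfloor> \<le> (1 + \<delta>) * p k \<and> 0 < p k)"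
proof -
  define q where "q = (\<lambda>l x::real. ereal (p \<lfloor>l * x\<rfloor>) / ereal (p \<lfloor>x\<rfloor>))"
  have 1: "((\<lambda>l. Liminf at_top (q l)) \<longlongrightarrow> 1) (at_right 1)" "((\<lambda>l. Limsup at_top (q l)) \<longlongrightarrow> 1) (at_right 1)"
    using irv by (auto simp: intermediate_regularly_varying_def q_def)
  have "eventually (\<lambda>l. Liminf at_top (q l) > ereal (1 - \<delta>) \<and> Limsup at_top (q l) < ereal (1 + \<delta>)) (at_right 1)"
    using order_tendstoD(1)[OF 1(1), of "ereal (1-\<delta>)"] order_tendstoD(2)[OF 1(2), of "ereal (1+\<delta>)"] \<delta>
    by (auto simp: eventually_conj_iff one_ereal_def)
  then obtain b where b: "b > 1" "\<And>l. l > 1 \<Longrightarrow> l < b \<Longrightarrow> Liminf at_top (q l) > ereal (1 - \<delta>) \<and> Limsup at_top (q l) < ereal (1 + \<delta>)"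
    by (auto simp: eventually_at_right_field)
  show ?thesis
  proof (intro exI[of _ "b - 1"] conjI allI impI)
    fix l assume l: "1 < l \<and> l < 1 + (b - 1)"
    have "eventually (\<lambda>x. q l x > ereal (1 - \<delta>) \<and> q l x < ereal (1 + \<delta>)) at_top"
      using b(2)[of l] l by (auto intro: eventually_conj less_LiminfD Limsup_lessD)
    then obtain K where K: "\<And>x. x \<ge> K \<Longrightarrow> q l x > ereal (1 - \<delta>) \<and> q l x < ereal (1 + \<delta>)"
      by (auto simp: eventually_at_top_linorder)
    show "\<exists>N::nat. \<forall>k::int. int N \<le> k \<longrightarrow> (1 - \<delta>) * p k \<le> p \<lfloor>l * k\<rfloor> \<and> p \<lfloor>l * k\<rfloor> \<le> (1 + \<delta>) * p k \<and> 0 < p k"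
    proof (intro exI[of _ "nat \<lceil>K\<rceil>"] allI impI)
      fix k :: int assume "int (nat \<lceil>K\<rceil>) \<le> k"
      then have "K \<le> real_of_int k" by linarith
      from K[OF this] have Q: "ereal (p \<lfloor>l * k\<rfloor>) / ereal (p k) > ereal (1 - \<delta>)" "ereal (p \<lfloor>l * k\<rfloor>) / ereal (p k) < ereal (1 + \<delta>)"
        unfolding q_def floor_of_int by blast+
      \<comment> \<open>A zero of \<open>p\<close> at \<open>k\<close> would make the extended
        quotient \<open>0\<close> or \<open>\<infinity>\<close>; the lower bound excludes the former
        and the upper bound the latter.\<close>
      have pos: "p k > 0"
      proof (rule ccontr)
        assume "\<not> 0 < p k" then have z: "p k = 0" using p[of k] by simp
        show False
        proof (cases "p \<lfloor>l * k\<rfloor> = 0")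
          case True
          then have "ereal (p \<lfloor>l * k\<rfloor>) / ereal (p k) = ereal 0" using z by simp
          then show False using Q(1) \<delta> by simp
        next
          case False
          then have "p \<lfloor>l * k\<rfloor> > 0" using p[of "\<lfloor>l * k\<rfloor>"] by simp
          then have "ereal (p \<lfloor>l * k\<rfloor>) / ereal (p k) = \<infinity>" using z by (simp add: divide_ereal_def)
          then show False using Q(2) by simp
        qed
      qed
      then show "(1 - \<delta>) * p k \<le> p \<lfloor>l * k\<rfloor> \<and> p \<lfloor>l * k\<rfloor> \<le> (1 + \<delta>) * p k \<and> 0 < p k"
        using Q by (auto simp: field_simps)
    qed
  qed (use b in auto)
qed

text \<open>The hypothesis gives a threshold for \<open>x\<close> that depends on \<open>l\<close>. It becomes uniform because the set \<open>A\<close> of ratios \<open>l\<close>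
  with threshold at most \<open>m\<close> nearly exhausts an interval \<open>(1, 1 + h)\<close>, so that it meets its dilation by \<open>t\<close> for \<open>t\<close> close
  to \<open>1\<close>: for \<open>u \<in> A \<inter> tA\<close> both \<open>p k\<close> and \<open>p (t k)\<close> are close to \<open>p \<lfloor>u k\<rfloor>\<close>.\<close>

lemma irv_one_sided:
  fixes p :: "int \<Rightarrow> real"
  assumes irv: "intermediate_regularly_varying (\<lambda>u. p \<lfloor>u\<rfloor>)" and p: "\<And>k. 0 \<le> p k" and \<delta>: "0 < \<delta>" "\<delta> < 1"
  shows "\<exists>h>0::real. \<exists>N>0. \<forall>k l::int. N \<le> k \<longrightarrow> k \<le> l \<longrightarrow> real_of_int l \<le> (1 + h) * real_of_int k \<longrightarrow>
    p l \<le> (1 + \<delta>) * p k \<and> p k \<le> (1 + \<delta>) * p l \<and> 0 < p k"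
proof -
  obtain h1 where h1: "h1 > 0" "\<And>l::real. 1 < l \<Longrightarrow> l < 1 + h1 \<Longrightarrow>
    (\<exists>N::nat. \<forall>k::int. int N \<le> k \<longrightarrow> (1 - \<delta>/3) * p k \<le> p \<lfloor>l * k\<rfloor> \<and> p \<lfloor>l * k\<rfloor> \<le> (1 + \<delta>/3) * p k \<and> 0 < p k)"
    using irv_pointwise[OF irv p, of "\<delta>/3"] \<delta> by auto
  define h0 where "h0 = min h1 1"
  have h0: "h0 > 0" "h0 \<le> 1" "h0 \<le> h1" using h1(1) by (auto simp: h0_def)
  define G where "G = (\<lambda>l (k::int). (1 - \<delta>/3) * p k \<le> p \<lfloor>l * real_of_int k\<rfloor> \<and> p \<lfloor>l * real_of_int k\<rfloor> \<le> (1 + \<delta>/3) * p k \<and> 0 < p k)"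
  define A where "A = (\<lambda>m::nat. {l\<in>{1<..<1+h0}. \<forall>k. int m \<le> k \<longrightarrow> G l k})"
  have "(\<lambda>l. p \<lfloor>l * real_of_int k\<rfloor>) \<in> borel_measurable borel" for k by measurable
  then have [measurable]: "A m \<in> sets borel" for m unfolding A_def G_def by measurable
  have incA: "incseq A" by (auto simp: incseq_def A_def)
  have UA: "(\<Union>m. A m) = {1<..<1+h0}"
  proof (intro equalityI subsetI)
    fix l assume "l \<in> {1<..<1+h0}"
    moreover from this h1(2)[of l] h0(3) obtain N where "\<forall>k. int N \<le> k \<longrightarrow> G l k" by (auto simp: G_def)
    ultimately show "l \<in> (\<Union>m. A m)" by (auto simp: A_def)
  qed (auto simp: A_def)
  have "(\<lambda>m. emeasure lborel (A m)) \<longlonglongrightarrow> emeasure lborel (\<Union>m. A m)"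
    by (rule Lim_emeasure_incseq[OF _ incA]) auto
  then have "(\<lambda>m. emeasure lborel (A m)) \<longlonglongrightarrow> ennreal h0"
    unfolding UA using h0 by simp
  then have "eventually (\<lambda>m. ennreal (h0 * 0.9) < emeasure lborel (A m)) sequentially"
    by (rule order_tendstoD(1)) (use h0 in \<open>auto intro!: ennreal_lessI\<close>)
  then obtain m where m: "ennreal (h0 * 0.9) < emeasure lborel (A m)"
    by (auto simp: eventually_sequentially)
  show ?thesis
  proof (intro exI[of _ "h0/8"] conjI exI[of _ "int m + 1"] allI impI)
    fix k l :: int assume kl: "int m + 1 \<le> k" "k \<le> l" "real_of_int l \<le> (1 + h0/8) * real_of_int k"
    define t where "t = real_of_int l / real_of_int k"
    have t: "1 \<le> t" "t \<le> 1 + h0 / 8" using kl by (auto simp: t_def field_simps)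
    have kpos: "k > 0" "l > 0" using kl by auto
    define B where "B = {u. u / t \<in> A m}"
    have [measurable]: "B \<in> sets borel" unfolding B_def using t by measurable
    have "emeasure lborel B = ennreal \<bar>t\<bar> * (\<integral>\<^sup>+u. indicator B (0 + t * u) \<partial>lborel)"
      using nn_integral_real_affine[of "indicator B" t 0] t by simp
    also have "(\<lambda>u. indicator B (0 + t * u)) = (indicator (A m) :: real \<Rightarrow> ennreal)"
      using t by (auto simp: B_def fun_eq_iff indicator_def)
    finally have "emeasure lborel B = ennreal t * emeasure lborel (A m)" using t by simp
    moreover have "1 * emeasure lborel (A m) \<le> ennreal t * emeasure lborel (A m)"
      by (rule mult_right_mono) (use t in auto)
    ultimately have EB: "emeasure lborel (A m) \<le> emeasure lborel B" by simp
    have "A m \<inter> B \<noteq> {}"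
    proof
      assume disj: "A m \<inter> B = {}"
      have "A m \<union> B \<subseteq> {1<..<(1+h0/8)*(1+h0)}"
      proof
        fix u assume "u \<in> A m \<union> B"
        then consider "u \<in> A m" | "u \<in> B" by auto
        then show "u \<in> {1<..<(1+h0/8)*(1+h0)}"
        proof cases
          case 1
          have "1 + h0 \<le> (1+h0/8)*(1+h0)" using h0 by (simp add: algebra_simps)
          moreover have "1 < u" "u < 1 + h0" using 1 unfolding A_def by auto
          ultimately show ?thesis unfolding greaterThanLessThan_iff by linarith
        next
          case 2
          then have "1 < u / t" "u / t < 1 + h0" by (auto simp: B_def A_def)
          then have "t < u" "u < t * (1 + h0)" using t by (auto simp: field_simps)
          moreover have "t * (1 + h0) \<le> (1 + h0/8) * (1 + h0)" using t h0 by (intro mult_right_mono) auto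
          ultimately show ?thesis using t unfolding greaterThanLessThan_iff by linarith
        qed
      qed
      then have "emeasure lborel (A m \<union> B) \<le> emeasure lborel {1<..<(1+h0/8)*(1+h0)}"
        by (intro emeasure_mono) auto
      also have "\<dots> = ennreal ((1+h0/8)*(1+h0) - 1)"
        using h0 by (intro emeasure_lborel_Ioo) (auto simp: algebra_simps intro: add_nonneg_nonneg)
      also have "\<dots> \<le> ennreal (h0 * 1.25)"
        using h0 by (intro ennreal_leI) (auto simp: algebra_simps)
      finally have "emeasure lborel (A m) + emeasure lborel B \<le> ennreal (h0 * 1.25)"
        using disj by (subst (asm) plus_emeasure[symmetric]) auto
      then have "ennreal (h0 * 0.9) + ennreal (h0 * 0.9) \<le> ennreal (h0 * 1.25)"
        using m EB by (meson add_mono less_imp_le order_trans)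
      then have "ennreal (h0 * 0.9 + h0 * 0.9) \<le> ennreal (h0 * 1.25)"
        using h0 by (subst ennreal_plus) auto
      then show False using h0 by (subst (asm) ennreal_le_iff) auto
    qed
    then obtain u where u: "u \<in> A m" "u / t \<in> A m" by (auto simp: B_def)
    have 1: "G u k" "G (u / t) l" using u kl by (auto simp: A_def)
    have "u / t * real_of_int l = u * real_of_int k" using kpos by (simp add: t_def)
    with 1 have g: "(1 - \<delta>/3) * p k \<le> p \<lfloor>u * k\<rfloor>" "p \<lfloor>u * k\<rfloor> \<le> (1 + \<delta>/3) * p k" "0 < p k"
        "(1 - \<delta>/3) * p l \<le> p \<lfloor>u * k\<rfloor>" "p \<lfloor>u * k\<rfloor> \<le> (1 + \<delta>/3) * p l" "0 < p l"
      by (auto simp: G_def)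
    \<comment> \<open>The reason for starting from \<open>\<delta>/3\<close>: \<open>p k\<close> and
      \<open>p l\<close> are compared through the same value
      \<open>p \<lfloor>u * k\<rfloor>\<close>, and the two errors combine to at most
      \<open>1 + \<delta>\<close>.\<close>
    have d: "(1 + \<delta>/3) \<le> (1 - \<delta>/3) * (1 + \<delta>)"
    proof -
      have "\<delta> * \<delta> \<le> \<delta> * 1" using \<delta> by (intro mult_left_mono) auto
      moreover have "(1 - \<delta>/3) * (1 + \<delta>) = 1 + 2 * \<delta> / 3 - (\<delta> * \<delta>) / 3" by (simp add: field_simps)
      ultimately show ?thesis by linarith
    qed
    have "(1 - \<delta>/3) * p l \<le> (1 - \<delta>/3) * ((1 + \<delta>) * p k)"
      using g order_trans[OF _ mult_right_mono[OF d, of "p k"]] unfolding mult.assoc by (meson less_imp_le order_trans)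
    moreover have "(1 - \<delta>/3) * p k \<le> (1 - \<delta>/3) * ((1 + \<delta>) * p l)"
      using g order_trans[OF _ mult_right_mono[OF d, of "p l"]] unfolding mult.assoc by (meson less_imp_le order_trans)
    ultimately show "p l \<le> (1 + \<delta>) * p k" "p k \<le> (1 + \<delta>) * p l" "0 < p k"
      using \<delta> g by (auto simp: mult_le_cancel_left)
  qed (use h0 in auto)
qed

text \<open>For \<open>l\<close> below \<open>k\<close> the one-sided comparison is used with the
  roles exchanged. The choice \<open>h' \<le> 1/2\<close> keeps \<open>l\<close> above
  \<open>k/2\<close>, whence the threshold \<open>2*N\<close>, and \<open>h' \<le> h/4\<close> turns
  a distance measured against \<open>k\<close> into one measured against \<open>l\<close>.\<close>

lemma irv_uniform:
  fixes p :: "int \<Rightarrow> real"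
  assumes irv: "intermediate_regularly_varying (\<lambda>u. p \<lfloor>u\<rfloor>)" and p: "\<And>k. 0 \<le> p k" and \<delta>: "0 < \<delta>" "\<delta> < 1"
  shows "\<exists>h>0::real. \<exists>N>0. \<forall>k l::int. N \<le> k \<longrightarrow> \<bar>real_of_int l - k\<bar> \<le> h * k \<longrightarrow>
    (1 - \<delta>) * p k \<le> p l \<and> p l \<le> (1 + \<delta>) * p k \<and> 0 < p k"
proof -
  obtain h N where hN: "h > 0" "N > 0" "\<And>k l::int. N \<le> k \<Longrightarrow> k \<le> l \<Longrightarrow> real_of_int l \<le> (1 + h) * real_of_int k \<Longrightarrow>
    p l \<le> (1 + \<delta>) * p k \<and> p k \<le> (1 + \<delta>) * p l \<and> 0 < p k"
    using irv_one_sided[OF assms] by blast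
  define h' where "h' = min (h/2) (min (h/4) (1/2))"
  have h': "h' > 0" "h' \<le> 1/2" "h' \<le> h" "h' \<le> h / 4" using hN by (auto simp: h'_def)
  show ?thesis
  proof (intro exI[of _ h'] exI[of _ "2*N"] conjI allI impI)
    fix k l :: int assume kl: "2*N \<le> k" "\<bar>real_of_int l - k\<bar> \<le> h' * k"
    have lower: "(1 - \<delta>) * a \<le> b" if "a \<le> (1 + \<delta>) * b" "0 \<le> b" for a b
    proof -
      have "(1 - \<delta>) * a \<le> (1 - \<delta>) * ((1 + \<delta>) * b)" using that \<delta> by (intro mult_left_mono) auto
      also have "\<dots> = b - \<delta>^2 * b" by (simp add: algebra_simps power2_eq_square)
      also have "\<dots> \<le> b" using that by simp
      finally show ?thesis .
    qed
    have "h' * k \<le> 1/2 * k" using kl h' hN by (intro mult_right_mono) auto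
    then have l: "real_of_int l \<ge> k / 2" using kl by linarith
    then have lN: "l \<ge> N" using kl by linarith
    have "(1 - \<delta>) * p k \<le> p l \<and> p l \<le> (1 + \<delta>) * p k \<and> 0 < p k"
    proof (cases "k \<le> l")
      case True
      have "h' * k \<le> h * k" using kl h' hN by (intro mult_right_mono) auto
      then have "real_of_int l \<le> (1 + h) * real_of_int k" using kl by (simp add: algebra_simps)
      then show ?thesis using hN(3)[of k l] True kl hN lower[of "p k" "p l"] p by auto
    next
      case False
      have "h' * k \<le> h / 4 * k" using kl h' hN by (intro mult_right_mono) auto
      also have "\<dots> \<le> h * l" using l hN(1,2) kl by (auto simp: field_simps)
      finally have "k \<le> (1 + h) * l" using kl by (simp add: algebra_simps)
      then have 1: "p k \<le> (1 + \<delta>) * p l \<and> p l \<le> (1 + \<delta>) * p k \<and> 0 < p l" using hN(3)[of l k] False lN by auto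
      then have "0 < (1 + \<delta>) * p k" by linarith
      then have "0 < p k" using \<delta> by (simp add: zero_less_mult_iff)
      then show ?thesis using 1 lower[of "p k" "p l"] p by auto
    qed
    then show "(1 - \<delta>) * p k \<le> p l" "p l \<le> (1 + \<delta>) * p k" "0 < p k" by auto
  qed (use h' hN in auto)
qed

text \<open>Upwards from \<open>k\<close> to \<open>x\<close> one walks in steps of ratio at least
  \<open>1 + h/2\<close>, each losing at most a factor \<open>2\<close>; a fixed number
  \<open>n\<close> of steps covers a doubling, so \<open>2 ^ n\<close> per doubling suffices. If
  \<open>x\<close> lies below \<open>k\<close>, almost monotonicity gives the factor
  \<open>D0\<close>, and the exponent \<open>j + 1\<close> leaves room for it even when
  \<open>j = 0\<close>.\<close>

lemma irv_doubling:
  fixes p :: "int \<Rightarrow> real"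
  assumes irv: "intermediate_regularly_varying (\<lambda>u. p \<lfloor>u\<rfloor>)" and p: "\<And>k. 0 \<le> p k"
    and mono: "\<And>k l. N0 \<le> k \<Longrightarrow> k \<le> l \<Longrightarrow> p l \<le> D0 * p k"
  shows "\<exists>D\<ge>1. \<exists>N>0. \<forall>k x :: int. \<forall>j. N \<le> k \<longrightarrow> N \<le> x \<longrightarrow> x \<le> 2 ^ j * k \<longrightarrow> p k \<le> D ^ (j + 1) * p x"
proof -
  obtain h N1 where hN: "h > 0" "N1 > 0" "\<And>k l::int. N1 \<le> k \<Longrightarrow> \<bar>real_of_int l - k\<bar> \<le> h * k \<Longrightarrow>
    p l \<le> (3/2) * p k \<and> (1/2) * p k \<le> p l"
    using irv_uniform[OF irv p, of "1/2"] by force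
  define N where "N = max N0 (max N1 \<lceil>2/h\<rceil>)"
  have N: "N \<ge> N0" "N \<ge> N1" "N > 0" "real_of_int N \<ge> 2 / h" using hN unfolding N_def
    by (auto simp: le_max_iff_disj of_int_max intro!: le_of_int_ceiling)
  have chain: "p k \<le> 2 ^ i * p x" if "N \<le> k" "k \<le> x" "real_of_int x \<le> (1 + h/2) ^ i * k" for i and k x :: int
    using that
  proof (induction i arbitrary: k)
    case 0 then have "x = k" by simp
    then show ?case by simp
  next
    case (Suc i)
    show ?case
    proof (cases "real_of_int x \<le> (1 + h) * k")
      case True
      have "(1/2) * p k \<le> p x" using hN(3)[of k x] N Suc.prems True by (auto simp: algebra_simps)
      then have "p k \<le> 2 * p x" by simp
      also have "\<dots> \<le> 2 ^ Suc i * p x" using p[of x] by (intro mult_right_mono) auto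
      finally show ?thesis .
    next
      case False
      \<comment> \<open>Rounding down loses less than \<open>1\<close>, while
        \<open>h * k \<ge> 2\<close> because \<open>N \<ge> 2/h\<close>; so the step still has ratio
        at least \<open>1 + h/2\<close>.\<close>
      define k' where "k' = \<lfloor>(1 + h) * k\<rfloor>"
      have hk: "h * k \<ge> 2" using Suc.prems N(4) hN(1)
        by (smt (verit, best) divide_le_eq mult.commute of_int_le_iff)
      have k': "real_of_int k' \<le> (1 + h) * k" "(1 + h/2) * k \<le> k'"
        unfolding k'_def using hk by (simp) (use hk in \<open>simp add: algebra_simps; linarith\<close>)
      have kk: "k \<le> k'" using k'(2) hk by (simp add: algebra_simps)
      have "\<bar>real_of_int k' - k\<bar> \<le> h * k" using k' kk by (simp add: algebra_simps)
      then have "(1/2) * p k \<le> p k'" using hN(3)[of k k'] N Suc.prems by auto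
      moreover have "p k' \<le> 2 ^ i * p x"
      proof (rule Suc.IH)
        show "k' \<le> x" using k' False by linarith
        have "real_of_int x \<le> (1 + h/2) ^ i * ((1 + h/2) * k)" using Suc.prems by (simp add: mult_ac)
        also have "\<dots> \<le> (1 + h/2) ^ i * k'" using k' hN by (intro mult_left_mono) auto
        finally show "real_of_int x \<le> (1 + h/2) ^ i * k'" .
      qed (use kk Suc.prems in auto)
      ultimately show ?thesis by simp
    qed
  qed
  obtain n where n: "2 \<le> (1 + h/2) ^ n" using real_arch_pow[of "1 + h/2" 2] hN(1) by (force intro: less_imp_le)
  define D where "D = max (2 ^ n) D0"
  have D: "D \<ge> 2 ^ n" "D \<ge> D0" "D \<ge> 1"
    by (auto simp: D_def le_max_iff_disj)
  show ?thesis
  proof (intro exI[of _ D] exI[of _ N] conjI allI impI)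
    fix k x :: int and j assume a: "N \<le> k" "N \<le> x" "x \<le> 2 ^ j * k"
    show "p k \<le> D ^ (j + 1) * p x"
    proof (cases "k \<le> x")
      case True
      have "real_of_int x \<le> 2 ^ j * real_of_int k" using a(3) by (metis of_int_le_iff of_int_mult of_int_numeral of_int_power)
      also have "\<dots> \<le> ((1 + h/2) ^ n) ^ j * real_of_int k"
        using n a N by (intro mult_right_mono power_mono) auto
      finally have "p k \<le> 2 ^ (n * j) * p x" using chain[of k x "n*j"] a True by (simp add: power_mult)
      also have "2 ^ (n * j) = ((2::real) ^ n) ^ j" by (simp add: power_mult)
      also have "\<dots> \<le> D ^ j" using D by (intro power_mono) auto
      also have "\<dots> \<le> D ^ (j+1)" using D by (intro power_increasing) auto
      finally show ?thesis using p[of x] by (auto simp: mult_right_mono)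
    next
      case False
      have "p k \<le> D0 * p x" using mono[of x k] False a N by auto
      also have "\<dots> \<le> D ^ (j+1) * p x"
      proof (rule mult_right_mono[OF _ p])
        have "D0 \<le> D ^ 1" using D by simp
        also have "\<dots> \<le> D ^ (j+1)" using D by (intro power_increasing) auto
        finally show "D0 \<le> D ^ (j+1)" .
      qed
      finally show ?thesis .
    qed
  qed (use D N in auto)
qed

text \<open>The denominator of the extended quotient can be cleared only where \<open>p k\<close> is
  positive; intermediate regular variation supplies this for large \<open>k\<close>.\<close>

lemma limsup_almost_monotone:
  fixes p :: "int \<Rightarrow> real"
  assumes L: "Limsup at_top (\<lambda>k::int. (SUP l\<in>{k..}. ereal (p l)) / ereal (p k)) < \<infinity>" and p: "\<And>k. 0 \<le> p k"
    and pos: "\<And>k. N1 \<le> k \<Longrightarrow> 0 < p k"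
  shows "\<exists>N0 D0. \<forall>k l. N0 \<le> k \<longrightarrow> k \<le> l \<longrightarrow> p l \<le> D0 * p k"
proof -
  obtain D where D: "Limsup at_top (\<lambda>k::int. (SUP l\<in>{k..}. ereal (p l)) / ereal (p k)) < ereal D"
    using ereal_dense2[OF L] by auto
  from Limsup_lessD[OF D] obtain N2 where N2: "\<And>k. N2 \<le> k \<Longrightarrow> (SUP l\<in>{k..}. ereal (p l)) / ereal (p k) < ereal D"
    by (auto simp: eventually_at_top_linorder)
  show ?thesis
  proof (intro exI[of _ "max N1 N2"] exI[of _ D] allI impI)
    fix k l assume kl: "max N1 N2 \<le> k" "k \<le> l"
    have pk: "p k > 0" using pos kl by auto
    have "ereal (p l) / ereal (p k) \<le> (SUP l\<in>{k..}. ereal (p l)) / ereal (p k)"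
      by (rule ereal_divide_right_mono) (use kl pk in \<open>auto intro: SUP_upper\<close>)
    also have "\<dots> < ereal D" using N2 kl by auto
    finally show "p l \<le> D * p k" using pk by (simp add: field_simps)
  qed
qed

section \<open>Truncated moments\<close>

text \<open>\<open>V y / y\<close> does not increase along \<open>y, 2 * y, 4 * y, ...\<close>;
  between two consecutive dyadic points, monotonicity of \<open>V\<close> costs one further factor
  \<open>2\<close>.\<close>

lemma almost_halving_le:
  fixes V :: "real \<Rightarrow> real"
  assumes V: "\<And>y. y0 \<le> y \<Longrightarrow> V (2 * y) \<le> 2 * V y" and mono: "mono V" and y0: "0 < y0"
    and y: "y0 \<le> y" "y \<le> y'" and nn: "\<And>y. 0 \<le> V y"
  shows "V y' / y' \<le> 2 * (V y / y)"
proof -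
  have pow: "V (2 ^ i * y) \<le> 2 ^ i * V y" for i
  proof (induction i)
    case (Suc i)
    have "1 * y \<le> 2 ^ i * y" using y y0 by (intro mult_right_mono) auto
    then have "V (2 * (2 ^ i * y)) \<le> 2 * V (2 ^ i * y)" using y by (intro V) auto
    with Suc show ?case by (simp add: mult_ac)
  qed simp
  have ypos: "y > 0" using y y0 by simp
  obtain n where n: "y' / y < 2 ^ n" using real_arch_pow[of 2 "y'/y"] by auto
  define i where "i = (LEAST i. y' / y < 2 ^ i)"
  have i: "y' / y < 2 ^ i" unfolding i_def by (rule LeastI[of _ n]) (rule n)
  have "i \<noteq> 0" using i y ypos by (intro notI) auto
  then obtain j where j: "i = Suc j" using not0_implies_Suc by blast
  have "\<not> y' / y < 2 ^ j" using not_less_Least[of j "\<lambda>i. y' / y < 2 ^ i"] j unfolding i_def by auto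
  then have lo: "2 ^ j * y \<le> y'" using ypos by (simp add: field_simps)
  have hi: "y' \<le> 2 ^ Suc j * y" using i j ypos by (simp add: field_simps)
  have "V y' \<le> V (2 ^ Suc j * y)" using monoD[OF mono hi] .
  also have "\<dots> \<le> 2 ^ Suc j * V y" by (rule pow)
  finally have 1: "V y' \<le> 2 ^ Suc j * V y" .
  have "V y' / y' \<le> (2 ^ Suc j * V y) / (2 ^ j * y)"
    by (rule frac_le) (use 1 lo ypos nn[of y] in auto)
  also have "\<dots> = 2 * (V y / y)" by simp
  finally show ?thesis .
qed

text \<open>Iterating the estimate for dyadic shells bounds the truncated first moment by a geometric series.\<close>

lemma tail_moment_le:
  fixes V \<tau> :: "real \<Rightarrow> real"
  assumes V: "\<And>y. y0 \<le> y \<Longrightarrow> V (2 * y) \<le> (1 + d) * V y" and d: "0 < d" "d \<le> 1/2"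
    and shell: "\<And>y. y0 \<le> y \<Longrightarrow> \<tau> y \<le> (V (2 * y) - V y) / y + \<tau> (2 * y)"
    and y0: "0 < y0" and lim: "(\<tau> \<longlongrightarrow> 0) at_top" and y: "y0 \<le> y" and nn: "\<And>y. 0 \<le> V y"
  shows "\<tau> y \<le> 4 * d * (V y / y)"
proof -
  have step: "\<tau> y \<le> 4 * d * (V y / y) + \<tau> (2 ^ i * y)" if "y0 \<le> y" for i y
    using that
  proof (induction i arbitrary: y)
    case 0
    then show ?case using d nn[of y] y0 by simp
  next
    case (Suc i)
    have yp: "y > 0" using Suc.prems y0 by simp
    have "\<tau> y \<le> (V (2 * y) - V y) / y + \<tau> (2 * y)" using shell Suc.prems by auto
    also have "(V (2 * y) - V y) / y \<le> d * (V y / y)"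
      using divide_right_mono[of "V (2 * y) - V y" "d * V y" y] V[OF Suc.prems] yp by (simp add: algebra_simps)
    also have "\<tau> (2 * y) \<le> 4 * d * (V (2 * y) / (2 * y)) + \<tau> (2 ^ i * (2 * y))"
      using Suc.prems yp by (intro Suc.IH) auto
    also have "4 * d * (V (2 * y) / (2 * y)) \<le> 4 * d * (((1 + d) * V y) / (2 * y))"
      using V[OF Suc.prems] yp d by (intro mult_left_mono divide_right_mono) auto
    also have "\<dots> = (2 * d * (1 + d)) * (V y / y)" by simp
    \<comment> \<open>Here \<open>d \<le> 1/2\<close> gives \<open>2 * (1 + d) \<le> 3\<close>; with
      the \<open>d\<close> of the current shell the total is \<open>4 * d\<close>, which closes the
      induction.\<close>
    also have "\<dots> \<le> 3 * d * (V y / y)"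
      using d nn[of y] yp by (intro mult_right_mono) (auto simp: algebra_simps)
    finally show ?case by (simp add: mult_ac algebra_simps)
  qed
  have "(\<lambda>i. \<tau> (2 ^ i * y)) \<longlonglongrightarrow> 0"
  proof (rule filterlim_compose[OF lim])
    show "filterlim (\<lambda>i. 2 ^ i * y) at_top sequentially"
      by (rule filterlim_at_top_mult_tendsto_pos[OF tendsto_const])
         (use y y0 in \<open>auto intro!: filterlim_at_top_mono[OF filterlim_real_sequentially] less_imp_le[OF of_nat_less_two_power]\<close>)
  qed
  then have "(\<lambda>i. 4 * d * (V y / y) + \<tau> (2 ^ i * y)) \<longlonglongrightarrow> 4 * d * (V y / y) + 0"
    by (intro tendsto_intros)
  then show ?thesis using step[OF y] by (intro LIMSEQ_le_const[of _ _ "\<tau> y"]) auto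
qed

lemma slowly_varying_doubling:
  assumes "slowly_varying L" "0 < d" and nn: "\<And>y. 0 \<le> L y"
  shows "eventually (\<lambda>y. L (2 * y) \<le> (1 + d) * L y \<and> 0 < L y) at_top"
proof -
  have "((\<lambda>x. L (2 * x) / L x) \<longlongrightarrow> 1) at_top" using assms by (auto simp: slowly_varying_def)
  then have "eventually (\<lambda>y. L (2 * y) / L y < 1 + d) at_top" "eventually (\<lambda>y. L (2 * y) / L y > 0) at_top"
    using assms(2) by (auto intro: order_tendstoD)
  then show ?thesis
  proof eventually_elim
    case (elim y)
    then have "L y \<noteq> 0" by auto
    then have "L y > 0" using nn[of y] by simp
    then show ?case using elim by (simp add: field_simps)
  qed
qed

section \<open>Sums of integer-valued i.i.d. variables\<close>

text \<open>For negative \<open>u\<close> it follows from \<open>exp u * (1 - u) \<le> 1\<close> and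
  \<open>(1 + u + u^2) * (1 - u) = 1 - u^3 \<ge> 1\<close>.\<close>

lemma exp_le_quadratic:
  fixes u :: real
  assumes "\<bar>u\<bar> \<le> 1"
  shows "exp u \<le> 1 + u + u\<^sup>2"
proof (cases "0 \<le> u")
  case True
  then show ?thesis using assms by (intro exp_bound) auto
next
  case False
  have "1 + (- u) \<le> exp (- u)" by (rule exp_ge_add_one_self)
  then have "exp u * (1 - u) \<le> 1" using mult_left_mono[of "1 - u" "exp (-u)" "exp u"] by (simp add: exp_minus)
  also have "1 \<le> (1 + u + u\<^sup>2) * (1 - u)"
  proof -
    have "(1 + u + u\<^sup>2) * (1 - u) = 1 + (- u) * u\<^sup>2" by (simp add: algebra_simps power2_eq_square)
    moreover have "(- u) * u\<^sup>2 \<ge> 0" using False by (intro mult_nonneg_nonneg) auto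
    ultimately show ?thesis by simp
  qed
  finally show ?thesis using False by (simp add: mult_le_cancel_right)
qed

lemma measurable_sum_count_space [measurable]:
  fixes f :: "'b \<Rightarrow> 'a \<Rightarrow> int"
  assumes [measurable]: "\<And>j. j \<in> J \<Longrightarrow> f j \<in> measurable N (count_space UNIV)"
  shows "(\<lambda>x. \<Sum>j\<in>J. f j x) \<in> measurable N (count_space UNIV)"
proof -
  have "(\<lambda>x. \<Sum>j\<in>J. f j x) = (\<lambda>x. \<lfloor>\<Sum>j\<in>J. real_of_int (f j x)\<rfloor>)"
    by (simp flip: of_int_sum)
  also have "\<dots> \<in> measurable N (count_space UNIV)" by measurable
  finally show ?thesis .
qed

locale iid_integers = prob_space M for M :: "'a measure" +
  fixes \<xi> :: "'a \<Rightarrow> int" and X :: "nat \<Rightarrow> 'a \<Rightarrow> int"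
  assumes \<xi>_meas [measurable]: "\<xi> \<in> measurable M (count_space UNIV)"
    and indep_X: "indep_vars (\<lambda>_. count_space UNIV) X {1..}"
    and distr_X: "\<And>i. i \<ge> 1 \<Longrightarrow> distr M (count_space UNIV) (X i) = distr M (count_space UNIV) \<xi>"
    and int_\<xi>: "integrable M (\<lambda>\<omega>. real_of_int (\<xi> \<omega>))"
begin

definition p :: "int \<Rightarrow> real" where "p k = prob {\<omega> \<in> space M. \<xi> \<omega> = k}"
definition \<mu> :: real where "\<mu> = mean M \<xi>"
definition V :: "real \<Rightarrow> real" where "V = trunc_var M \<xi>"
text \<open>The first moment is cut off from below because it is finite beyond every level, whereas
  the second moment there may be infinite.\<close>

definition \<tau> :: "real \<Rightarrow> real"
  where "\<tau> y = expectation (\<lambda>\<omega>. \<bar>real_of_int (\<xi> \<omega>) - \<mu>\<bar> * indicator {\<omega>. y < \<bar>real_of_int (\<xi> \<omega>) - \<mu>\<bar>} \<omega>)"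
text \<open>Arbitrary index sets are allowed because the argument removes the index of the big jump;
  \<open>T {1..n}\<close> is the full sum.\<close>

definition T :: "nat set \<Rightarrow> 'a \<Rightarrow> int" where "T J \<omega> = (\<Sum>j\<in>J. X j \<omega>)"

lemma p_nonneg: "0 \<le> p k" by (simp add: p_def)

lemma X_meas: "i \<ge> 1 \<Longrightarrow> X i \<in> measurable M (count_space UNIV)"
  using indep_X by (auto simp: indep_vars_def)

lemma prob_X:
  assumes "i \<ge> 1" shows "prob {\<omega> \<in> space M. X i \<omega> \<in> A} = prob {\<omega> \<in> space M. \<xi> \<omega> \<in> A}"
proof -
  have "prob {\<omega> \<in> space M. X i \<omega> \<in> A} = measure (distr M (count_space UNIV) (X i)) A"
    by (subst measure_distr[OF X_meas[OF assms]]) (auto intro: arg_cong[where f=prob])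
  also have "\<dots> = prob {\<omega> \<in> space M. \<xi> \<omega> \<in> A}"
    unfolding distr_X[OF assms] by (subst measure_distr) (auto intro: arg_cong[where f=prob])
  finally show ?thesis .
qed

lemma nn_integral_X:
  assumes "i \<ge> 1" shows "(\<integral>\<^sup>+\<omega>. f (X i \<omega>) \<partial>M) = (\<integral>\<^sup>+\<omega>. f (\<xi> \<omega>) \<partial>M)"
proof -
  have "(\<integral>\<^sup>+\<omega>. f (X i \<omega>) \<partial>M) = (\<integral>\<^sup>+k. f k \<partial>distr M (count_space UNIV) (X i))"
    by (subst nn_integral_distr[OF X_meas[OF assms]]) auto
  also have "\<dots> = (\<integral>\<^sup>+\<omega>. f (\<xi> \<omega>) \<partial>M)"
    unfolding distr_X[OF assms] by (subst nn_integral_distr) auto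
  finally show ?thesis .
qed

lemma T_meas: "J \<subseteq> {1..} \<Longrightarrow> T J \<in> measurable M (count_space UNIV)"
  unfolding T_def by (intro measurable_sum_count_space) (use X_meas in auto)

lemma V_eq: "V y = expectation (\<lambda>\<omega>. (real_of_int (\<xi> \<omega>) - \<mu>)\<^sup>2 * indicator {\<omega>. \<bar>real_of_int (\<xi> \<omega>) - \<mu>\<bar> \<le> y} \<omega>)"
  by (simp add: V_def trunc_var_def \<mu>_def)

lemma integrable_V: "integrable M (\<lambda>\<omega>. (real_of_int (\<xi> \<omega>) - \<mu>)\<^sup>2 * indicator {\<omega>. \<bar>real_of_int (\<xi> \<omega>) - \<mu>\<bar> \<le> y} \<omega>)"
proof (rule integrable_const_bound[where B="y\<^sup>2"])
  have "(real_of_int (\<xi> \<omega>) - \<mu>)\<^sup>2 * indicator {\<omega>. \<bar>real_of_int (\<xi> \<omega>) - \<mu>\<bar> \<le> y} \<omega> \<le> y\<^sup>2" for \<omega>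
    using power_mono[of "\<bar>real_of_int (\<xi> \<omega>) - \<mu>\<bar>" y 2] by (auto simp: indicator_def)
  then show "AE \<omega> in M. norm ((real_of_int (\<xi> \<omega>) - \<mu>)\<^sup>2 * indicator {\<omega>. \<bar>real_of_int (\<xi> \<omega>) - \<mu>\<bar> \<le> y} \<omega>) \<le> y\<^sup>2"
    by (intro AE_I2) simp
qed measurable

lemma integrable_dev: "integrable M (\<lambda>\<omega>. \<bar>real_of_int (\<xi> \<omega>) - \<mu>\<bar>)"
  using int_\<xi> by (intro integrable_abs Bochner_Integration.integrable_diff) auto

lemma integrable_\<tau>: "integrable M (\<lambda>\<omega>. \<bar>real_of_int (\<xi> \<omega>) - \<mu>\<bar> * indicator {\<omega>. y < \<bar>real_of_int (\<xi> \<omega>) - \<mu>\<bar>} \<omega>)"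
  by (rule Bochner_Integration.integrable_bound[OF integrable_dev]) (auto simp: indicator_def)

lemma V_nonneg: "0 \<le> V y" unfolding V_eq by (intro integral_nonneg_AE) auto
lemma \<tau>_nonneg: "0 \<le> \<tau> y" unfolding \<tau>_def by (intro integral_nonneg_AE) auto

lemma V_mono: "mono V"
  unfolding mono_def V_eq by (intro allI impI integral_mono integrable_V) (auto simp: indicator_def)

text \<open>Serves to exclude negative values of the normalising sequence and of the threshold
  wherever \<open>V\<close> does not vanish at them.\<close>

lemma V_neg: "y < 0 \<Longrightarrow> V y = 0"
  unfolding V_eq by (intro integral_eq_zero_AE) (auto simp: indicator_def)

text \<open>On the shell between \<open>y\<close> and \<open>2 * y\<close> the deviation is at most
  its square divided by \<open>y\<close>.\<close>

lemma \<tau>_shell: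
  assumes "0 < y"
  shows "\<tau> y \<le> (V (2 * y) - V y) / y + \<tau> (2 * y)"
proof -
  let ?g = "\<lambda>\<omega>. real_of_int (\<xi> \<omega>) - \<mu>"
  have "\<tau> y \<le> expectation (\<lambda>\<omega>. ((?g \<omega>)\<^sup>2 * indicator {\<omega>. \<bar>?g \<omega>\<bar> \<le> 2 * y} \<omega> - (?g \<omega>)\<^sup>2 * indicator {\<omega>. \<bar>?g \<omega>\<bar> \<le> y} \<omega>) / y
      + \<bar>?g \<omega>\<bar> * indicator {\<omega>. 2 * y < \<bar>?g \<omega>\<bar>} \<omega>)"
    unfolding \<tau>_def
  proof (intro integral_mono integrable_\<tau> Bochner_Integration.integrable_add integrable_divide Bochner_Integration.integrable_diff integrable_V)
    fix \<omega>
    have "\<bar>?g \<omega>\<bar> \<le> (?g \<omega>)\<^sup>2 / y" if "y < \<bar>?g \<omega>\<bar>"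
      using mult_right_mono[of y "\<bar>?g \<omega>\<bar>" "\<bar>?g \<omega>\<bar>"] that assms
      by (simp add: field_simps power2_eq_square)
    then show "\<bar>?g \<omega>\<bar> * indicator {\<omega>. y < \<bar>?g \<omega>\<bar>} \<omega> \<le>
       ((?g \<omega>)\<^sup>2 * indicator {\<omega>. \<bar>?g \<omega>\<bar> \<le> 2 * y} \<omega> - (?g \<omega>)\<^sup>2 * indicator {\<omega>. \<bar>?g \<omega>\<bar> \<le> y} \<omega>) / y
      + \<bar>?g \<omega>\<bar> * indicator {\<omega>. 2 * y < \<bar>?g \<omega>\<bar>} \<omega>"
      using assms by (auto simp: indicator_def)
  qed
  also have "\<dots> = (V (2 * y) - V y) / y + \<tau> (2 * y)"
    unfolding V_eq \<tau>_def by (simp add: integrable_V integrable_\<tau>)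
  finally show ?thesis .
qed

lemma \<tau>_tendsto: "(\<tau> \<longlongrightarrow> 0) at_top"
proof -
  have "((\<lambda>y. expectation (\<lambda>\<omega>. \<bar>real_of_int (\<xi> \<omega>) - \<mu>\<bar> * indicator {\<omega>. y < \<bar>real_of_int (\<xi> \<omega>) - \<mu>\<bar>} \<omega>)) \<longlongrightarrow> expectation (\<lambda>\<omega>. 0)) at_top"
  proof (rule integral_dominated_convergence_at_top[where w="\<lambda>\<omega>. \<bar>real_of_int (\<xi> \<omega>) - \<mu>\<bar>"])
    show "AE \<omega> in M. ((\<lambda>y. \<bar>real_of_int (\<xi> \<omega>) - \<mu>\<bar> * indicator {\<omega>. y < \<bar>real_of_int (\<xi> \<omega>) - \<mu>\<bar>} \<omega>) \<longlongrightarrow> 0) at_top"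
    proof (rule AE_I2)
      fix \<omega>
      have "eventually (\<lambda>y. \<bar>real_of_int (\<xi> \<omega>) - \<mu>\<bar> * indicator {\<omega>. y < \<bar>real_of_int (\<xi> \<omega>) - \<mu>\<bar>} \<omega> = 0) at_top"
        using eventually_ge_at_top[of "\<bar>real_of_int (\<xi> \<omega>) - \<mu>\<bar>"] by eventually_elim auto
      then show "((\<lambda>y. \<bar>real_of_int (\<xi> \<omega>) - \<mu>\<bar> * indicator {\<omega>. y < \<bar>real_of_int (\<xi> \<omega>) - \<mu>\<bar>} \<omega>) \<longlongrightarrow> 0) at_top"
        by (rule tendsto_eventually)
    qed
  qed (auto intro!: integrable_dev always_eventually simp: indicator_def)
  then show ?thesis by (simp add: \<tau>_def[abs_def])
qed

lemma tail_le: "0 < y \<Longrightarrow> prob {\<omega> \<in> space M. y < \<bar>real_of_int (\<xi> \<omega>) - \<mu>\<bar>} \<le> \<tau> y / y"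
proof -
  assume y: "0 < y"
  have "prob {\<omega> \<in> space M. y < \<bar>real_of_int (\<xi> \<omega>) - \<mu>\<bar>} = expectation (indicator {\<omega> \<in> space M. y < \<bar>real_of_int (\<xi> \<omega>) - \<mu>\<bar>})"
    by simp
  also have "\<dots> \<le> expectation (\<lambda>\<omega>. (\<bar>real_of_int (\<xi> \<omega>) - \<mu>\<bar> * indicator {\<omega>. y < \<bar>real_of_int (\<xi> \<omega>) - \<mu>\<bar>} \<omega>) / y)"
    using y by (intro integral_mono integrable_divide integrable_\<tau> integrable_real_indicator)
      (auto simp: indicator_def less_top[symmetric])
  also have "\<dots> = \<tau> y / y" by (simp add: \<tau>_def)
  finally show ?thesis .
qed

text \<open>Below the fixed level \<open>K\<close> the second moment is \<open>V K\<close>; between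
  \<open>K\<close> and \<open>y\<close> one of the two factors is bounded by \<open>y\<close>.
  Choosing \<open>K\<close> large first and then \<open>y\<close> shows that integrability alone
  forces \<open>V y / y\<close> to \<open>0\<close>.\<close>

lemma V_over_le:
  assumes "0 < K" "0 < y"
  shows "V y / y \<le> V K / y + \<tau> K"
proof -
  let ?g = "\<lambda>\<omega>. real_of_int (\<xi> \<omega>) - \<mu>"
  have "V y \<le> expectation (\<lambda>\<omega>. (?g \<omega>)\<^sup>2 * indicator {\<omega>. \<bar>?g \<omega>\<bar> \<le> K} \<omega> + y * (\<bar>?g \<omega>\<bar> * indicator {\<omega>. K < \<bar>?g \<omega>\<bar>} \<omega>))"
    unfolding V_eq
  proof (intro integral_mono Bochner_Integration.integrable_add integrable_V integrable_mult_right integrable_\<tau>)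
    fix \<omega>
    have "(?g \<omega>)\<^sup>2 \<le> y * \<bar>?g \<omega>\<bar>" if "\<bar>?g \<omega>\<bar> \<le> y"
      using mult_right_mono[of "\<bar>?g \<omega>\<bar>" y "\<bar>?g \<omega>\<bar>"] that assms
      by (simp add: power2_eq_square)
    then show "(?g \<omega>)\<^sup>2 * indicator {\<omega>. \<bar>?g \<omega>\<bar> \<le> y} \<omega> \<le> (?g \<omega>)\<^sup>2 * indicator {\<omega>. \<bar>?g \<omega>\<bar> \<le> K} \<omega> + y * (\<bar>?g \<omega>\<bar> * indicator {\<omega>. K < \<bar>?g \<omega>\<bar>} \<omega>)"
      using assms by (auto simp: indicator_def)
  qed
  also have "\<dots> = V K + y * \<tau> K" unfolding V_eq \<tau>_def by (simp add: integrable_V integrable_\<tau>)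
  finally show ?thesis using assms by (simp add: field_simps)
qed

lemma V_over_tendsto: "((\<lambda>y. V y / y) \<longlongrightarrow> 0) at_top"
proof (rule tendstoI)
  fix e :: real assume e: "0 < e"
  have "eventually (\<lambda>K. \<tau> K < e / 2 \<and> 0 < K) at_top"
    using order_tendstoD(2)[OF \<tau>_tendsto, of "e/2"] e eventually_gt_at_top[of 0]
    by (auto intro: eventually_conj)
  then obtain K where K: "\<tau> K < e / 2" "0 < K" by (auto simp: eventually_at_top_linorder)
  have "((\<lambda>y. V K / y) \<longlongrightarrow> 0) at_top" by (rule tendsto_divide_0[OF tendsto_const filterlim_at_top_imp_at_infinity[OF filterlim_ident]])
  then have "eventually (\<lambda>y. V K / y < e / 2) at_top" using e by (intro order_tendstoD(2)) auto
  then show "eventually (\<lambda>y. dist (V y / y) 0 < e) at_top"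
    using eventually_gt_at_top[of 0]
  proof eventually_elim
    case (elim y)
    have "V y / y < e" using V_over_le[OF K(2), of y] K(1) elim by linarith
    then show ?case using elim V_nonneg[of y] by (simp add: dist_real_def)
  qed
qed

text \<open>Since \<open>\<xi>\<close> is integer-valued, \<open>V\<close> is a step function with finitely many values below any level.\<close>

lemma V_bounded_below: "\<exists>c>0. \<forall>y\<le>K. V y \<noteq> 0 \<longrightarrow> c \<le> V y"
proof -
  define G where "G A = expectation (\<lambda>\<omega>. (real_of_int (\<xi> \<omega>) - \<mu>)\<^sup>2 * indicator {\<omega>. \<xi> \<omega> \<in> A} \<omega>)" for A :: "int set"
  define F where "F = {k::int. \<bar>real_of_int k - \<mu>\<bar> \<le> K}"
  have "F \<subseteq> {\<lfloor>\<mu> - K\<rfloor>..\<lceil>\<mu> + K\<rceil>}" unfolding F_def by (auto; linarith)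
  then have "finite F" by (rule finite_subset) auto
  have VG: "V y = G {k. \<bar>real_of_int k - \<mu>\<bar> \<le> y}" for y by (simp add: V_eq G_def)
  have "V ` {..K} \<subseteq> G ` Pow F"
  proof
    fix v assume "v \<in> V ` {..K}"
    then obtain y where y: "y \<le> K" "v = V y" by auto
    then show "v \<in> G ` Pow F" by (intro image_eqI[where x="{k. \<bar>real_of_int k - \<mu>\<bar> \<le> y}"]) (auto simp: F_def VG)
  qed
  then have fin: "finite (V ` {..K})" by (rule finite_subset) (use \<open>finite F\<close> in auto)
  define c where "c = Min (insert 1 (V ` {..K} - {0}))"
  have "c \<in> insert 1 (V ` {..K} - {0})" unfolding c_def by (rule Min_in) (use fin in auto)
  then have "c > 0" using V_nonneg by (auto simp: less_le)
  moreover have "c \<le> V y" if "y \<le> K" "V y \<noteq> 0" for y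
    unfolding c_def using that fin by (intro Min_le) auto
  ultimately show ?thesis by auto
qed

text \<open>The truncation is one-sided, and below \<open>-y\<close> the second moment may be infinite. There the quadratic
  bound for the exponential is replaced by \<open>exp u \<le> 1 = 1 + u + \<bar>u\<bar>\<close>, which produces the term \<open>\<tau> y\<close>.\<close>

lemma chernoff:
  assumes \<sigma>: "\<bar>\<sigma>\<bar> = 1" and J: "finite J" "J \<subseteq> {1..}" and y: "0 < y" and l: "0 \<le> l" "l * y \<le> 1"
  shows "prob {\<omega> \<in> space M. z \<le> (\<Sum>j\<in>J. \<sigma> * (real_of_int (X j \<omega>) - \<mu>)) \<and> (\<forall>j\<in>J. \<sigma> * (real_of_int (X j \<omega>) - \<mu>) \<le> y)}
     \<le> exp (- l * z + real (card J) * (l\<^sup>2 * V y + l * \<tau> y))"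
proof -
  define g where "g k = \<sigma> * (real_of_int k - \<mu>)" for k :: int
  define w where "w k = exp (l * g k) * indicator {k. g k \<le> y} k" for k
  \<comment> \<open>An integrable majorant of \<open>w\<close> whose term \<open>l * g k\<close> has
    mean zero, so that its expectation is \<open>1 + l\<^sup>2 * V y + l * \<tau> y\<close>. Where
    \<open>g k > y\<close>, \<open>w\<close> vanishes and \<open>u\<close> is nonnegative, so upward
    deviations beyond \<open>y\<close> need no exponential moment.\<close>
  define u where "u k = 1 + l * g k + l\<^sup>2 * ((real_of_int k - \<mu>)\<^sup>2 * indicator {k. \<bar>real_of_int k - \<mu>\<bar> \<le> y} k)
     + l * (\<bar>real_of_int k - \<mu>\<bar> * indicator {k. y < \<bar>real_of_int k - \<mu>\<bar>} k)" for k
  have \<sigma>': "\<sigma> = 1 \<or> \<sigma> = -1" using \<sigma> by linarith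
  have abs_g: "\<bar>g k\<bar> = \<bar>real_of_int k - \<mu>\<bar>" "(g k)\<^sup>2 = (real_of_int k - \<mu>)\<^sup>2" for k
    using \<sigma>' by (auto simp: g_def power2_commute)
  have wu: "w k \<le> u k" for k
  proof (cases "\<bar>g k\<bar> \<le> y")
    case True
    have "\<bar>l * g k\<bar> \<le> l * y" using True l by (auto simp: abs_mult intro: mult_left_mono)
    then have "exp (l * g k) \<le> 1 + l * g k + (l * g k)\<^sup>2" using l by (intro exp_le_quadratic) auto
    then show ?thesis using True abs_g[of k] by (auto simp: w_def u_def indicator_def power_mult_distrib)
  next
    case False
    show ?thesis
    proof (cases "g k > y")
      case True
      have "l * g k \<ge> 0" using True y l by auto
      then show ?thesis using True False abs_g[of k] l by (auto simp: w_def u_def indicator_def)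
    next
      case F2: False
      then have "g k < 0" using False y by linarith
      then have "l * g k \<le> 0" using l by (auto simp: mult_le_0_iff)
      then have "w k \<le> 1" by (auto simp: w_def indicator_def)
      moreover have "u k = 1" using False abs_g(1)[of k, symmetric] \<open>g k < 0\<close> by (auto simp: u_def indicator_def)
      ultimately show ?thesis by simp
    qed
  qed
  have w0: "0 \<le> w k" for k by (simp add: w_def)
  have int_g: "integrable M (\<lambda>\<omega>. g (\<xi> \<omega>))" "expectation (\<lambda>\<omega>. g (\<xi> \<omega>)) = 0"
    unfolding g_def using int_\<xi> by (auto simp: prob_space \<mu>_def mean_def)
  have iV: "integrable M (\<lambda>\<omega>. (real_of_int (\<xi> \<omega>) - \<mu>)\<^sup>2 * indicator {k. \<bar>real_of_int k - \<mu>\<bar> \<le> y} (\<xi> \<omega>))"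
    using integrable_V[of y] by (simp add: indicator_def)
  have i\<tau>: "integrable M (\<lambda>\<omega>. \<bar>real_of_int (\<xi> \<omega>) - \<mu>\<bar> * indicator {k. y < \<bar>real_of_int k - \<mu>\<bar>} (\<xi> \<omega>))"
    using integrable_\<tau>[of y] by (simp add: indicator_def)
  have iu: "integrable M (\<lambda>\<omega>. u (\<xi> \<omega>))"
    unfolding u_def using iV i\<tau> int_g by auto
  have "expectation (\<lambda>\<omega>. u (\<xi> \<omega>)) = 1 + l\<^sup>2 * V y + l * \<tau> y"
    unfolding u_def V_eq \<tau>_def using iV i\<tau> int_g by (simp add: prob_space indicator_def)
  also have "\<dots> \<le> exp (l\<^sup>2 * V y + l * \<tau> y)"
    using exp_ge_add_one_self[of "l\<^sup>2 * V y + l * \<tau> y"] by linarith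
  finally have Eu: "expectation (\<lambda>\<omega>. u (\<xi> \<omega>)) \<le> exp (l\<^sup>2 * V y + l * \<tau> y)" .
  have Ew: "(\<integral>\<^sup>+\<omega>. ennreal (w (\<xi> \<omega>)) \<partial>M) \<le> ennreal (exp (l\<^sup>2 * V y + l * \<tau> y))"
  proof -
    have "(\<integral>\<^sup>+\<omega>. ennreal (w (\<xi> \<omega>)) \<partial>M) \<le> (\<integral>\<^sup>+\<omega>. ennreal (u (\<xi> \<omega>)) \<partial>M)"
      by (intro nn_integral_mono ennreal_leI wu)
    also have "\<dots> = ennreal (expectation (\<lambda>\<omega>. u (\<xi> \<omega>)))"
      using order_trans[OF w0 wu] by (intro nn_integral_eq_integral iu) auto
    also have "\<dots> \<le> ennreal (exp (l\<^sup>2 * V y + l * \<tau> y))" by (intro ennreal_leI Eu)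
    finally show ?thesis .
  qed
  have indep: "indep_vars (\<lambda>_. borel) (\<lambda>j \<omega>. ennreal (w (X j \<omega>))) J"
    by (rule indep_vars_compose2[OF indep_vars_subset[OF indep_X J(2)]]) auto
  let ?E = "{\<omega> \<in> space M. z \<le> (\<Sum>j\<in>J. \<sigma> * (real_of_int (X j \<omega>) - \<mu>)) \<and> (\<forall>j\<in>J. \<sigma> * (real_of_int (X j \<omega>) - \<mu>) \<le> y)}"
  have [measurable]: "X j \<in> measurable M (count_space UNIV)" if "j \<in> J" for j using that J X_meas by auto
  have Em: "?E \<in> sets M" using J(1) by measurable
  have "emeasure M ?E = (\<integral>\<^sup>+\<omega>. indicator ?E \<omega> \<partial>M)" using Em by simp
  also have "\<dots> \<le> (\<integral>\<^sup>+\<omega>. ennreal (exp (- l * z)) * (\<Prod>j\<in>J. ennreal (w (X j \<omega>))) \<partial>M)"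
  proof (rule nn_integral_mono)
    fix \<omega>
    show "indicator ?E \<omega> \<le> ennreal (exp (- l * z)) * (\<Prod>j\<in>J. ennreal (w (X j \<omega>)))"
    proof (cases "\<omega> \<in> ?E")
      case True
      have "(\<Prod>j\<in>J. w (X j \<omega>)) = (\<Prod>j\<in>J. exp (l * g (X j \<omega>)))"
        using True by (intro prod.cong) (auto simp: w_def g_def)
      also have "\<dots> = exp (l * (\<Sum>j\<in>J. g (X j \<omega>)))" using J(1) by (simp add: exp_sum sum_distrib_left)
      finally have "exp (- l * z) * (\<Prod>j\<in>J. w (X j \<omega>)) = exp (l * ((\<Sum>j\<in>J. g (X j \<omega>)) - z))"
        by (simp add: exp_add[symmetric] algebra_simps)
      also have "1 \<le> \<dots>" using True l by (auto simp: g_def)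
      finally have "1 \<le> ennreal (exp (- l * z) * (\<Prod>j\<in>J. w (X j \<omega>)))" by simp
      then show ?thesis using True w0 by (simp add: ennreal_mult prod_ennreal prod_nonneg)
    qed (auto simp: indicator_def)
  qed
  also have "\<dots> = ennreal (exp (- l * z)) * (\<Prod>j\<in>J. \<integral>\<^sup>+\<omega>. ennreal (w (X j \<omega>)) \<partial>M)"
    using J(1) by (subst nn_integral_cmult) (auto simp: indep_vars_nn_integral[OF J(1) indep])
  also have "\<dots> \<le> ennreal (exp (- l * z)) * (\<Prod>j\<in>J. ennreal (exp (l\<^sup>2 * V y + l * \<tau> y)))"
  proof (rule mult_left_mono[OF prod_mono_ennreal])
    fix j assume "j \<in> J"
    then have "j \<ge> 1" using J by auto
    then show "(\<integral>\<^sup>+\<omega>. ennreal (w (X j \<omega>)) \<partial>M) \<le> ennreal (exp (l\<^sup>2 * V y + l * \<tau> y))"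
      using Ew nn_integral_X[of j "\<lambda>k. ennreal (w k)"] by simp
  qed auto
  also have "\<dots> = ennreal (exp (- l * z) * (exp (l\<^sup>2 * V y + l * \<tau> y)) ^ card J)"
    by (simp add: ennreal_mult ennreal_power)
  also have "exp (- l * z) * (exp (l\<^sup>2 * V y + l * \<tau> y)) ^ card J = exp (- l * z + real (card J) * (l\<^sup>2 * V y + l * \<tau> y))"
    by (simp only: exp_add exp_of_nat_mult)
  finally show ?thesis by (simp add: emeasure_eq_measure)
qed

text \<open>Condition on the value \<open>k\<close> of \<open>X i\<close> and use its independence
  of the family over \<open>J\<close>. The sum over \<open>k\<close> is an integral over
  \<open>count_space B\<close>, so \<open>B\<close> may be infinite.\<close>

lemma split_emeasure:
  assumes i: "i \<ge> 1" and J: "finite J" "J \<subseteq> {1..}" "i \<notin> J"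
  shows "emeasure M {\<omega> \<in> space M. X i \<omega> \<in> B \<and> X i \<omega> + T J \<omega> = s \<and> (\<forall>j\<in>J. X j \<omega> \<in> A)}
     = (\<integral>\<^sup>+k. ennreal (p k) * emeasure M {\<omega> \<in> space M. T J \<omega> = s - k \<and> (\<forall>j\<in>J. X j \<omega> \<in> A)} \<partial>count_space B)"
    (is "emeasure M ?E = ?R")
proof -
  note [measurable] = X_meas[OF i] T_meas[OF J(2)]
  have [measurable]: "X j \<in> measurable M (count_space UNIV)" if "j \<in> J" for j using that J X_meas by auto
  let ?F = "\<lambda>k. {\<omega> \<in> space M. X i \<omega> = k \<and> T J \<omega> = s - k \<and> (\<forall>j\<in>J. X j \<omega> \<in> A)}"
  have "?E = (\<Union>k\<in>B. ?F k)" by auto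
  also have "emeasure M (\<Union>k\<in>B. ?F k) = (\<integral>\<^sup>+k. emeasure M (?F k) \<partial>count_space B)"
    using J(1) by (intro emeasure_UN_countable) (auto simp: disjoint_family_on_def)
  also have "\<dots> = ?R"
  proof (rule nn_integral_cong)
    fix k :: int
    have "indep_var (PiM {i} (\<lambda>_. count_space UNIV)) (\<lambda>\<omega>. \<lambda>j\<in>{i}. X j \<omega>) (PiM J (\<lambda>_. count_space UNIV)) (\<lambda>\<omega>. \<lambda>j\<in>J. X j \<omega>)"
      by (rule indep_var_restrict[OF indep_X]) (use i J in auto)
    note ind = indep_varD[OF this, of "{f \<in> space (PiM {i} (\<lambda>_. count_space UNIV)). f i = k}"
      "{f \<in> space (PiM J (\<lambda>_. count_space UNIV)). (\<Sum>j\<in>J. f j) = s - k \<and> (\<forall>j\<in>J. f j \<in> A)}"]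
    have m1: "{f \<in> space (PiM {i} (\<lambda>_. count_space UNIV)). f i = k} \<in> sets (PiM {i} (\<lambda>_. count_space UNIV))"
      by measurable
    have m2: "{f \<in> space (PiM J (\<lambda>_. count_space UNIV)). (\<Sum>j\<in>J. f j) = s - k \<and> (\<forall>j\<in>J. f j \<in> A)} \<in> sets (PiM J (\<lambda>_. count_space UNIV))"
      using J(1) by measurable
    have e1: "(\<lambda>x. (\<lambda>j\<in>{i}. X j x, \<lambda>j\<in>J. X j x)) -` ({f \<in> space (PiM {i} (\<lambda>_. count_space UNIV)). f i = k} \<times> 
       {f \<in> space (PiM J (\<lambda>_. count_space UNIV)). (\<Sum>j\<in>J. f j) = s - k \<and> (\<forall>j\<in>J. f j \<in> A)}) \<inter> space M = ?F k"
      by (auto simp: space_PiM T_def)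
    have e2: "(\<lambda>\<omega>. \<lambda>j\<in>{i}. X j \<omega>) -` {f \<in> space (PiM {i} (\<lambda>_. count_space UNIV)). f i = k} \<inter> space M = {\<omega> \<in> space M. X i \<omega> \<in> {k}}"
      by (auto simp: space_PiM)
    have e3: "(\<lambda>\<omega>. \<lambda>j\<in>J. X j \<omega>) -` {f \<in> space (PiM J (\<lambda>_. count_space UNIV)). (\<Sum>j\<in>J. f j) = s - k \<and> (\<forall>j\<in>J. f j \<in> A)} \<inter> space M
       = {\<omega> \<in> space M. T J \<omega> = s - k \<and> (\<forall>j\<in>J. X j \<omega> \<in> A)}"
      by (auto simp: space_PiM T_def)
    have "prob (?F k) = p k * prob {\<omega> \<in> space M. T J \<omega> = s - k \<and> (\<forall>j\<in>J. X j \<omega> \<in> A)}"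
      using ind[OF m1 m2] unfolding e1 e2 e3 prob_X[OF i] p_def by simp
    then show "emeasure M (?F k) = ennreal (p k) * emeasure M {\<omega> \<in> space M. T J \<omega> = s - k \<and> (\<forall>j\<in>J. X j \<omega> \<in> A)}"
      by (simp add: emeasure_eq_measure ennreal_mult p_nonneg)
  qed
  finally show ?thesis .
qed

text \<open>The same sum without the weights \<open>p k\<close>. Bounding the weights uniformly on
  \<open>B\<close> and resumming thus turns the local events \<open>T J \<omega> = s - k\<close>
  into the single global event \<open>s - T J \<omega> \<in> B\<close>.\<close>

lemma split_emeasure_rest:
  assumes J: "finite J" "J \<subseteq> {1..}"
  shows "emeasure M {\<omega> \<in> space M. s - T J \<omega> \<in> B \<and> (\<forall>j\<in>J. X j \<omega> \<in> A)}
     = (\<integral>\<^sup>+k. emeasure M {\<omega> \<in> space M. T J \<omega> = s - k \<and> (\<forall>j\<in>J. X j \<omega> \<in> A)} \<partial>count_space B)"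
    (is "emeasure M ?E = ?R")
proof -
  note [measurable] = T_meas[OF J(2)]
  have [measurable]: "X j \<in> measurable M (count_space UNIV)" if "j \<in> J" for j using that J X_meas by auto
  let ?F = "\<lambda>k. {\<omega> \<in> space M. T J \<omega> = s - k \<and> (\<forall>j\<in>J. X j \<omega> \<in> A)}"
  have "?E = (\<Union>k\<in>B. ?F k)" by force
  also have "emeasure M (\<Union>k\<in>B. ?F k) = (\<integral>\<^sup>+k. emeasure M (?F k) \<partial>count_space B)"
    using J(1) by (intro emeasure_UN_countable) (auto simp: disjoint_family_on_def)
  finally show ?thesis .
qed

lemma split_upper:
  assumes i: "i \<ge> 1" and J: "finite J" "J \<subseteq> {1..}" "i \<notin> J" and q: "\<And>k. k \<in> B \<Longrightarrow> p k \<le> q" "0 \<le> q"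
  shows "prob {\<omega> \<in> space M. X i \<omega> \<in> B \<and> X i \<omega> + T J \<omega> = s \<and> (\<forall>j\<in>J. X j \<omega> \<in> A)}
     \<le> q * prob {\<omega> \<in> space M. s - T J \<omega> \<in> B \<and> (\<forall>j\<in>J. X j \<omega> \<in> A)}"
proof -
  have "emeasure M {\<omega> \<in> space M. X i \<omega> \<in> B \<and> X i \<omega> + T J \<omega> = s \<and> (\<forall>j\<in>J. X j \<omega> \<in> A)}
     \<le> (\<integral>\<^sup>+k. ennreal q * emeasure M {\<omega> \<in> space M. T J \<omega> = s - k \<and> (\<forall>j\<in>J. X j \<omega> \<in> A)} \<partial>count_space B)"
    unfolding split_emeasure[OF i J]
    by (intro nn_integral_mono mult_right_mono ennreal_leI) (auto simp: q)
  also have "\<dots> = ennreal q * emeasure M {\<omega> \<in> space M. s - T J \<omega> \<in> B \<and> (\<forall>j\<in>J. X j \<omega> \<in> A)}"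
    unfolding split_emeasure_rest[OF J(1,2)] by (rule nn_integral_cmult) auto
  finally show ?thesis using q(2) by (simp add: emeasure_eq_measure ennreal_mult[symmetric])
qed

lemma split_lower:
  assumes i: "i \<ge> 1" and J: "finite J" "J \<subseteq> {1..}" "i \<notin> J" and q: "\<And>k. k \<in> B \<Longrightarrow> q \<le> p k" "0 \<le> q"
  shows "q * prob {\<omega> \<in> space M. s - T J \<omega> \<in> B \<and> (\<forall>j\<in>J. X j \<omega> \<in> A)}
     \<le> prob {\<omega> \<in> space M. X i \<omega> \<in> B \<and> X i \<omega> + T J \<omega> = s \<and> (\<forall>j\<in>J. X j \<omega> \<in> A)}"
proof -
  have "ennreal q * emeasure M {\<omega> \<in> space M. s - T J \<omega> \<in> B \<and> (\<forall>j\<in>J. X j \<omega> \<in> A)}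
    = (\<integral>\<^sup>+k. ennreal q * emeasure M {\<omega> \<in> space M. T J \<omega> = s - k \<and> (\<forall>j\<in>J. X j \<omega> \<in> A)} \<partial>count_space B)"
    unfolding split_emeasure_rest[OF J(1,2)] by (rule nn_integral_cmult[symmetric]) auto
  also have "\<dots> \<le> emeasure M {\<omega> \<in> space M. X i \<omega> \<in> B \<and> X i \<omega> + T J \<omega> = s \<and> (\<forall>j\<in>J. X j \<omega> \<in> A)}"
    unfolding split_emeasure[OF i J]
    by (intro nn_integral_mono mult_right_mono ennreal_leI) (auto simp: q)
  finally show ?thesis using q(2) by (simp add: emeasure_eq_measure ennreal_mult[symmetric])
qed

end

section \<open>Large deviations\<close>

locale iid_regular = iid_integers +
  assumes irv: "intermediate_regularly_varying (\<lambda>u. p \<lfloor>u\<rfloor>)"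
    and limsup_p: "Limsup at_top (\<lambda>k::int. (SUP l\<in>{k..}. ereal (p l)) / ereal (p k)) < \<infinity>"
    and sv: "slowly_varying V"
begin

lemma p_doubling:
  obtains D N where "D \<ge> 1" "N > 0" "\<And>k x j. N \<le> k \<Longrightarrow> N \<le> x \<Longrightarrow> x \<le> 2 ^ j * k \<Longrightarrow> p k \<le> D ^ (j + 1) * p x"
    "\<And>k. N \<le> k \<Longrightarrow> 0 < p k"
proof -
  obtain h N1 where N1: "h > 0" "N1 > 0" "\<And>k l::int. N1 \<le> k \<Longrightarrow> \<bar>real_of_int l - k\<bar> \<le> h * k \<Longrightarrow> 0 < p k"
    using irv_uniform[OF irv p_nonneg, of "1/2"] by auto
  have pos: "0 < p k" if "N1 \<le> k" for k using N1(3)[of k k] N1(1,2) that by auto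
  obtain N0 D0 where "\<And>k l. N0 \<le> k \<Longrightarrow> k \<le> l \<Longrightarrow> p l \<le> D0 * p k"
    using limsup_almost_monotone[OF limsup_p p_nonneg pos] by blast
  from irv_doubling[OF irv p_nonneg this] obtain D N where
    "D \<ge> 1" "N > 0" "\<And>k x j. N \<le> k \<Longrightarrow> N \<le> x \<Longrightarrow> x \<le> 2 ^ j * k \<Longrightarrow> p k \<le> D ^ (j + 1) * p x" by blast
  then show ?thesis using pos by (intro that[of D "max N N1"]) auto
qed

text \<open>At most \<open>j\<close> doublings, with \<open>2 ^ j > 1 / \<eta>\<close>, lead from
  \<open>k\<close> up to \<open>x\<close>, so \<open>C = D ^ (j + 1)\<close> works; values
  \<open>k\<close> beyond \<open>x\<close> are covered as well, since the doubling bound includes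
  almost monotonicity.\<close>

lemma p_far_le:
  fixes \<eta> :: real
  assumes "0 < \<eta>"
  obtains C N where "C \<ge> 0" "\<And>x k :: int. N \<le> x \<Longrightarrow> \<eta> * x \<le> k \<Longrightarrow> p k \<le> C * p x"
proof -
  obtain D N where D: "D \<ge> 1" "N > 0" "\<And>k x j. N \<le> k \<Longrightarrow> N \<le> x \<Longrightarrow> x \<le> 2 ^ j * k \<Longrightarrow> p k \<le> D ^ (j + 1) * p x"
    using p_doubling by metis
  obtain j where j: "1 / \<eta> < 2 ^ j" using real_arch_pow[of 2] by auto
  show ?thesis
  proof (rule that[of "D ^ (j+1)" "max N \<lceil>N / \<eta>\<rceil>"])
    fix x k :: int assume a: "max N \<lceil>N / \<eta>\<rceil> \<le> x" "\<eta> * x \<le> k"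
    have "N / \<eta> \<le> x" using a by linarith
    then have "N \<le> k" using a(2) assms by (simp add: field_simps)
    have "1 * real_of_int x \<le> (2 ^ j * \<eta>) * x" using a D j assms by (intro mult_right_mono) (auto simp: field_simps)
    also have "\<dots> = 2 ^ j * (\<eta> * x)" by simp
    also have "\<dots> \<le> 2 ^ j * real_of_int k" using a(2) by (intro mult_left_mono) auto
    finally have "real_of_int x \<le> real_of_int (2 ^ j * k)" by simp
    then have "x \<le> 2 ^ j * k" by (simp only: of_int_le_iff)
    then show "p k \<le> D ^ (j + 1) * p x" using D(3)[of k x j] a \<open>N \<le> k\<close> by auto
  qed (use D in auto)
qed

text \<open>From the fixed point \<open>N\<close> one reaches \<open>x\<close> by about
  \<open>log 2 x\<close> doublings, each costing at most \<open>D < 2 ^ i\<close>; the product is of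
  order \<open>x ^ i\<close>.\<close>

lemma p_lower_bound:
  obtains c i N where "c > 0" "\<And>x::int. N \<le> x \<Longrightarrow> c / real_of_int x ^ i \<le> p x"
proof -
  obtain D N where D: "D \<ge> 1" "N > 0" "\<And>k x j. N \<le> k \<Longrightarrow> N \<le> x \<Longrightarrow> x \<le> 2 ^ j * k \<Longrightarrow> p k \<le> D ^ (j + 1) * p x"
     "\<And>k. N \<le> k \<Longrightarrow> 0 < p k"
    using p_doubling by metis
  obtain i where i: "D < 2 ^ i" using real_arch_pow[of 2] by auto
  show ?thesis
  proof (rule that[of "p N / (D * 2 ^ i)" N i])
    fix x :: int assume x: "N \<le> x"
    define j where "j = (LEAST j. x \<le> 2 ^ j)"
    have xj: "x \<le> 2 ^ j" unfolding j_def
      by (rule LeastI[of _ "nat x"]) (use x D(2) of_nat_less_two_power[of "nat x", where 'a=int] in auto)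
    have j2: "(2::real) ^ j \<le> 2 * real_of_int x"
    proof (cases j)
      case 0 then show ?thesis using x D(2) by simp
    next
      case (Suc j')
      have "\<not> x \<le> 2 ^ j'" using not_less_Least[of j' "\<lambda>j. x \<le> 2 ^ j"] Suc unfolding j_def by auto
      then have "real_of_int (2 ^ j') \<le> x" by (simp only: of_int_le_iff)
      then show ?thesis using Suc by simp
    qed
    have "2 ^ j * 1 \<le> 2 ^ j * N" using D(2) by (intro mult_left_mono) auto
    then have "x \<le> 2 ^ j * N" using xj by linarith
    then have "p N \<le> D ^ (j + 1) * p x" using D(3)[of N x j] x by auto
    also have "D ^ (j + 1) = D * D ^ j" by simp
    also have "\<dots> \<le> D * ((2 ^ i) ^ j)" using i D(1) by (intro mult_left_mono power_mono) auto
    also have "(2 ^ i) ^ j = ((2::real) ^ j) ^ i" by (simp add: power_mult[symmetric] mult.commute)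
    also have "\<dots> \<le> (2 * real_of_int x) ^ i" using j2 by (intro power_mono) auto
    finally have "p N \<le> D * (2 * real_of_int x) ^ i * p x" using p_nonneg[of x] D(1) by (auto simp: mult_left_mono mult_right_mono)
    then show "p N / (D * 2 ^ i) / real_of_int x ^ i \<le> p x"
      using D(1,2) x by (simp add: field_simps power_mult_distrib)
  qed (use D(1,4) in auto)
qed

lemma V_halving:
  obtains y0 where "y0 > 0" "\<And>y y'. y0 \<le> y \<Longrightarrow> y \<le> y' \<Longrightarrow> V y' / y' \<le> 2 * (V y / y)" "\<And>y. y0 \<le> y \<Longrightarrow> 0 < V y"
proof -
  have "eventually (\<lambda>y. (V (2 * y) \<le> (1 + 1) * V y \<and> 0 < V y) \<and> 0 < y) at_top"
    by (intro eventually_conj slowly_varying_doubling sv V_nonneg eventually_gt_at_top) auto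
  then obtain y0 where y0: "\<And>y. y0 \<le> y \<Longrightarrow> V (2 * y) \<le> 2 * V y" "\<And>y. y0 \<le> y \<Longrightarrow> 0 < V y" "0 < y0"
    by (auto simp: eventually_at_top_linorder)
  show ?thesis
  proof (rule that[OF y0(3)])
    fix y y' assume "y0 \<le> y" "y \<le> y'"
    then show "V y' / y' \<le> 2 * (V y / y)" by (intro almost_halving_le[OF y0(1) V_mono y0(3) _ _ V_nonneg])
  qed (rule y0(2))
qed

text \<open>Slow variation makes \<open>V (2 * y) - V y\<close> a small multiple of
  \<open>V y\<close>, so each dyadic shell beyond \<open>y\<close> contributes little to the tail
  moment. This lets the term with \<open>\<tau>\<close> in \<open>chernoff\<close> be absorbed by a
  fraction of the term with \<open>V\<close>.\<close>

lemma \<tau>_small: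
  assumes "0 < e"
  shows "eventually (\<lambda>y. \<tau> y \<le> e * (V y / y)) at_top"
proof -
  define d where "d = min (e / 4) (1 / 2)"
  have d: "0 < d" "d \<le> 1 / 2" "4 * d \<le> e" using assms by (auto simp: d_def)
  have "eventually (\<lambda>y. (V (2 * y) \<le> (1 + d) * V y \<and> 0 < V y) \<and> 0 < y) at_top"
    by (intro eventually_conj slowly_varying_doubling sv V_nonneg eventually_gt_at_top d)
  then obtain y0 where y0: "\<And>y. y0 \<le> y \<Longrightarrow> V (2 * y) \<le> (1 + d) * V y" "0 < y0"
    by (auto simp: eventually_at_top_linorder)
  have "\<tau> y \<le> e * (V y / y)" if "y0 \<le> y" for y
  proof -
    have "\<tau> y \<le> 4 * d * (V y / y)"
      using tail_moment_le[of y0 V d \<tau> y] y0 d \<tau>_shell \<tau>_tendsto that V_nonneg by auto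
    also have "\<dots> \<le> e * (V y / y)" using d y0(2) that V_nonneg[of y] by (intro mult_right_mono) auto
    finally show ?thesis .
  qed
  then show ?thesis by (auto simp: eventually_at_top_linorder)
qed

text \<open>Centring turns \<open>X j \<le> y\<close> into \<open>X j - \<mu> \<le> 2 * y\<close>
  for \<open>y \<ge> \<bar>\<mu>\<bar>\<close>, which is why \<open>V\<close> enters at
  \<open>2 * y\<close>. The bound is applied both to the sum left after removing a jump and to the
  full sum without large jumps.\<close>

lemma truncated_sum_tail:
  obtains y1 where "y1 > 0" "\<And>y n J x z. y1 \<le> y \<Longrightarrow> finite J \<Longrightarrow> J \<subseteq> {1..} \<Longrightarrow> card J \<le> n \<Longrightarrow>
     real n * (V (2 * y) / (2 * y)) \<le> 4 * x \<Longrightarrow> 0 \<le> x \<Longrightarrow> x / 2 \<le> z \<Longrightarrow>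
     prob {\<omega> \<in> space M. z \<le> (\<Sum>j\<in>J. real_of_int (X j \<omega>) - \<mu>) \<and> (\<forall>j\<in>J. real_of_int (X j \<omega>) \<le> y)} \<le> exp (- x / (256 * y))"
proof -
  have "eventually (\<lambda>y. \<tau> y \<le> 1/32 * (V y / y) \<and> \<bar>\<mu>\<bar> + 1 \<le> y) at_top"
    by (intro eventually_conj \<tau>_small eventually_ge_at_top) auto
  then obtain y1 where y1: "\<And>y. y1 \<le> y \<Longrightarrow> \<tau> y \<le> 1/32 * (V y / y)" "\<bar>\<mu>\<bar> + 1 \<le> y1"
    by (auto simp: eventually_at_top_linorder)
  have y1p: "y1 > 0" using y1(2) by linarith
  show ?thesis
  proof (rule that[OF y1p])
    fix y x z :: real and n :: nat and J :: "nat set"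
    assume a: "y1 \<le> y" "finite J" "J \<subseteq> {1..}" "card J \<le> n" "real n * (V (2 * y) / (2 * y)) \<le> 4 * x" "0 \<le> x" "x / 2 \<le> z"
    define y' where "y' = 2 * y"
    have y': "y' > 0" "y1 \<le> y'" using a(1) y1p by (auto simp: y'_def)
    \<comment> \<open>With this \<open>l\<close> the gain \<open>l * x / 2\<close> is
      \<open>4 * x / (128 * y')\<close>, while the cost condition and
      \<open>\<tau> y' \<le> V y' / (32 * y')\<close> keep the loss below
      \<open>3 * x / (128 * y')\<close>. The difference is the claimed exponent, as
      \<open>y' = 2 * y\<close>.\<close>
    define l where "l = 1 / (16 * y')"
    have l: "0 \<le> l" "l * y' \<le> 1" using y' by (auto simp: l_def)
    have [measurable]: "X j \<in> measurable M (count_space UNIV)" if "j \<in> J" for j :: nat using that a X_meas by auto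
    have "prob {\<omega> \<in> space M. z \<le> (\<Sum>j\<in>J. real_of_int (X j \<omega>) - \<mu>) \<and> (\<forall>j\<in>J. real_of_int (X j \<omega>) \<le> y)}
      \<le> prob {\<omega> \<in> space M. z \<le> (\<Sum>j\<in>J. 1 * (real_of_int (X j \<omega>) - \<mu>)) \<and> (\<forall>j\<in>J. 1 * (real_of_int (X j \<omega>) - \<mu>) \<le> y')}"
    proof (rule finite_measure_mono)
      show "{\<omega> \<in> space M. z \<le> (\<Sum>j\<in>J. real_of_int (X j \<omega>) - \<mu>) \<and> (\<forall>j\<in>J. real_of_int (X j \<omega>) \<le> y)}
        \<subseteq> {\<omega> \<in> space M. z \<le> (\<Sum>j\<in>J. 1 * (real_of_int (X j \<omega>) - \<mu>)) \<and> (\<forall>j\<in>J. 1 * (real_of_int (X j \<omega>) - \<mu>) \<le> y')}"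
      proof (intro Collect_mono impI conjI ballI; elim conjE)
        fix \<omega> j assume "\<forall>j\<in>J. real_of_int (X j \<omega>) \<le> y" "j \<in> J"
        then have "real_of_int (X j \<omega>) \<le> y" by auto
        then show "1 * (real_of_int (X j \<omega>) - \<mu>) \<le> y'" using y1(2) a(1) abs_ge_minus_self[of \<mu>] unfolding y'_def by simp
      qed auto
    qed (use a(2) in measurable)
    also have "\<dots> \<le> exp (- l * z + real (card J) * (l\<^sup>2 * V y' + l * \<tau> y'))"
      by (rule chernoff) (use a y' l in auto)
    also have "\<dots> \<le> exp (- x / (256 * y))"
    proof -
      have "real (card J) * (l\<^sup>2 * V y' + l * \<tau> y') \<le> real n * (l\<^sup>2 * V y' + l * \<tau> y')"
        using a(4) l V_nonneg[of y'] \<tau>_nonneg[of y'] by (intro mult_right_mono) auto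
      also have "\<dots> \<le> real n * (l\<^sup>2 * V y' + l * (1/32 * (V y' / y')))"
        using y1(1)[OF y'(2)] l by (intro mult_left_mono add_left_mono) auto
      also have "\<dots> = (l\<^sup>2 * y' + l / 32) * (real n * (V y' / y'))" using y' by (simp add: field_simps)
      also have "\<dots> \<le> (l\<^sup>2 * y' + l / 32) * (4 * x)"
        using a(5) y' l unfolding y'_def[symmetric] by (intro mult_left_mono) auto
      also have "\<dots> = 3 * x / (128 * y')" using y' by (simp add: l_def field_simps power2_eq_square)
      finally have 1: "real (card J) * (l\<^sup>2 * V y' + l * \<tau> y') \<le> 3 * x / (128 * y')" .
      have "l * (x / 2) \<le> l * z" using a l by (intro mult_left_mono) auto
      then have "- l * z \<le> - (4 * x / (128 * y'))" using y' by (simp add: l_def)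
      with 1 have "- l * z + real (card J) * (l\<^sup>2 * V y' + l * \<tau> y') \<le> - (x / (128 * y'))"
        by (simp add: field_simps)
      also have "\<dots> = - x / (256 * y)" by (simp add: y'_def)
      finally show ?thesis by simp
    qed
    finally show "prob {\<omega> \<in> space M. z \<le> (\<Sum>j\<in>J. real_of_int (X j \<omega>) - \<mu>) \<and> (\<forall>j\<in>J. real_of_int (X j \<omega>) \<le> y)} \<le> exp (- x / (256 * y))" .
  qed
qed

end

text \<open>The common ground of both regimes: \<open>x_large\<close> is the Chebyshev-type
  condition for a truncated sum to be negligible at scale \<open>x\<close>. It follows from
  \<open>x / a\<close> tending to infinity as well as from linear growth of
  \<open>x\<close>.\<close>

locale large_deviation = iid_regular +
  fixes x :: "nat \<Rightarrow> int"
  assumes x_top: "filterlim (\<lambda>n. real_of_int (x n)) at_top sequentially"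
    and x_large: "(\<lambda>n. real n * V (x n) / (real_of_int (x n))\<^sup>2) \<longlonglongrightarrow> 0"
begin

definition s :: "nat \<Rightarrow> int" where "s n = x n + \<lfloor>real n * \<mu>\<rfloor>"

lemma eventually_x: "eventually (\<lambda>n. K \<le> real_of_int (x n)) sequentially"
  using x_top by (simp add: filterlim_at_top)

lemma eventually_x_int: "eventually (\<lambda>n. K \<le> x n) sequentially"
  using eventually_x[of "real_of_int K"] by simp

lemma eventually_of_large:
  fixes \<eta> :: real
  assumes "eventually P at_top" "0 < \<eta>"
  shows "eventually (\<lambda>n. P (\<eta> * real_of_int (x n))) sequentially"
proof -
  have "filterlim (\<lambda>n. \<eta> * real_of_int (x n)) at_top sequentially"
    by (rule filterlim_tendsto_pos_mult_at_top[OF tendsto_const assms(2) x_top])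
  then show ?thesis using assms(1) by (rule eventually_compose_filterlim[rotated])
qed

text \<open>The sum bounds the error in the Chernoff exponent at level \<open>\<eta> * x\<close>
  with \<open>l = 1 / (\<eta> * x)\<close>, and its second part also bounds the probability that
  some summand deviates by more than \<open>\<eta> * x\<close>. Since
  \<open>\<tau> y \<le> V y / y\<close> eventually and \<open>V\<close> is monotone, it is at most
  \<open>2 / \<eta>\<^sup>2\<close> times the quantity in \<open>x_large\<close>.\<close>

lemma cost_tendsto:
  fixes \<eta> :: real
  assumes \<eta>: "0 < \<eta>" "\<eta> \<le> 1"
  shows "(\<lambda>n. real n * (V (\<eta> * x n) / (\<eta> * x n)\<^sup>2 + \<tau> (\<eta> * x n) / (\<eta> * x n))) \<longlonglongrightarrow> 0"
proof (rule tendsto_sandwich[OF _ _ tendsto_const])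
  show "(\<lambda>n. 2 / \<eta>\<^sup>2 * (real n * V (x n) / (real_of_int (x n))\<^sup>2)) \<longlonglongrightarrow> 0"
    by (rule tendsto_mult_right_zero[OF x_large])
  have "eventually (\<lambda>n. \<tau> (\<eta> * x n) \<le> 1 * (V (\<eta> * x n) / (\<eta> * x n))) sequentially"
    using eventually_of_large[OF \<tau>_small[OF zero_less_one] \<eta>(1)] by simp
  then show "eventually (\<lambda>n. real n * (V (\<eta> * x n) / (\<eta> * x n)\<^sup>2 + \<tau> (\<eta> * x n) / (\<eta> * x n)) \<le> 2 / \<eta>\<^sup>2 * (real n * V (x n) / (real_of_int (x n))\<^sup>2)) sequentially"
    using eventually_x[of 1]
  proof eventually_elim
    case (elim n)
    define y where "y = \<eta> * x n"
    have y: "y > 0" "y \<le> x n" using \<eta> elim by (auto simp: y_def)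
    have "\<tau> y / y \<le> (V y / y) / y" using elim y by (intro divide_right_mono) (auto simp: y_def)
    then have "V y / y\<^sup>2 + \<tau> y / y \<le> 2 * V y / y\<^sup>2" by (simp add: power2_eq_square)
    also have "\<dots> \<le> 2 * V (x n) / y\<^sup>2" using monoD[OF V_mono y(2)] by (intro divide_right_mono) auto
    finally have "real n * (V y / y\<^sup>2 + \<tau> y / y) \<le> real n * (2 * V (x n) / y\<^sup>2)" by (intro mult_left_mono) auto
    also have "\<dots> = 2 / \<eta>\<^sup>2 * (real n * V (x n) / (real_of_int (x n))\<^sup>2)" by (simp add: y_def power_mult_distrib)
    finally show ?case by (simp add: y_def)
  qed
  show "eventually (\<lambda>n. 0 \<le> real n * (V (\<eta> * x n) / (\<eta> * x n)\<^sup>2 + \<tau> (\<eta> * x n) / (\<eta> * x n))) sequentially"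
    using eventually_x[of 1] by eventually_elim (use \<eta> V_nonneg \<tau>_nonneg in auto)
qed

text \<open>The two-sided bound uses Chernoff at truncation level \<open>\<eta> x\<close>: its exponent \<open>-h/\<eta> + o(1)\<close> is as small as desired
  once \<open>\<eta>\<close> is small.\<close>

lemma weak_law:
  fixes h e :: real
  assumes h: "0 < h" and e: "0 < e"
  shows "eventually (\<lambda>n. \<forall>J. finite J \<longrightarrow> J \<subseteq> {1..} \<longrightarrow> card J \<le> n \<longrightarrow>
    prob {\<omega> \<in> space M. (\<exists>j\<in>J. h * x n < \<bar>real_of_int (X j \<omega>) - \<mu>\<bar>) \<or> h * x n \<le> \<bar>\<Sum>j\<in>J. real_of_int (X j \<omega>) - \<mu>\<bar>} \<le> e) sequentially"
proof -
  \<comment> \<open>The budget \<open>e\<close> is split into \<open>e/2\<close> for a single large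
    deviation and \<open>e/4\<close> for each sign of the sum. The exponent is at most
    \<open>- h / \<eta> + 1\<close>, where \<open>1\<close> bounds the cost, so
    \<open>h / \<eta> \<ge> L\<close> is what is required of \<open>\<eta>\<close>.\<close>
  define L where "L = max 1 (1 + ln (4 / e))"
  have L: "L \<ge> 1" "exp (- L + 1) \<le> e / 4"
  proof -
    have "- L + 1 \<le> - ln (4 / e)" by (auto simp: L_def)
    then have "exp (- L + 1) \<le> exp (- ln (4 / e))" by simp
    also have "\<dots> = e / 4" using e by (simp add: exp_minus)
    finally show "exp (- L + 1) \<le> e / 4" .
  qed (auto simp: L_def)
  define \<eta> where "\<eta> = min 1 (h / L)"
  have \<eta>: "0 < \<eta>" "\<eta> \<le> 1" "\<eta> \<le> h" "L \<le> h / \<eta>"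
  proof -
    show "0 < \<eta>" "\<eta> \<le> 1" using h L by (auto simp: \<eta>_def)
    have "\<eta> \<le> h / L" by (auto simp: \<eta>_def)
    also have "\<dots> \<le> h / 1" using h L by (intro divide_left_mono) auto
    finally show "\<eta> \<le> h" by simp
    show "L \<le> h / \<eta>" using \<open>\<eta> \<le> h / L\<close> \<open>0 < \<eta>\<close> L by (simp add: field_simps)
  qed
  have "eventually (\<lambda>n. real n * (V (\<eta> * x n) / (\<eta> * x n)\<^sup>2 + \<tau> (\<eta> * x n) / (\<eta> * x n)) < min 1 (e / 2)) sequentially"
    using e by (intro order_tendstoD(2)[OF cost_tendsto[OF \<eta>(1,2)]]) auto
  then show ?thesis using eventually_x[of 1]
  proof eventually_elim
    case (elim n)
    define y where "y = \<eta> * x n"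
    have y: "y > 0" "y \<le> h * x n" using \<eta> elim by (auto simp: y_def)
    define E where "E = real n * (V y / y\<^sup>2 + \<tau> y / y)"
    have E: "E \<le> 1" "E \<le> e / 2" using elim by (auto simp: E_def y_def)
    show ?case
    proof (intro allI impI)
      fix J :: "nat set" assume J: "finite J" "J \<subseteq> {1..}" "card J \<le> n"
      have [measurable]: "X j \<in> measurable M (count_space UNIV)" if "j \<in> J" for j using that J X_meas by auto
      let ?A = "\<lambda>j. {\<omega> \<in> space M. X j \<omega> \<in> {k. y < \<bar>real_of_int k - \<mu>\<bar>}}"
      let ?B = "\<lambda>\<sigma>. {\<omega> \<in> space M. h * x n \<le> (\<Sum>j\<in>J. \<sigma> * (real_of_int (X j \<omega>) - \<mu>)) \<and> (\<forall>j\<in>J. \<sigma> * (real_of_int (X j \<omega>) - \<mu>) \<le> y)}"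
      let ?G = "{\<omega> \<in> space M. (\<exists>j\<in>J. h * x n < \<bar>real_of_int (X j \<omega>) - \<mu>\<bar>) \<or> h * x n \<le> \<bar>\<Sum>j\<in>J. real_of_int (X j \<omega>) - \<mu>\<bar>}"
      have mB: "?B \<sigma> \<in> events" for \<sigma> using J(1) by measurable
      have mA: "?A j \<in> events" if "j \<in> J" for j using that by measurable
      \<comment> \<open>Because \<open>y \<le> h * x n\<close>, a deviation beyond
        \<open>h * x n\<close> is already one beyond \<open>y\<close>. If there is none beyond
        \<open>y\<close>, the truncation holds for both signs and one of the two signed sums must be
        large.\<close>
      have "?G \<subseteq> (\<Union>j\<in>J. ?A j) \<union> (?B 1 \<union> ?B (-1))"
      proof
        fix \<omega> assume w: "\<omega> \<in> ?G"
        show "\<omega> \<in> (\<Union>j\<in>J. ?A j) \<union> (?B 1 \<union> ?B (-1))"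
        proof (cases "\<exists>j\<in>J. y < \<bar>real_of_int (X j \<omega>) - \<mu>\<bar>")
          case True then show ?thesis using w by auto
        next
          case False
          then have le: "\<bar>real_of_int (X j \<omega>) - \<mu>\<bar> \<le> y" if "j \<in> J" for j using that by auto
          then have "\<not> h * x n < \<bar>real_of_int (X j \<omega>) - \<mu>\<bar>" if "j \<in> J" for j using that y by force
          then have "h * x n \<le> \<bar>\<Sum>j\<in>J. real_of_int (X j \<omega>) - \<mu>\<bar>" using w by auto
          moreover have "(\<Sum>j\<in>J. - 1 * (real_of_int (X j \<omega>) - \<mu>)) = - (\<Sum>j\<in>J. real_of_int (X j \<omega>) - \<mu>)"
            by (simp only: sum_negf[symmetric]) simp
          ultimately have "h * x n \<le> (\<Sum>j\<in>J. 1 * (real_of_int (X j \<omega>) - \<mu>)) \<or> h * x n \<le> (\<Sum>j\<in>J. - 1 * (real_of_int (X j \<omega>) - \<mu>))"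
            by (auto simp: abs_if split: if_splits)
          moreover have "1 * (real_of_int (X j \<omega>) - \<mu>) \<le> y" "- 1 * (real_of_int (X j \<omega>) - \<mu>) \<le> y" if "j \<in> J" for j
            using le[OF that] by auto
          ultimately show ?thesis using w by blast
        qed
      qed
      then have "prob ?G \<le> prob ((\<Union>j\<in>J. ?A j) \<union> (?B 1 \<union> ?B (-1)))"
        using mA mB J(1) by (intro finite_measure_mono) auto
      also have "\<dots> \<le> prob (\<Union>j\<in>J. ?A j) + (prob (?B 1) + prob (?B (-1)))"
        using mA mB J(1) by (intro order_trans[OF measure_Un_le] add_mono order_refl sets.Un) auto
      also have "prob (\<Union>j\<in>J. ?A j) \<le> (\<Sum>j\<in>J. prob (?A j))"
        using mA J(1) by (intro finite_measure_subadditive_finite) auto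
      also have "\<dots> \<le> (\<Sum>j\<in>J. \<tau> y / y)"
      proof (rule sum_mono)
        fix j assume "j \<in> J"
        then have "j \<ge> 1" using J by auto
        then show "prob (?A j) \<le> \<tau> y / y" using tail_le[OF y(1)] by (subst prob_X) auto
      qed
      also have "\<dots> = real (card J) * (\<tau> y / y)" by simp
      also have "\<dots> \<le> real n * (\<tau> y / y)" using J(3) \<tau>_nonneg[of y] y by (intro mult_right_mono) auto
      also have "\<dots> \<le> E" unfolding E_def using V_nonneg[of y] by (intro mult_left_mono) auto
      also have "prob (?B \<sigma>) \<le> e / 4" if "\<bar>\<sigma>\<bar> = 1" for \<sigma>
      proof -
        have "prob (?B \<sigma>) \<le> exp (- (1 / y) * (h * x n) + real (card J) * ((1 / y)\<^sup>2 * V y + 1 / y * \<tau> y))"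
          using y J by (intro chernoff that) auto
        also have "\<dots> \<le> exp (- L + 1)"
        proof -
          have "real (card J) * ((1 / y)\<^sup>2 * V y + 1 / y * \<tau> y) \<le> real n * ((1 / y)\<^sup>2 * V y + 1 / y * \<tau> y)"
            using J(3) y V_nonneg[of y] \<tau>_nonneg[of y] by (intro mult_right_mono) auto
          also have "\<dots> = E" by (simp add: E_def power_divide)
          finally have "real (card J) * ((1 / y)\<^sup>2 * V y + 1 / y * \<tau> y) \<le> 1" using E by simp
          moreover have "(1 / y) * (h * x n) = h / \<eta>" using elim by (simp add: y_def)
          ultimately show ?thesis using \<eta>(4) by simp
        qed
        also have "\<dots> \<le> e / 4" by (rule L(2))
        finally show ?thesis .
      qed
      from add_mono[OF this[of 1] this[of "-1"]] have "prob (?B 1) + prob (?B (-1)) \<le> e / 4 + e / 4" by simp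
      finally show "prob ?G \<le> e" using E(2) by linarith
    qed
  qed
qed

end

section \<open>Decomposition over the index of the big jump\<close>

context iid_integers
begin

lemma T_split: "i \<in> {1..n} \<Longrightarrow> X i \<omega> + T ({1..n} - {i}) \<omega> = T {1..n} \<omega>"
  unfolding T_def by (subst sum.remove[of "{1..n}" i]) auto

lemma sum_centered: "(\<Sum>j\<in>J. real_of_int (X j \<omega>) - \<mu>) = real_of_int (T J \<omega>) - real (card J) * \<mu>"
  by (simp add: T_def sum_subtractf)

lemma partial_max_measurable:
  assumes "n \<ge> 1"
  shows "partial_max X n \<in> measurable M (count_space UNIV)"
proof -
  have [measurable]: "X i \<in> measurable M (count_space UNIV)" if "i \<in> {1..n}" for i using that X_meas by auto
  have "partial_max X n = (\<lambda>\<omega>. \<lfloor>Max ((\<lambda>i. real_of_int (X i \<omega>)) ` {1..n})\<rfloor>)"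
  proof
    fix \<omega>
    have "real_of_int (Max ((\<lambda>i. X i \<omega>) ` {1..n})) = Max (real_of_int ` ((\<lambda>i. X i \<omega>) ` {1..n}))"
      using assms by (intro mono_Max_commute) (auto simp: mono_def)
    then show "partial_max X n \<omega> = \<lfloor>Max ((\<lambda>i. real_of_int (X i \<omega>)) ` {1..n})\<rfloor>"
      unfolding partial_max_def image_image by (metis floor_of_int)
  qed
  also have "\<dots> \<in> measurable M (count_space UNIV)" by measurable
  finally show ?thesis .
qed

lemma partial_max_ge: "i \<in> {1..n} \<Longrightarrow> X i \<omega> \<le> partial_max X n \<omega>"
  unfolding partial_max_def by (intro Max_ge) auto

lemma partial_max_attained: "n \<ge> 1 \<Longrightarrow> \<exists>i\<in>{1..n}. partial_max X n \<omega> = X i \<omega>"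
  using Max_in[of "(\<lambda>i. X i \<omega>) ` {1..n}"] unfolding partial_max_def by fastforce

lemma one_jump_upper:
  assumes q: "\<And>k. k \<in> B \<Longrightarrow> p k \<le> q" "0 \<le> q"
    and c: "\<And>i. i \<in> {1..n} \<Longrightarrow> prob {\<omega> \<in> space M. s - T ({1..n} - {i}) \<omega> \<in> B \<and> (\<forall>j\<in>{1..n} - {i}. X j \<omega> \<in> A)} \<le> c"
  shows "prob {\<omega> \<in> space M. T {1..n} \<omega> = s \<and> (\<exists>i\<in>{1..n}. X i \<omega> \<in> B \<and> (\<forall>j\<in>{1..n} - {i}. X j \<omega> \<in> A))} \<le> real n * q * c"
proof -
  have [measurable]: "X i \<in> measurable M (count_space UNIV)" if "i \<in> {1..n}" for i using that X_meas by auto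
  have T [measurable]: "T J \<in> measurable M (count_space UNIV)" if "J \<subseteq> {1..n}" for J using that by (intro T_meas) auto
  let ?E = "\<lambda>i. {\<omega> \<in> space M. X i \<omega> \<in> B \<and> X i \<omega> + T ({1..n} - {i}) \<omega> = s \<and> (\<forall>j\<in>{1..n} - {i}. X j \<omega> \<in> A)}"
  have E: "?E i \<in> events" if "i \<in> {1..n}" for i
  proof -
    have [measurable]: "T ({1..n} - {i}) \<in> measurable M (count_space UNIV)" by (rule T) auto
    show ?thesis using that by measurable
  qed
  have "{\<omega> \<in> space M. T {1..n} \<omega> = s \<and> (\<exists>i\<in>{1..n}. X i \<omega> \<in> B \<and> (\<forall>j\<in>{1..n} - {i}. X j \<omega> \<in> A))} = (\<Union>i\<in>{1..n}. ?E i)"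
    using T_split by fastforce
  also have "prob \<dots> \<le> (\<Sum>i\<in>{1..n}. prob (?E i))" using E by (intro finite_measure_subadditive_finite) auto
  also have "\<dots> \<le> (\<Sum>i\<in>{1..n}. q * c)"
  proof (rule sum_mono)
    fix i assume i: "i \<in> {1..n}"
    have "prob (?E i) \<le> q * prob {\<omega> \<in> space M. s - T ({1..n} - {i}) \<omega> \<in> B \<and> (\<forall>j\<in>{1..n} - {i}. X j \<omega> \<in> A)}"
      by (rule split_upper) (use i q in auto)
    also have "\<dots> \<le> q * c" by (rule mult_left_mono[OF c[OF i] q(2)])
    finally show "prob (?E i) \<le> q * c" .
  qed
  finally show ?thesis by (simp add: mult.assoc)
qed

text \<open>Disjointness of \<open>A\<close> and \<open>B\<close> makes the jump index unique, so
  the events for different indices are disjoint and their probabilities add up exactly.\<close>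

lemma one_jump_lower:
  assumes q: "\<And>k. k \<in> B \<Longrightarrow> q \<le> p k" "0 \<le> q" and disj: "B \<inter> A = {}"
    and c: "\<And>i. i \<in> {1..n} \<Longrightarrow> c \<le> prob {\<omega> \<in> space M. s - T ({1..n} - {i}) \<omega> \<in> B \<and> (\<forall>j\<in>{1..n} - {i}. X j \<omega> \<in> A)}"
  shows "real n * q * c \<le> prob {\<omega> \<in> space M. T {1..n} \<omega> = s \<and> (\<exists>i\<in>{1..n}. X i \<omega> \<in> B \<and> (\<forall>j\<in>{1..n} - {i}. X j \<omega> \<in> A))}"
proof -
  have [measurable]: "X i \<in> measurable M (count_space UNIV)" if "i \<in> {1..n}" for i using that X_meas by auto
  have T [measurable]: "T J \<in> measurable M (count_space UNIV)" if "J \<subseteq> {1..n}" for J using that by (intro T_meas) auto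
  let ?E = "\<lambda>i. {\<omega> \<in> space M. X i \<omega> \<in> B \<and> X i \<omega> + T ({1..n} - {i}) \<omega> = s \<and> (\<forall>j\<in>{1..n} - {i}. X j \<omega> \<in> A)}"
  have E: "?E i \<in> events" if "i \<in> {1..n}" for i
  proof -
    have [measurable]: "T ({1..n} - {i}) \<in> measurable M (count_space UNIV)" by (rule T) auto
    show ?thesis using that by measurable
  qed
  have "real n * q * c = (\<Sum>i\<in>{1..n}. q * c)" by simp
  also have "\<dots> \<le> (\<Sum>i\<in>{1..n}. prob (?E i))"
  proof (rule sum_mono)
    fix i assume i: "i \<in> {1..n}"
    have "q * c \<le> q * prob {\<omega> \<in> space M. s - T ({1..n} - {i}) \<omega> \<in> B \<and> (\<forall>j\<in>{1..n} - {i}. X j \<omega> \<in> A)}"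
      by (rule mult_left_mono[OF c[OF i] q(2)])
    also have "\<dots> \<le> prob (?E i)"
      by (rule split_lower) (use i q in auto)
    finally show "q * c \<le> prob (?E i)" .
  qed
  also have "\<dots> = prob (\<Union>i\<in>{1..n}. ?E i)"
  proof (rule finite_measure_finite_Union[symmetric])
    show "disjoint_family_on ?E {1..n}" using disj by (fastforce simp: disjoint_family_on_def)
  qed (use E in auto)
  also have "(\<Union>i\<in>{1..n}. ?E i) = {\<omega> \<in> space M. T {1..n} \<omega> = s \<and> (\<exists>i\<in>{1..n}. X i \<omega> \<in> B \<and> (\<forall>j\<in>{1..n} - {i}. X j \<omega> \<in> A))}"
    using T_split by fastforce
  finally show ?thesis .
qed

end

section \<open>Jumps comparable to \<open>x\<close>\<close>

context large_deviation
begin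

lemma s_bounds: "real_of_int (s n) - real n * \<mu> \<le> x n" "x n - 1 \<le> real_of_int (s n) - real n * \<mu>"
  unfolding s_def by (simp, linarith)+

text \<open>Removing one summand shifts the centring by \<open>\<mu>\<close>, and the floor in
  \<open>s n\<close> shifts it by at most \<open>1\<close>. Both are absorbed by applying the weak
  law with \<open>h / 2\<close>. The individual deviations are retained because the lower bound
  needs all other summands to be small.\<close>

lemma weak_law_leave_one_out:
  fixes h e :: real
  assumes h: "0 < h" and e: "0 < e"
  shows "eventually (\<lambda>n. \<forall>i\<in>{1..n}. prob {\<omega> \<in> space M. (\<exists>j\<in>{1..n} - {i}. h * x n < \<bar>real_of_int (X j \<omega>) - \<mu>\<bar>) \<or>
     h * x n < \<bar>real_of_int (s n - T ({1..n} - {i}) \<omega> - x n)\<bar>} \<le> e) sequentially"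
proof -
  have "h / 2 > 0" using h by simp
  from weak_law[OF this e] eventually_x[of "2 * (\<bar>\<mu>\<bar> + 1) / h"] eventually_x[of 0]
  show ?thesis
  proof eventually_elim
    case (elim n)
    have big: "\<bar>\<mu>\<bar> + 1 \<le> h / 2 * x n" using elim(2) h by (simp add: field_simps)
    have hx: "h / 2 * x n \<le> h * x n" using elim(3) h by simp
    show ?case
    proof
      fix i assume i: "i \<in> {1..n}"
      let ?J = "{1..n} - {i}"
      have [measurable]: "X j \<in> measurable M (count_space UNIV)" if "j \<in> ?J" for j using that X_meas by auto
      have c: "real (card ?J) = real n - 1" using i by (simp add: of_nat_diff)
      let ?F = "{\<omega> \<in> space M. (\<exists>j\<in>?J. h / 2 * x n < \<bar>real_of_int (X j \<omega>) - \<mu>\<bar>) \<or> h / 2 * x n \<le> \<bar>\<Sum>j\<in>?J. real_of_int (X j \<omega>) - \<mu>\<bar>}"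
      have "prob {\<omega> \<in> space M. (\<exists>j\<in>?J. h * x n < \<bar>real_of_int (X j \<omega>) - \<mu>\<bar>) \<or>
          h * x n < \<bar>real_of_int (s n - T ?J \<omega> - x n)\<bar>} \<le> prob ?F"
      proof (rule finite_measure_mono)
        show "{\<omega> \<in> space M. (\<exists>j\<in>?J. h * x n < \<bar>real_of_int (X j \<omega>) - \<mu>\<bar>) \<or>
          h * x n < \<bar>real_of_int (s n - T ?J \<omega> - x n)\<bar>} \<subseteq> ?F"
        proof
          fix \<omega> assume w: "\<omega> \<in> {\<omega> \<in> space M. (\<exists>j\<in>?J. h * x n < \<bar>real_of_int (X j \<omega>) - \<mu>\<bar>) \<or>
            h * x n < \<bar>real_of_int (s n - T ?J \<omega> - x n)\<bar>}"
          have "h / 2 * x n \<le> \<bar>\<Sum>j\<in>?J. real_of_int (X j \<omega>) - \<mu>\<bar>" if "h * x n < \<bar>real_of_int (s n - T ?J \<omega> - x n)\<bar>"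
          proof -
            have "real_of_int (s n - T ?J \<omega> - x n) = (real_of_int (s n) - real n * \<mu> - x n) + \<mu> - (real_of_int (T ?J \<omega>) - (real n - 1) * \<mu>)"
              by (simp add: algebra_simps)
            moreover have "h * x n = h / 2 * x n + h / 2 * x n" by simp
            ultimately show ?thesis
              unfolding sum_centered c using that big s_bounds[of n] by linarith
          qed
          moreover have "\<exists>j\<in>?J. h / 2 * x n < \<bar>real_of_int (X j \<omega>) - \<mu>\<bar>" if "\<exists>j\<in>?J. h * x n < \<bar>real_of_int (X j \<omega>) - \<mu>\<bar>"
            using that hx by (meson le_less_trans)
          ultimately show "\<omega> \<in> ?F" using w by blast
        qed
        show "?F \<in> events" by measurable
      qed
      also have "\<dots> \<le> e"
      proof (rule elim(1)[rule_format])
        show "card ?J \<le> n" using c by linarith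
      qed auto
      finally show "prob {\<omega> \<in> space M. (\<exists>j\<in>?J. h * x n < \<bar>real_of_int (X j \<omega>) - \<mu>\<bar>) \<or>
          h * x n < \<bar>real_of_int (s n - T ?J \<omega> - x n)\<bar>} \<le> e" .
    qed
  qed
qed

lemma leave_one_out_events:
  assumes "i \<in> {1..n}"
  shows "{\<omega> \<in> space M. P (T ({1..n} - {i}) \<omega>) \<and> (\<forall>j\<in>{1..n} - {i}. Q (X j \<omega>))} \<in> events"
    and "{\<omega> \<in> space M. (\<exists>j\<in>{1..n} - {i}. Q (X j \<omega>)) \<or> P (T ({1..n} - {i}) \<omega>)} \<in> events"
proof -
  have [measurable]: "X j \<in> measurable M (count_space UNIV)" if "j \<in> {1..n} - {i}" for j using that X_meas by auto
  have [measurable]: "T ({1..n} - {i}) \<in> measurable M (count_space UNIV)" by (rule T_meas) auto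
  show "{\<omega> \<in> space M. P (T ({1..n} - {i}) \<omega>) \<and> (\<forall>j\<in>{1..n} - {i}. Q (X j \<omega>))} \<in> events"
    "{\<omega> \<in> space M. (\<exists>j\<in>{1..n} - {i}. Q (X j \<omega>)) \<or> P (T ({1..n} - {i}) \<omega>)} \<in> events"
    by measurable
qed

lemma far_jump_negligible:
  fixes \<eta> h e :: real
  assumes \<eta>: "0 < \<eta>" and h: "0 < h" and e: "0 < e"
  shows "eventually (\<lambda>n. prob {\<omega> \<in> space M. T {1..n} \<omega> = s n \<and>
    (\<exists>i\<in>{1..n}. \<eta> * x n \<le> X i \<omega> \<and> h * x n < \<bar>real_of_int (X i \<omega> - x n)\<bar>)} \<le> e * (real n * p (x n))) sequentially"
proof -
  obtain C N where C: "C \<ge> 0" "\<And>x k :: int. N \<le> x \<Longrightarrow> \<eta> * x \<le> k \<Longrightarrow> p k \<le> C * p x"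
    using p_far_le[OF \<eta>] by metis
  define e' where "e' = e / (C + 1)"
  have e': "e' > 0" "C * e' \<le> e" using e C(1) by (auto simp: e'_def field_simps)
  from weak_law_leave_one_out[OF h e'(1)] eventually_x_int[of N]
  show ?thesis
  proof eventually_elim
    case (elim n)
    define B where "B = {k::int. \<eta> * x n \<le> k \<and> h * x n < \<bar>real_of_int (k - x n)\<bar>}"
    have "prob {\<omega> \<in> space M. T {1..n} \<omega> = s n \<and> (\<exists>i\<in>{1..n}. X i \<omega> \<in> B \<and> (\<forall>j\<in>{1..n} - {i}. X j \<omega> \<in> UNIV))}
        \<le> real n * (C * p (x n)) * e'"
    proof (rule one_jump_upper)
      fix i assume i: "i \<in> {1..n}"
      have "prob {\<omega> \<in> space M. s n - T ({1..n} - {i}) \<omega> \<in> B \<and> (\<forall>j\<in>{1..n} - {i}. X j \<omega> \<in> UNIV)}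
        \<le> prob {\<omega> \<in> space M. (\<exists>j\<in>{1..n} - {i}. h * x n < \<bar>real_of_int (X j \<omega>) - \<mu>\<bar>) \<or>
          h * x n < \<bar>real_of_int (s n - T ({1..n} - {i}) \<omega> - x n)\<bar>}"
        by (rule finite_measure_mono[OF _ leave_one_out_events(2)[OF i]]) (auto simp: B_def)
      also have "\<dots> \<le> e'" using elim(1) i by blast
      finally show "prob {\<omega> \<in> space M. s n - T ({1..n} - {i}) \<omega> \<in> B \<and> (\<forall>j\<in>{1..n} - {i}. X j \<omega> \<in> UNIV)} \<le> e'" .
    qed (use C elim(2) p_nonneg in \<open>auto simp: B_def\<close>)
    also have "\<dots> = (C * e') * (real n * p (x n))" by simp
    also have "\<dots> \<le> e * (real n * p (x n))" using e'(2) p_nonneg by (intro mult_right_mono) auto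
    finally show ?case by (simp add: B_def)
  qed
qed

lemma p_eventually_pos: "eventually (\<lambda>n. 0 < p (x n)) sequentially"
proof -
  obtain D N where "\<And>k. N \<le> k \<Longrightarrow> 0 < p k" using p_doubling by metis
  then show ?thesis using eventually_x_int[of N] by (auto elim: eventually_mono)
qed

text \<open>Bounding the probability for the remaining sum by \<open>1\<close> suffices here; only
  the matching lower bound needs the weak law. The window must shrink with \<open>e\<close>, since
  \<open>p\<close> is nearly constant only on narrow windows.\<close>

lemma near_jump_upper:
  fixes e :: real
  assumes e: "0 < e" "e < 1"
  shows "\<exists>h0>0::real. \<forall>h\<le>h0. eventually (\<lambda>n. prob {\<omega> \<in> space M. T {1..n} \<omega> = s n \<and>
    (\<exists>i\<in>{1..n}. \<bar>real_of_int (X i \<omega> - x n)\<bar> \<le> h * x n)} \<le> (1 + e) * (real n * p (x n))) sequentially"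
proof -
  obtain h0 N where h0: "h0 > 0" "N > 0" "\<And>k l::int. N \<le> k \<Longrightarrow> \<bar>real_of_int l - k\<bar> \<le> h0 * k \<Longrightarrow> p l \<le> (1 + e) * p k"
    using irv_uniform[OF irv p_nonneg e] by blast
  show ?thesis
  proof (intro exI[of _ h0] conjI allI impI h0(1))
    fix h assume h: "h \<le> h0"
    from eventually_x_int[of N]
    show "eventually (\<lambda>n. prob {\<omega> \<in> space M. T {1..n} \<omega> = s n \<and>
      (\<exists>i\<in>{1..n}. \<bar>real_of_int (X i \<omega> - x n)\<bar> \<le> h * x n)} \<le> (1 + e) * (real n * p (x n))) sequentially"
    proof eventually_elim
      case (elim n)
      define B where "B = {k::int. \<bar>real_of_int (k - x n)\<bar> \<le> h * x n}"
      have "prob {\<omega> \<in> space M. T {1..n} \<omega> = s n \<and> (\<exists>i\<in>{1..n}. X i \<omega> \<in> B \<and> (\<forall>j\<in>{1..n} - {i}. X j \<omega> \<in> UNIV))}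
        \<le> real n * ((1 + e) * p (x n)) * 1"
      proof (rule one_jump_upper)
        fix k assume "k \<in> B"
        moreover have "h * x n \<le> h0 * x n" using h elim h0(2) by (intro mult_right_mono) auto
        ultimately show "p k \<le> (1 + e) * p (x n)" using elim by (intro h0(3)) (auto simp: B_def)
      qed (use e p_nonneg in auto)
      then show ?case by (simp add: B_def mult_ac)
    qed
  qed
qed

text \<open>With \<open>g \<le> 1/4\<close> the jump is at least \<open>3/4 * x\<close> while the
  other summands are kept below \<open>1/2 * x\<close>. This makes the jump the maximum and its
  index unique. One factor \<open>1 - e/2\<close> comes from the variation of \<open>p\<close> on
  the window, the other from the weak law.\<close>

lemma near_max_lower:
  fixes h e :: real
  assumes e: "0 < e" "e < 1" and h: "0 < h"
  shows "eventually (\<lambda>n. (1 - e) * (real n * p (x n)) \<le> prob {\<omega> \<in> space M. T {1..n} \<omega> = s n \<and>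
    \<bar>real_of_int (partial_max X n \<omega> - x n)\<bar> \<le> h * x n}) sequentially"
proof -
  have e2: "0 < e / 2" "e / 2 < 1" using e by auto
  obtain h0 N where h0: "h0 > 0" "N > 0" "\<And>k l::int. N \<le> k \<Longrightarrow> \<bar>real_of_int l - k\<bar> \<le> h0 * k \<Longrightarrow> (1 - e / 2) * p k \<le> p l"
    using irv_uniform[OF irv p_nonneg e2] by blast
  define g where "g = min (min h h0) (1/4)"
  have g: "0 < g" "g \<le> h" "g \<le> h0" "g \<le> 1/4" using h h0(1) by (auto simp: g_def)
  from weak_law_leave_one_out[OF g(1) e2(1)] eventually_x_int[of N] eventually_x[of "4 * \<bar>\<mu>\<bar> + 1"] eventually_ge_at_top[of 1]
  show ?thesis
  proof eventually_elim
    case (elim n)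
    have xpos: "real_of_int (x n) > 0" using elim(3) by linarith
    have gx: "g * x n \<le> h * x n" "g * x n \<le> h0 * x n" "g * x n \<le> 1/4 * x n"
      using xpos g by (auto intro: mult_right_mono)
    define B where "B = {k::int. \<bar>real_of_int (k - x n)\<bar> \<le> g * x n}"
    define A where "A = {k::int. real_of_int k \<le> 1/2 * x n}"
    let ?G = "{\<omega> \<in> space M. T {1..n} \<omega> = s n \<and> (\<exists>i\<in>{1..n}. X i \<omega> \<in> B \<and> (\<forall>j\<in>{1..n} - {i}. X j \<omega> \<in> A))}"
    have BA: "real_of_int k \<ge> 3/4 * x n" if "k \<in> B" for k using that gx(3) by (auto simp: B_def)
    have "(1 - e) * (real n * p (x n)) \<le> ((1 - e / 2) * (1 - e / 2)) * (real n * p (x n))"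
      using e p_nonneg by (intro mult_right_mono) (auto simp: algebra_simps)
    also have "\<dots> = real n * ((1 - e / 2) * p (x n)) * (1 - e / 2)" by simp
    also have "\<dots> \<le> prob ?G"
    proof (rule one_jump_lower)
      fix k assume "k \<in> B" then show "(1 - e / 2) * p (x n) \<le> p k"
        using elim(2) gx(2) by (intro h0(3)) (auto simp: B_def)
    next
      show "B \<inter> A = {}" using BA xpos by (force simp: A_def)
    next
      fix i assume i: "i \<in> {1..n}"
      let ?H = "{\<omega> \<in> space M. s n - T ({1..n} - {i}) \<omega> \<in> B \<and> (\<forall>j\<in>{1..n} - {i}. X j \<omega> \<in> A)}"
      let ?F = "{\<omega> \<in> space M. (\<exists>j\<in>{1..n} - {i}. g * x n < \<bar>real_of_int (X j \<omega>) - \<mu>\<bar>) \<or>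
          g * x n < \<bar>real_of_int (s n - T ({1..n} - {i}) \<omega> - x n)\<bar>}"
      have H: "?H \<in> events" "?F \<in> events"
        by (rule leave_one_out_events(1)[OF i]) (rule leave_one_out_events(2)[OF i])
      have "space M - ?H \<subseteq> ?F"
      proof
        fix \<omega> assume w: "\<omega> \<in> space M - ?H"
        show "\<omega> \<in> ?F"
        proof (cases "\<exists>j\<in>{1..n} - {i}. X j \<omega> \<notin> A")
          case True
          then obtain j where j: "j \<in> {1..n} - {i}" "X j \<omega> \<notin> A" by blast
          then have "real_of_int (X j \<omega>) > 1/2 * x n" by (simp add: A_def)
          then have "g * x n < \<bar>real_of_int (X j \<omega>) - \<mu>\<bar>" using gx(3) elim(3) by linarith
          then show ?thesis using j(1) w by auto
        next
          case False
          then have "s n - T ({1..n} - {i}) \<omega> \<notin> B" using w by auto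
          then show ?thesis using w by (auto simp: B_def)
        qed
      qed
      then have "prob (space M - ?H) \<le> prob ?F" using H by (intro finite_measure_mono) auto
      also have "\<dots> \<le> e / 2" using elim(1) i by blast
      finally show "1 - e / 2 \<le> prob ?H" using H(1) by (simp add: prob_compl)
    qed (use e p_nonneg in auto)
    also have "\<dots> \<le> prob {\<omega> \<in> space M. T {1..n} \<omega> = s n \<and> \<bar>real_of_int (partial_max X n \<omega> - x n)\<bar> \<le> h * x n}"
    proof (rule finite_measure_mono)
      show "?G \<subseteq> {\<omega> \<in> space M. T {1..n} \<omega> = s n \<and> \<bar>real_of_int (partial_max X n \<omega> - x n)\<bar> \<le> h * x n}"
      proof
        fix \<omega> assume w: "\<omega> \<in> ?G"
        then obtain i where i: "i \<in> {1..n}" "X i \<omega> \<in> B" "\<forall>j\<in>{1..n} - {i}. X j \<omega> \<in> A" by blast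
        obtain i' where i': "i' \<in> {1..n}" "partial_max X n \<omega> = X i' \<omega>" using partial_max_attained[of n \<omega>] elim(4) by blast
        have "i' = i"
        proof (rule ccontr)
          assume "i' \<noteq> i"
          then have "X i' \<omega> \<in> A" using i i' by auto
          then have "real_of_int (X i' \<omega>) < X i \<omega>" using BA[OF i(2)] xpos by (simp add: A_def)
          then show False using partial_max_ge[OF i(1), of \<omega>] i'(2) by simp
        qed
        then have "\<bar>real_of_int (partial_max X n \<omega> - x n)\<bar> \<le> g * x n" using i(2) i'(2) by (auto simp: B_def)
        then show "\<omega> \<in> {\<omega> \<in> space M. T {1..n} \<omega> = s n \<and> \<bar>real_of_int (partial_max X n \<omega> - x n)\<bar> \<le> h * x n}"
          using w gx(1) by auto
      qed
      have [measurable]: "T {1..n} \<in> measurable M (count_space UNIV)" by (rule T_meas) auto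
      note [measurable] = partial_max_measurable[OF elim(4)]
      show "{\<omega> \<in> space M. T {1..n} \<omega> = s n \<and> \<bar>real_of_int (partial_max X n \<omega> - x n)\<bar> \<le> h * x n} \<in> events"
        by measurable
    qed
    finally show ?case .
  qed
qed

end

section \<open>Small jumps by dyadic shells, and the resulting asymptotics\<close>

lemma dyadic_shell:
  fixes m x :: int
  assumes m: "0 < m" "m \<le> x / 2 ^ J" and J: "1 \<le> J"
  obtains j where "J \<le> j" "j < nat x" "x / 2 ^ (j + 1) < m" "m \<le> x / 2 ^ j"
proof -
  have xm: "real_of_int x \<ge> 2 ^ J * m" using m by (simp add: field_simps)
  have "real_of_int x > 0" using m by (smt (verit) divide_nonpos_pos of_int_0_less_iff zero_less_power)
  obtain i where i: "x / m < 2 ^ i" using real_arch_pow[of 2 "x/m"] by auto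
  have "(2::real) ^ i \<le> 2 ^ (i + 1)" by (intro power_increasing) auto
  then have "x / m < 2 ^ (i + 1)" using i by linarith
  then have i: "x / 2 ^ (i + 1) < m" using m by (simp add: field_simps)
  define j where "j = (LEAST i. x / 2 ^ (i + 1) < real_of_int m)"
  have j: "x / 2 ^ (j + 1) < m" unfolding j_def by (rule LeastI[of _ i]) (rule i)
  have "J \<le> j"
  proof (rule ccontr)
    assume "\<not> J \<le> j"
    then have "(2::real) ^ (j + 1) \<le> 2 ^ J" by (intro power_increasing) auto
    then have "x / 2 ^ J \<le> x / 2 ^ (j + 1)" using \<open>real_of_int x > 0\<close> by (intro divide_left_mono) auto
    then show False using j m(2) by linarith
  qed
  then obtain j' where j': "j = Suc j'" using J by (cases j) auto
  have "\<not> x / 2 ^ (j' + 1) < real_of_int m"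
    using not_less_Least[of j' "\<lambda>i. x / 2 ^ (i + 1) < real_of_int m"] j' unfolding j_def by auto
  then have mj: "m \<le> x / 2 ^ j" using j' by simp
  \<comment> \<open>As \<open>m\<close> is a positive integer, \<open>2 ^ j \<le> x\<close>; only
    finitely many shells occur, and a finite union bound will suffice.\<close>
  have "2 ^ j * 1 \<le> 2 ^ j * real_of_int m" using m(1) by (intro mult_left_mono) auto
  also have "\<dots> \<le> x" using mj by (simp add: field_simps)
  finally have "(2::real) ^ j \<le> real (nat x)" using \<open>real_of_int x > 0\<close> by simp
  moreover have "real j < 2 ^ j" by (rule of_nat_less_two_power)
  ultimately have "j < nat x" by linarith
  then show ?thesis using that \<open>J \<le> j\<close> j mj by blast
qed

text \<open>The ratio of consecutive terms is \<open>D * exp (- (2 ^ n / 256))\<close>, which drops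
  below \<open>1/2\<close> once \<open>2 ^ n \<ge> 512 * D\<close>.\<close>

lemma summable_doubly_exponential:
  fixes D :: real
  assumes "D \<ge> 1"
  shows "summable (\<lambda>j. D ^ (j + 2) * exp (- (2 ^ j) / 256))"
proof -
  obtain N where N: "512 * D < 2 ^ N" using real_arch_pow[of 2 "512 * D"] by auto
  show ?thesis
  proof (rule summable_ratio_test[of "1/2" N])
    fix n assume "N \<le> n"
    then have "(2::real) ^ N \<le> 2 ^ n" by (intro power_increasing) auto
    then have n: "2 * D \<le> 2 ^ n / 256" using N by linarith
    also have "\<dots> \<le> exp (2 ^ n / 256)" using exp_ge_add_one_self[of "2 ^ n / 256 :: real"] by linarith
    finally have "2 * D * exp (- (2 ^ n / 256)) \<le> 1" by (simp add: exp_minus field_simps)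
    then have 1: "D * exp (- (2 ^ n / 256)) \<le> 1 / 2" by simp
    have "exp (- (2 ^ Suc n) / 256) = exp (- (2 ^ n) / 256) * exp (- (2 ^ n / 256) :: real)" by (simp flip: exp_add)
    then have "D ^ (Suc n + 2) * exp (- (2 ^ Suc n) / 256) = (D * exp (- (2 ^ n / 256))) * (D ^ (n + 2) * exp (- (2 ^ n) / 256))"
      by (simp add: mult_ac)
    also have "\<dots> \<le> 1 / 2 * (D ^ (n + 2) * exp (- (2 ^ n) / 256))" using 1 assms by (intro mult_right_mono) auto
    finally show "norm (D ^ (Suc n + 2) * exp (- (2 ^ Suc n) / 256)) \<le> 1 / 2 * norm (D ^ (n + 2) * exp (- (2 ^ n) / 256))"
      using assms by (simp add: abs_mult)
  qed simp
qed

context large_deviation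
begin

lemma T_events:
  shows "{\<omega> \<in> space M. T {1..n} \<omega> = a \<and> (\<exists>i\<in>{1..n}. Q (X i \<omega>))} \<in> events"
    and "{\<omega> \<in> space M. T {1..n} \<omega> = a} \<in> events"
    and "n \<ge> 1 \<Longrightarrow> {\<omega> \<in> space M. T {1..n} \<omega> = a \<and> Q (partial_max X n \<omega>)} \<in> events"
proof -
  have [measurable]: "X j \<in> measurable M (count_space UNIV)" if "j \<in> {1..n}" for j using that X_meas by auto
  have [measurable]: "T {1..n} \<in> measurable M (count_space UNIV)" by (rule T_meas) auto
  show "{\<omega> \<in> space M. T {1..n} \<omega> = a \<and> (\<exists>i\<in>{1..n}. Q (X i \<omega>))} \<in> events"
    "{\<omega> \<in> space M. T {1..n} \<omega> = a} \<in> events" by measurable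
  assume "n \<ge> 1"
  note [measurable] = partial_max_measurable[OF this]
  show "{\<omega> \<in> space M. T {1..n} \<omega> = a \<and> Q (partial_max X n \<omega>)} \<in> events" by measurable
qed

text \<open>A sandwich applied to several event families: \<open>low\<close> gives the lower bound
  through \<open>near_max_lower\<close>, while \<open>up\<close> says that up to a negligible event
  \<open>F n\<close> forces a jump comparable to \<open>x\<close>. Such a jump is either near
  \<open>x\<close> or far from it, so the upper error is \<open>3 * e\<close>: one \<open>e\<close>
  each for the near jumps, the far jumps and the exceptional event.\<close>

lemma one_big_jump:
  fixes h :: real
  assumes h: "0 < h"
    and low: "eventually (\<lambda>n. {\<omega> \<in> space M. T {1..n} \<omega> = s n \<and> \<bar>real_of_int (partial_max X n \<omega> - x n)\<bar> \<le> h * x n} \<subseteq> F n) sequentially"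
    and meas: "eventually (\<lambda>n. F n \<in> events) sequentially"
    and up: "\<And>e::real. 0 < e \<Longrightarrow> \<exists>\<eta>>0::real. eventually (\<lambda>n. \<exists>R\<in>events. prob R \<le> e * (real n * p (x n)) \<and>
      F n \<subseteq> {\<omega> \<in> space M. T {1..n} \<omega> = s n \<and> (\<exists>i\<in>{1..n}. \<eta> * x n \<le> X i \<omega>)} \<union> R) sequentially"
  shows "(\<lambda>n. prob (F n) / (real n * p (x n))) \<longlonglongrightarrow> 1"
proof (rule tendstoI)
  fix e' :: real assume e': "0 < e'"
  define e where "e = min (e' / 4) (1 / 2)"
  have e: "0 < e" "e < 1" "3 * e < e'" using e' by (auto simp: e_def)
  obtain h0 :: real where h0: "h0 > 0" "\<forall>h\<le>h0. eventually (\<lambda>n. prob {\<omega> \<in> space M. T {1..n} \<omega> = s n \<and>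
    (\<exists>i\<in>{1..n}. \<bar>real_of_int (X i \<omega> - x n)\<bar> \<le> h * x n)} \<le> (1 + e) * (real n * p (x n))) sequentially"
    using near_jump_upper[OF e(1,2)] by (elim exE conjE)
  obtain \<eta> :: real where \<eta>: "\<eta> > 0" "eventually (\<lambda>n. \<exists>R\<in>events. prob R \<le> e * (real n * p (x n)) \<and>
      F n \<subseteq> {\<omega> \<in> space M. T {1..n} \<omega> = s n \<and> (\<exists>i\<in>{1..n}. \<eta> * x n \<le> X i \<omega>)} \<union> R) sequentially"
    using up[OF e(1)] by blast
  from h0(2)[rule_format, OF order_refl] \<eta>(2) far_jump_negligible[OF \<eta>(1) h0(1) e(1)] near_max_lower[OF e(1,2) h] low meas
    p_eventually_pos eventually_ge_at_top[of 1]
  show "eventually (\<lambda>n. dist (prob (F n) / (real n * p (x n))) 1 < e') sequentially"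
  proof eventually_elim
    case (elim n)
    define g where "g = real n * p (x n)"
    have g: "g > 0" using elim(7,8) by (simp add: g_def)
    let ?N = "{\<omega> \<in> space M. T {1..n} \<omega> = s n \<and> (\<exists>i\<in>{1..n}. \<bar>real_of_int (X i \<omega> - x n)\<bar> \<le> h0 * x n)}"
    let ?G = "{\<omega> \<in> space M. T {1..n} \<omega> = s n \<and> (\<exists>i\<in>{1..n}. \<eta> * x n \<le> X i \<omega> \<and> h0 * x n < \<bar>real_of_int (X i \<omega> - x n)\<bar>)}"
    obtain R where R: "R \<in> events" "prob R \<le> e * g"
      "F n \<subseteq> {\<omega> \<in> space M. T {1..n} \<omega> = s n \<and> (\<exists>i\<in>{1..n}. \<eta> * x n \<le> X i \<omega>)} \<union> R"
      using elim(2) unfolding g_def by blast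
    have ev: "?N \<in> events" "?G \<in> events" by (rule T_events(1))+
    have "F n \<subseteq> ?N \<union> (?G \<union> R)"
    proof
      fix \<omega> assume "\<omega> \<in> F n"
      then consider "\<omega> \<in> R" | i where "\<omega> \<in> space M" "T {1..n} \<omega> = s n" "i \<in> {1..n}" "\<eta> * x n \<le> X i \<omega>" using R(3) by blast
      then show "\<omega> \<in> ?N \<union> (?G \<union> R)"
      proof cases
        case 2
        show ?thesis
        proof (cases "\<bar>real_of_int (X i \<omega> - x n)\<bar> \<le> h0 * x n")
          case True
          then have "\<exists>i\<in>{1..n}. \<bar>real_of_int (X i \<omega> - x n)\<bar> \<le> h0 * x n" using 2(3) by (rule bexI)
          then have "\<omega> \<in> ?N" using 2(1,2) by simp
          then show ?thesis by (rule UnI1)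
        next
          case False
          then have "\<exists>i\<in>{1..n}. \<eta> * x n \<le> X i \<omega> \<and> h0 * x n < \<bar>real_of_int (X i \<omega> - x n)\<bar>"
            using 2(3,4) by (intro bexI[of _ i]) auto
          then have "\<omega> \<in> ?G" using 2(1,2) by simp
          then show ?thesis by (intro UnI2 UnI1)
        qed
      qed blast
    qed
    then have "prob (F n) \<le> prob (?N \<union> (?G \<union> R))" using ev R(1) by (intro finite_measure_mono) auto
    also have "\<dots> \<le> prob ?N + (prob ?G + prob R)"
      by (intro order_trans[OF measure_Un_le] add_mono order_refl measure_Un_le sets.Un ev R(1))
    also have "\<dots> \<le> (1 + e) * g + (e * g + e * g)"
      using elim(1,3) R(2) unfolding g_def[symmetric] by (intro add_mono) auto
    finally have 1: "prob (F n) \<le> (1 + 3 * e) * g" by (simp add: algebra_simps)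
    have "(1 - e) * g \<le> prob {\<omega> \<in> space M. T {1..n} \<omega> = s n \<and> \<bar>real_of_int (partial_max X n \<omega> - x n)\<bar> \<le> h * x n}"
      using elim(4) unfolding g_def .
    also have "\<dots> \<le> prob (F n)" using elim(5,6) by (intro finite_measure_mono)
    finally have 2: "1 - e \<le> prob (F n) / g" using g by (simp add: field_simps)
    have "prob (F n) / g \<le> 1 + 3 * e" using 1 g by (simp add: field_simps)
    with 2 show ?case using e unfolding g_def[symmetric] dist_real_def by linarith
  qed
qed

text \<open>A jump of size about \<open>x / 2\<^sup>j\<close> gains at most a factor \<open>D\<^sup>j\<close> over \<open>p x\<close>, but the remaining sum then has
  to be large without large jumps, which costs a factor doubly exponential in \<open>j\<close>.\<close>

lemma dyadic_jump_le:
  fixes R :: "nat \<Rightarrow> real"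
  assumes R: "filterlim R at_top sequentially"
    and cost: "eventually (\<lambda>n. \<forall>y\<ge>R n. real n * (V y / y) \<le> 4 * real_of_int (x n)) sequentially"
  shows "\<exists>D\<ge>1. eventually (\<lambda>n. \<forall>j\<ge>2. prob {\<omega> \<in> space M. T {1..n} \<omega> = s n \<and>
      (\<exists>i\<in>{1..n}. X i \<omega> \<in> {k. R n < k \<and> x n / 2 ^ (j + 1) < k \<and> k \<le> x n / 2 ^ j} \<and>
         (\<forall>l\<in>{1..n} - {i}. X l \<omega> \<in> {k. k \<le> x n / 2 ^ j}))}
      \<le> (D ^ (j + 2) * exp (- (2 ^ j) / 256)) * (real n * p (x n))) sequentially"
proof -
  obtain D N where D: "D \<ge> 1" "N > 0" "\<And>k x j. N \<le> k \<Longrightarrow> N \<le> x \<Longrightarrow> x \<le> 2 ^ j * k \<Longrightarrow> p k \<le> D ^ (j + 1) * p x"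
    using p_doubling by metis
  obtain y1 where y1: "y1 > 0" "\<And>y n J x z. y1 \<le> y \<Longrightarrow> finite J \<Longrightarrow> J \<subseteq> {1..} \<Longrightarrow> card J \<le> n \<Longrightarrow>
     real n * (V (2 * y) / (2 * y)) \<le> 4 * x \<Longrightarrow> 0 \<le> x \<Longrightarrow> x / 2 \<le> z \<Longrightarrow>
     prob {\<omega> \<in> space M. z \<le> (\<Sum>j\<in>J. real_of_int (X j \<omega>) - \<mu>) \<and> (\<forall>j\<in>J. real_of_int (X j \<omega>) \<le> y)} \<le> exp (- x / (256 * y))"
    by (rule truncated_sum_tail, rule that)
  have "eventually (\<lambda>n. max y1 (real_of_int N) \<le> R n) sequentially" using R unfolding filterlim_at_top by blast
  from this cost eventually_x[of "4 * (1 + \<bar>\<mu>\<bar>)"] eventually_x_int[of N]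
  have "eventually (\<lambda>n. \<forall>j\<ge>2. prob {\<omega> \<in> space M. T {1..n} \<omega> = s n \<and>
      (\<exists>i\<in>{1..n}. X i \<omega> \<in> {k. R n < k \<and> x n / 2 ^ (j + 1) < k \<and> k \<le> x n / 2 ^ j} \<and>
         (\<forall>l\<in>{1..n} - {i}. X l \<omega> \<in> {k. k \<le> x n / 2 ^ j}))}
      \<le> (D ^ (j + 2) * exp (- (2 ^ j) / 256)) * (real n * p (x n))) sequentially"
  proof eventually_elim
    case (elim n)
    show ?case
    proof (intro allI impI)
      fix j :: nat assume j: "j \<ge> 2"
      define y where "y = x n / 2 ^ j"
      define A where "A = {k::int. k \<le> y}"
      define B where "B = {k::int. R n < k \<and> x n / 2 ^ (j + 1) < k \<and> k \<le> y}"
      have xpos: "real_of_int (x n) > 0" by (rule less_le_trans[OF _ elim(3)]) (simp add: add_pos_nonneg)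
      \<comment> \<open>This is where \<open>j \<ge> 2\<close> matters: the jump takes at most
        \<open>x/4\<close>, and the floor together with the removed mean takes at most another
        \<open>x/4\<close>, so the centred rest must still reach \<open>x/2\<close>.\<close>
      have "(2::real) ^ 2 \<le> 2 ^ j" using j by (intro power_increasing) auto
      then have "x n / 2 ^ j \<le> x n / 4" using xpos by (intro divide_left_mono) auto
      then have y4: "y \<le> x n / 4" by (simp add: y_def)
      have xy: "x n / y = 2 ^ j" using xpos by (simp add: y_def)
      have "prob {\<omega> \<in> space M. T {1..n} \<omega> = s n \<and> (\<exists>i\<in>{1..n}. X i \<omega> \<in> B \<and> (\<forall>l\<in>{1..n} - {i}. X l \<omega> \<in> A))}
        \<le> real n * (D ^ (j + 2) * p (x n)) * exp (- (2 ^ j) / 256)"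
      \<comment> \<open>A shell entirely below \<open>R n\<close> is empty. Otherwise
        \<open>R n < y\<close>, so the cost condition is available at \<open>2 * y\<close>; the cut
        at \<open>R n\<close> also keeps the jumps in the range where the doubling bound for
        \<open>p\<close> holds.\<close>
      proof (cases "y \<le> R n")
        case True
        then have "B = {}" by (auto simp: B_def)
        then show ?thesis using D(1) p_nonneg[of "x n"] by simp
      next
        case False
        show ?thesis
        proof (rule one_jump_upper)
          fix k assume k: "k \<in> B"
          then have "real_of_int N \<le> real_of_int k" using elim(1) unfolding B_def by auto
          moreover have "real_of_int (x n) \<le> real_of_int (2 ^ (j + 1) * k)" using k by (simp add: B_def field_simps)
          ultimately show "p k \<le> D ^ (j + 2) * p (x n)" using D(3)[of k "x n" "j + 1"] elim(4)
            by (simp only: of_int_le_iff) simp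
        next
          fix i assume i: "i \<in> {1..n}"
          let ?J = "{1..n} - {i}"
          have [measurable]: "X l \<in> measurable M (count_space UNIV)" if "l \<in> ?J" for l using that X_meas by auto
          have c: "real (card ?J) = real n - 1" using i by (simp add: of_nat_diff)
          have "prob {\<omega> \<in> space M. s n - T ?J \<omega> \<in> B \<and> (\<forall>l\<in>?J. X l \<omega> \<in> A)}
             \<le> prob {\<omega> \<in> space M. x n / 2 \<le> (\<Sum>l\<in>?J. real_of_int (X l \<omega>) - \<mu>) \<and> (\<forall>l\<in>?J. real_of_int (X l \<omega>) \<le> y)}"
          proof (rule finite_measure_mono)
            show "{\<omega> \<in> space M. s n - T ?J \<omega> \<in> B \<and> (\<forall>l\<in>?J. X l \<omega> \<in> A)} \<subseteq>
              {\<omega> \<in> space M. x n / 2 \<le> (\<Sum>l\<in>?J. real_of_int (X l \<omega>) - \<mu>) \<and> (\<forall>l\<in>?J. real_of_int (X l \<omega>) \<le> y)}"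
            proof
              fix \<omega> assume w: "\<omega> \<in> {\<omega> \<in> space M. s n - T ?J \<omega> \<in> B \<and> (\<forall>l\<in>?J. X l \<omega> \<in> A)}"
              then have "real_of_int (s n) - T ?J \<omega> \<le> y" by (simp add: B_def)
              moreover have "(real n - 1) * \<mu> = real n * \<mu> - \<mu>" by (simp add: algebra_simps)
              moreover have "- \<mu> \<le> real_of_int (x n) / 4 - 1"
                using order_trans[OF abs_ge_minus_self[of \<mu>], of "real_of_int (x n) / 4 - 1"] elim(3) by simp
              moreover have "real_of_int (x n) - 1 \<le> real_of_int (s n) - real n * \<mu>" using s_bounds(2)[of n] by simp
              ultimately have "x n / 2 \<le> (\<Sum>l\<in>?J. real_of_int (X l \<omega>) - \<mu>)"
                unfolding sum_centered c using y4 by linarith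
              then show "\<omega> \<in> {\<omega> \<in> space M. x n / 2 \<le> (\<Sum>l\<in>?J. real_of_int (X l \<omega>) - \<mu>) \<and> (\<forall>l\<in>?J. real_of_int (X l \<omega>) \<le> y)}"
                using w by (simp add: A_def)
            qed
          qed measurable
          also have "\<dots> \<le> exp (- real_of_int (x n) / (256 * y))"
          proof (rule y1(2))
            show "y1 \<le> y" using False elim(1) by auto
            have "R n \<le> 2 * y" using False \<open>y1 \<le> y\<close> y1(1) by linarith
            then show "real n * (V (2 * y) / (2 * y)) \<le> 4 * real_of_int (x n)" using elim(2) by blast
            show "card ?J \<le> n" using c by linarith
          qed (use xpos in auto)
          also have "- real_of_int (x n) / (256 * y) = - (2 ^ j) / 256" using xy by (simp add: field_simps)
          finally show "prob {\<omega> \<in> space M. s n - T ?J \<omega> \<in> B \<and> (\<forall>l\<in>?J. X l \<omega> \<in> A)} \<le> exp (- (2 ^ j) / 256)" .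
        qed (use D(1) p_nonneg in auto)
      qed
      then show "prob {\<omega> \<in> space M. T {1..n} \<omega> = s n \<and>
        (\<exists>i\<in>{1..n}. X i \<omega> \<in> {k. R n < k \<and> x n / 2 ^ (j + 1) < k \<and> k \<le> x n / 2 ^ j} \<and>
         (\<forall>l\<in>{1..n} - {i}. X l \<omega> \<in> {k. k \<le> x n / 2 ^ j}))}
        \<le> (D ^ (j + 2) * exp (- (2 ^ j) / 256)) * (real n * p (x n))"
        unfolding A_def B_def y_def by (simp only: mult_ac)
    qed
  qed
  then show ?thesis using D(1) by blast
qed

text \<open>The shell bounds are \<open>n p(x)\<close> times the terms of a convergent series that
  does not depend on \<open>n\<close>. Hence one fixed \<open>J\<close> makes the remainder at most
  \<open>e\<close>, and the maxima above \<open>x / 2 ^ J\<close> are left to the analysis of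
  comparable jumps.\<close>

lemma small_jumps_negligible:
  fixes e :: real and R :: "nat \<Rightarrow> real"
  assumes R: "filterlim R at_top sequentially"
    and cost: "eventually (\<lambda>n. \<forall>y\<ge>R n. real n * (V y / y) \<le> 4 * real_of_int (x n)) sequentially" and e: "0 < e"
  shows "\<exists>J. eventually (\<lambda>n. prob {\<omega> \<in> space M. T {1..n} \<omega> = s n \<and>
     (R n < partial_max X n \<omega> \<and> partial_max X n \<omega> \<le> x n / 2 ^ J)} \<le> e * (real n * p (x n))) sequentially"
proof -
  let ?E = "\<lambda>n j. {\<omega> \<in> space M. T {1..n} \<omega> = s n \<and>
      (\<exists>i\<in>{1..n}. X i \<omega> \<in> {k. R n < k \<and> x n / 2 ^ (j + 1) < k \<and> k \<le> x n / 2 ^ j} \<and>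
         (\<forall>l\<in>{1..n} - {i}. X l \<omega> \<in> {k. k \<le> x n / 2 ^ j}))}"
  obtain D where D: "D \<ge> 1" "eventually (\<lambda>n. \<forall>j\<ge>2. prob (?E n j) \<le> (D ^ (j + 2) * exp (- (2 ^ j) / 256)) * (real n * p (x n))) sequentially"
    using dyadic_jump_le[OF R cost] by blast
  define c where "c j = D ^ (j + 2) * exp (- (2 ^ j) / 256)" for j
  have c: "summable c" unfolding c_def by (rule summable_doubly_exponential[OF D(1)])
  have c0: "0 \<le> c j" for j using D(1) by (simp add: c_def)
  obtain J0 where J0: "\<And>m n. m \<ge> J0 \<Longrightarrow> norm (sum c {m..<n}) < e" using c e unfolding summable_Cauchy by blast
  define J where "J = max J0 2"
  have J: "2 \<le> J" "\<And>n. sum c {J..<n} \<le> e" using J0[of J] by (auto simp: J_def abs_less_iff intro: less_imp_le)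
  have "eventually (\<lambda>n. 1 \<le> R n) sequentially" using R by (simp add: filterlim_at_top)
  from this D(2) eventually_ge_at_top[of 1]
  have "eventually (\<lambda>n. prob {\<omega> \<in> space M. T {1..n} \<omega> = s n \<and>
     (R n < partial_max X n \<omega> \<and> partial_max X n \<omega> \<le> x n / 2 ^ J)} \<le> e * (real n * p (x n))) sequentially"
  proof eventually_elim
    case (elim n)
    have [measurable]: "X j \<in> measurable M (count_space UNIV)" if "j \<in> {1..n}" for j using that X_meas by auto
    have [measurable]: "T {1..n} \<in> measurable M (count_space UNIV)" by (rule T_meas) auto
    have E: "?E n j \<in> events" for j by measurable
    have "{\<omega> \<in> space M. T {1..n} \<omega> = s n \<and> (R n < partial_max X n \<omega> \<and> partial_max X n \<omega> \<le> x n / 2 ^ J)} \<subseteq> (\<Union>j\<in>{J..<nat (x n)}. ?E n j)"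
    proof
      fix \<omega> assume w: "\<omega> \<in> {\<omega> \<in> space M. T {1..n} \<omega> = s n \<and> (R n < partial_max X n \<omega> \<and> partial_max X n \<omega> \<le> x n / 2 ^ J)}"
      define m where "m = partial_max X n \<omega>"
      have m: "R n < m" "m \<le> x n / 2 ^ J" using w by (auto simp: m_def)
      have "0 < m" using m(1) elim(1) by linarith
      then obtain j where j: "J \<le> j" "j < nat (x n)" "x n / 2 ^ (j + 1) < m" "m \<le> x n / 2 ^ j"
        using dyadic_shell[of m "x n" J] m(2) J(1) by auto
      obtain i where i: "i \<in> {1..n}" "m = X i \<omega>" using partial_max_attained[OF elim(3)] unfolding m_def by blast
      have "real_of_int (X l \<omega>) \<le> x n / 2 ^ j" if "l \<in> {1..n}" for l
        using partial_max_ge[OF that, of \<omega>] j(4) unfolding m_def[symmetric] by linarith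
      then have "\<omega> \<in> ?E n j" using w i j m by auto
      then show "\<omega> \<in> (\<Union>j\<in>{J..<nat (x n)}. ?E n j)" using j by auto
    qed
    then have "prob {\<omega> \<in> space M. T {1..n} \<omega> = s n \<and> (R n < partial_max X n \<omega> \<and> partial_max X n \<omega> \<le> x n / 2 ^ J)}
       \<le> prob (\<Union>j\<in>{J..<nat (x n)}. ?E n j)" by (rule finite_measure_mono) (use E in auto)
    also have "\<dots> \<le> (\<Sum>j\<in>{J..<nat (x n)}. prob (?E n j))" using E by (intro finite_measure_subadditive_finite) auto
    also have "\<dots> \<le> (\<Sum>j\<in>{J..<nat (x n)}. c j * (real n * p (x n)))"
      using elim(2) J(1) unfolding c_def by (intro sum_mono) auto
    also have "\<dots> = sum c {J..<nat (x n)} * (real n * p (x n))" by (simp add: sum_distrib_right)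
    also have "\<dots> \<le> e * (real n * p (x n))" using J(2) p_nonneg by (intro mult_right_mono) auto
    finally show ?case .
  qed
  then show ?thesis by blast
qed

lemma no_jump_negligible:
  fixes e \<kappa> :: real
  assumes \<kappa>: "0 < \<kappa>" "eventually (\<lambda>n. \<kappa> * real n \<le> x n) sequentially" and e: "0 < e"
  shows "eventually (\<lambda>n. prob {\<omega> \<in> space M. T {1..n} \<omega> = s n \<and> partial_max X n \<omega> \<le> sqrt (x n)} \<le> e * (real n * p (x n))) sequentially"
    and "eventually (\<lambda>n. \<forall>y\<ge>sqrt (x n). real n * (V y / y) \<le> 4 * real_of_int (x n)) sequentially"
proof -
  have sq: "filterlim (\<lambda>n. sqrt (real_of_int (x n))) at_top sequentially"
    by (rule filterlim_compose[OF sqrt_at_top x_top])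
  \<comment> \<open>The level \<open>4 * \<kappa>\<close> matches the cost condition, since
    \<open>\<kappa> * n \<le> x\<close> gives \<open>n * (4 * \<kappa>) \<le> 4 * x\<close>.\<close>
  have "eventually (\<lambda>y. V y / y < 4 * \<kappa>) at_top" using \<kappa>(1) by (intro order_tendstoD(2)[OF V_over_tendsto]) auto
  then obtain Y where Y: "\<And>y. Y \<le> y \<Longrightarrow> V y / y < 4 * \<kappa>" by (auto simp: eventually_at_top_linorder)
  have "eventually (\<lambda>n. Y \<le> sqrt (x n)) sequentially" using sq by (simp add: filterlim_at_top)
  from this \<kappa>(2) show cost: "eventually (\<lambda>n. \<forall>y\<ge>sqrt (x n). real n * (V y / y) \<le> 4 * real_of_int (x n)) sequentially"
  proof eventually_elim
    case (elim n)
    show ?case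
    proof (intro allI impI)
      fix y assume "sqrt (x n) \<le> y"
      then have "real n * (V y / y) \<le> real n * (4 * \<kappa>)" using elim(1) Y[of y] by (intro mult_left_mono) auto
      also have "\<dots> = 4 * (\<kappa> * real n)" by simp
      finally show "real n * (V y / y) \<le> 4 * real_of_int (x n)" using elim(2) by linarith
    qed
  qed
  obtain y1 where y1: "y1 > 0" "\<And>y n J x z. y1 \<le> y \<Longrightarrow> finite J \<Longrightarrow> J \<subseteq> {1..} \<Longrightarrow> card J \<le> n \<Longrightarrow>
     real n * (V (2 * y) / (2 * y)) \<le> 4 * x \<Longrightarrow> 0 \<le> x \<Longrightarrow> x / 2 \<le> z \<Longrightarrow>
     prob {\<omega> \<in> space M. z \<le> (\<Sum>j\<in>J. real_of_int (X j \<omega>) - \<mu>) \<and> (\<forall>j\<in>J. real_of_int (X j \<omega>) \<le> y)} \<le> exp (- x / (256 * y))"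
    by (rule truncated_sum_tail, rule that)
  obtain c i N where c: "c > 0" "\<And>x::int. N \<le> x \<Longrightarrow> c / real_of_int x ^ i \<le> p x" using p_lower_bound by metis
  have "((\<lambda>u::real. exp (- sqrt u / 256) * u ^ i) \<longlongrightarrow> 0) at_top" by real_asymp
  then have "eventually (\<lambda>u::real. exp (- sqrt u / 256) * u ^ i < e * c) at_top" using e c by (intro order_tendstoD(2)) auto
  then have "eventually (\<lambda>n. exp (- sqrt (x n) / 256) * real_of_int (x n) ^ i < e * c) sequentially"
    by (rule eventually_compose_filterlim[OF _ x_top])
  moreover have "eventually (\<lambda>n. y1 \<le> sqrt (x n)) sequentially" using sq by (simp add: filterlim_at_top)
  ultimately show "eventually (\<lambda>n. prob {\<omega> \<in> space M. T {1..n} \<omega> = s n \<and> partial_max X n \<omega> \<le> sqrt (x n)} \<le> e * (real n * p (x n))) sequentially"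
    using cost eventually_x_int[of N] eventually_x[of 2] eventually_ge_at_top[of 1]
  proof eventually_elim
    case (elim n)
    have [measurable]: "X j \<in> measurable M (count_space UNIV)" if "j \<in> {1..n}" for j using that X_meas by auto
    have "prob {\<omega> \<in> space M. T {1..n} \<omega> = s n \<and> partial_max X n \<omega> \<le> sqrt (x n)}
      \<le> prob {\<omega> \<in> space M. x n / 2 \<le> (\<Sum>l\<in>{1..n}. real_of_int (X l \<omega>) - \<mu>) \<and> (\<forall>l\<in>{1..n}. real_of_int (X l \<omega>) \<le> sqrt (x n))}"
    proof (rule finite_measure_mono)
      show "{\<omega> \<in> space M. T {1..n} \<omega> = s n \<and> partial_max X n \<omega> \<le> sqrt (x n)}
        \<subseteq> {\<omega> \<in> space M. x n / 2 \<le> (\<Sum>l\<in>{1..n}. real_of_int (X l \<omega>) - \<mu>) \<and> (\<forall>l\<in>{1..n}. real_of_int (X l \<omega>) \<le> sqrt (x n))}"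
      proof
        fix \<omega> assume w: "\<omega> \<in> {\<omega> \<in> space M. T {1..n} \<omega> = s n \<and> partial_max X n \<omega> \<le> sqrt (x n)}"
        then have "x n / 2 \<le> (\<Sum>l\<in>{1..n}. real_of_int (X l \<omega>) - \<mu>)"
          unfolding sum_centered using s_bounds(2)[of n] elim(5) by simp
        moreover have "real_of_int (X l \<omega>) \<le> sqrt (x n)" if "l \<in> {1..n}" for l
          using partial_max_ge[OF that, of \<omega>] w by (simp; linarith)
        ultimately show "\<omega> \<in> {\<omega> \<in> space M. x n / 2 \<le> (\<Sum>l\<in>{1..n}. real_of_int (X l \<omega>) - \<mu>) \<and> (\<forall>l\<in>{1..n}. real_of_int (X l \<omega>) \<le> sqrt (x n))}"
          using w by simp
      qed
    qed measurable
    also have "\<dots> \<le> exp (- real_of_int (x n) / (256 * sqrt (x n)))"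
    proof (rule y1(2))
      show "real n * (V (2 * sqrt (x n)) / (2 * sqrt (x n))) \<le> 4 * real_of_int (x n)" using elim(3,5) by simp
    qed (use elim(2,5) in auto)
    also have "- real_of_int (x n) / (256 * sqrt (x n)) = - sqrt (x n) / 256" using elim(5) real_div_sqrt[of "x n"] by (simp add: field_simps)
    also have "exp (- sqrt (x n) / 256) \<le> e * (c / real_of_int (x n) ^ i)" using elim(1,5) by (simp add: field_simps)
    also have "\<dots> \<le> e * p (x n)" using c(2)[OF elim(4)] e by (intro mult_left_mono) auto
    also have "\<dots> \<le> e * (real n * p (x n))"
      using elim(6) e p_nonneg[of "x n"] mult_right_mono[of 1 "real n" "p (x n)"] by (intro mult_left_mono) auto
    finally show ?case .
  qed
qed

text \<open>For \<open>\<epsilon> < 1\<close> the event itself forces a jump of size at least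
  \<open>(1 - \<epsilon>) * x\<close>, so no exceptional event is required. For
  \<open>\<epsilon> \<ge> 1\<close> it would also admit maxima far smaller than
  \<open>x\<close>.\<close>

lemma near_max_asymp:
  fixes \<epsilon> :: real
  assumes "0 < \<epsilon>" "\<epsilon> < 1"
  shows "(\<lambda>n. prob {\<omega> \<in> space M. T {1..n} \<omega> = s n \<and> \<bar>real_of_int (partial_max X n \<omega> - x n)\<bar> \<le> \<epsilon> * x n} / (real n * p (x n))) \<longlonglongrightarrow> 1"
proof (rule one_big_jump[OF assms(1)])
  show "eventually (\<lambda>n. {\<omega> \<in> space M. T {1..n} \<omega> = s n \<and> \<bar>real_of_int (partial_max X n \<omega> - x n)\<bar> \<le> \<epsilon> * x n} \<in> events) sequentially"
    using eventually_ge_at_top[of 1] by eventually_elim (rule T_events(3))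
  fix e :: real assume e: "0 < e"
  show "\<exists>\<eta>>0::real. eventually (\<lambda>n. \<exists>R\<in>events. prob R \<le> e * (real n * p (x n)) \<and>
      {\<omega> \<in> space M. T {1..n} \<omega> = s n \<and> \<bar>real_of_int (partial_max X n \<omega> - x n)\<bar> \<le> \<epsilon> * x n} \<subseteq>
      {\<omega> \<in> space M. T {1..n} \<omega> = s n \<and> (\<exists>i\<in>{1..n}. \<eta> * x n \<le> X i \<omega>)} \<union> R) sequentially"
  proof (intro exI[of _ "1 - \<epsilon>"] conjI)
    show "eventually (\<lambda>n. \<exists>R\<in>events. prob R \<le> e * (real n * p (x n)) \<and>
      {\<omega> \<in> space M. T {1..n} \<omega> = s n \<and> \<bar>real_of_int (partial_max X n \<omega> - x n)\<bar> \<le> \<epsilon> * x n} \<subseteq>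
      {\<omega> \<in> space M. T {1..n} \<omega> = s n \<and> (\<exists>i\<in>{1..n}. (1 - \<epsilon>) * x n \<le> X i \<omega>)} \<union> R) sequentially"
      using eventually_ge_at_top[of 1]
    proof eventually_elim
      case (elim n)
      show ?case
      proof (intro bexI[of _ "{}"] conjI subsetI UnI1)
        fix \<omega> assume w: "\<omega> \<in> {\<omega> \<in> space M. T {1..n} \<omega> = s n \<and> \<bar>real_of_int (partial_max X n \<omega> - x n)\<bar> \<le> \<epsilon> * x n}"
        obtain i where i: "i \<in> {1..n}" "partial_max X n \<omega> = X i \<omega>" using partial_max_attained[OF elim] by blast
        have "(1 - \<epsilon>) * x n \<le> X i \<omega>" using w i(2) by (simp add: algebra_simps abs_le_iff)
        then show "\<omega> \<in> {\<omega> \<in> space M. T {1..n} \<omega> = s n \<and> (\<exists>i\<in>{1..n}. (1 - \<epsilon>) * x n \<le> X i \<omega>)}"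
          using w i(1) by auto
      qed (use e p_nonneg in auto)
    qed
  qed (use assms in auto)
qed auto

text \<open>Stated for a general threshold so that it serves both \<open>r_n\<close> and
  \<open>sqrt x\<close>. The condition \<open>Rx\<close> places a maximum within \<open>x/2\<close>
  of \<open>x\<close> above the threshold.\<close>

lemma max_above_asymp:
  fixes R :: "nat \<Rightarrow> real"
  assumes R: "filterlim R at_top sequentially"
    and cost: "eventually (\<lambda>n. \<forall>y\<ge>R n. real n * (V y / y) \<le> 4 * real_of_int (x n)) sequentially"
    and Rx: "eventually (\<lambda>n. R n < 1/2 * x n) sequentially"
  shows "(\<lambda>n. prob {\<omega> \<in> space M. T {1..n} \<omega> = s n \<and> R n < partial_max X n \<omega>} / (real n * p (x n))) \<longlonglongrightarrow> 1"
proof (rule one_big_jump[of "1/2"])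
  show "eventually (\<lambda>n. {\<omega> \<in> space M. T {1..n} \<omega> = s n \<and> \<bar>real_of_int (partial_max X n \<omega> - x n)\<bar> \<le> 1/2 * x n} \<subseteq>
     {\<omega> \<in> space M. T {1..n} \<omega> = s n \<and> R n < partial_max X n \<omega>}) sequentially"
    using Rx
  proof eventually_elim
    case (elim n)
    show ?case
    proof
      fix \<omega> assume w: "\<omega> \<in> {\<omega> \<in> space M. T {1..n} \<omega> = s n \<and> \<bar>real_of_int (partial_max X n \<omega> - x n)\<bar> \<le> 1/2 * x n}"
      then have "- real_of_int (partial_max X n \<omega> - x n) \<le> 1/2 * x n" using abs_le_D2 by blast
      then have "R n < partial_max X n \<omega>" using elim by simp
      then show "\<omega> \<in> {\<omega> \<in> space M. T {1..n} \<omega> = s n \<and> R n < partial_max X n \<omega>}" using w by simp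
    qed
  qed
  show "eventually (\<lambda>n. {\<omega> \<in> space M. T {1..n} \<omega> = s n \<and> R n < partial_max X n \<omega>} \<in> events) sequentially"
    using eventually_ge_at_top[of 1] by eventually_elim (rule T_events(3))
  fix e :: real assume e: "0 < e"
  obtain J where J: "eventually (\<lambda>n. prob {\<omega> \<in> space M. T {1..n} \<omega> = s n \<and>
     (R n < partial_max X n \<omega> \<and> partial_max X n \<omega> \<le> x n / 2 ^ J)} \<le> e * (real n * p (x n))) sequentially"
    using small_jumps_negligible[OF R cost e] by (elim exE)
  show "\<exists>\<eta>>0::real. eventually (\<lambda>n. \<exists>R'\<in>events. prob R' \<le> e * (real n * p (x n)) \<and>
      {\<omega> \<in> space M. T {1..n} \<omega> = s n \<and> R n < partial_max X n \<omega>} \<subseteq>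
      {\<omega> \<in> space M. T {1..n} \<omega> = s n \<and> (\<exists>i\<in>{1..n}. \<eta> * x n \<le> X i \<omega>)} \<union> R') sequentially"
  proof (intro exI[of _ "1 / 2 ^ J"] conjI)
    show "eventually (\<lambda>n. \<exists>R'\<in>events. prob R' \<le> e * (real n * p (x n)) \<and>
      {\<omega> \<in> space M. T {1..n} \<omega> = s n \<and> R n < partial_max X n \<omega>} \<subseteq>
      {\<omega> \<in> space M. T {1..n} \<omega> = s n \<and> (\<exists>i\<in>{1..n}. 1 / 2 ^ J * x n \<le> X i \<omega>)} \<union> R') sequentially"
      using J eventually_ge_at_top[of 1]
    proof eventually_elim
      case (elim n)
      let ?R = "{\<omega> \<in> space M. T {1..n} \<omega> = s n \<and> (R n < partial_max X n \<omega> \<and> partial_max X n \<omega> \<le> x n / 2 ^ J)}"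
      show ?case
      proof (intro bexI[of _ ?R] conjI subsetI elim(1))
        show "?R \<in> events" by (rule T_events(3)[OF elim(2)])
        fix \<omega> assume w: "\<omega> \<in> {\<omega> \<in> space M. T {1..n} \<omega> = s n \<and> R n < partial_max X n \<omega>}"
        obtain i where i: "i \<in> {1..n}" "partial_max X n \<omega> = X i \<omega>" using partial_max_attained[OF elim(2)] by blast
        show "\<omega> \<in> {\<omega> \<in> space M. T {1..n} \<omega> = s n \<and> (\<exists>i\<in>{1..n}. 1 / 2 ^ J * x n \<le> X i \<omega>)} \<union> ?R"
        proof (cases "partial_max X n \<omega> \<le> x n / 2 ^ J")
          case True then show ?thesis using w by simp
        next
          case False
          then have "1 / 2 ^ J * x n \<le> X i \<omega>" using i(2) by simp
          then have "\<exists>i\<in>{1..n}. 1 / 2 ^ J * x n \<le> X i \<omega>" using i(1) by (rule bexI)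
          then show ?thesis using w by simp
        qed
      qed
    qed
  qed auto
qed auto

text \<open>The part with maximum below \<open>sqrt x\<close> is negligible here, so the full event
  has the asymptotics of its large-jump part. Any \<open>\<epsilon> > 0\<close> is allowed: the
  event for \<open>\<epsilon>\<close> lies between the one for \<open>min \<epsilon> (1/2)\<close>
  and the full event, which are equivalent.\<close>

lemma linear_regime_asymp:
  fixes \<epsilon> \<kappa> :: real
  assumes \<kappa>: "0 < \<kappa>" "eventually (\<lambda>n. \<kappa> * real n \<le> x n) sequentially" and \<epsilon>: "0 < \<epsilon>"
  shows "(\<lambda>n. prob {\<omega> \<in> space M. T {1..n} \<omega> = s n} / (real n * p (x n))) \<longlonglongrightarrow> 1"
    and "(\<lambda>n. prob {\<omega> \<in> space M. T {1..n} \<omega> = s n \<and> \<bar>real_of_int (partial_max X n \<omega> - x n)\<bar> \<le> \<epsilon> * x n} / (real n * p (x n))) \<longlonglongrightarrow> 1"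
proof -
  let ?R = "\<lambda>n. sqrt (real_of_int (x n))"
  let ?lo = "\<lambda>n. prob {\<omega> \<in> space M. T {1..n} \<omega> = s n \<and> partial_max X n \<omega> \<le> ?R n}"
  let ?hi = "\<lambda>n. prob {\<omega> \<in> space M. T {1..n} \<omega> = s n \<and> ?R n < partial_max X n \<omega>}"
  let ?g = "\<lambda>n. real n * p (x n)"
  have R: "filterlim ?R at_top sequentially" by (rule filterlim_compose[OF sqrt_at_top x_top])
  have "eventually (\<lambda>n. ?R n < 1/2 * x n) sequentially"
  proof -
    have "eventually (\<lambda>u::real. sqrt u < 1/2 * u) at_top" by real_asymp
    then show ?thesis by (rule eventually_compose_filterlim[OF _ x_top])
  qed
  from max_above_asymp[OF R no_jump_negligible(2)[OF \<kappa> zero_less_one] this]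
  have hi: "(\<lambda>n. ?hi n / ?g n) \<longlonglongrightarrow> 1" .
  have g: "eventually (\<lambda>n. 0 < ?g n) sequentially"
    using p_eventually_pos eventually_ge_at_top[of 1] by eventually_elim simp
  have lo: "(\<lambda>n. ?lo n / ?g n) \<longlonglongrightarrow> 0"
  proof (rule tendstoI)
    fix e :: real assume e: "0 < e"
    have "eventually (\<lambda>n. ?lo n \<le> e / 2 * ?g n) sequentially" using e by (intro no_jump_negligible(1)[OF \<kappa>]) auto
    then show "eventually (\<lambda>n. dist (?lo n / ?g n) 0 < e) sequentially" using g
    proof eventually_elim
      case (elim n)
      have "?lo n / ?g n \<le> e / 2" using elim by (simp add: pos_divide_le_eq)
      moreover have "0 \<le> ?lo n / ?g n" using elim(2) by (intro divide_nonneg_pos) auto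
      moreover have "dist u 0 < e" if "u \<le> e / 2" "0 \<le> u" for u :: real using that e by (simp add: dist_real_def)
      ultimately show ?case by blast
    qed
  qed
  have "eventually (\<lambda>n. ?lo n / ?g n + ?hi n / ?g n = prob {\<omega> \<in> space M. T {1..n} \<omega> = s n} / ?g n) sequentially"
    using eventually_ge_at_top[of 1]
  proof eventually_elim
    case (elim n)
    have "{\<omega> \<in> space M. T {1..n} \<omega> = s n} = {\<omega> \<in> space M. T {1..n} \<omega> = s n \<and> partial_max X n \<omega> \<le> ?R n} \<union> {\<omega> \<in> space M. T {1..n} \<omega> = s n \<and> ?R n < partial_max X n \<omega>}"
      by auto
    then have "prob {\<omega> \<in> space M. T {1..n} \<omega> = s n} = ?lo n + ?hi n"
      using T_events(3)[OF elim] by (simp only:) (rule finite_measure_Union, auto)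
    then show ?case by (simp add: add_divide_distrib)
  qed
  then show total: "(\<lambda>n. prob {\<omega> \<in> space M. T {1..n} \<omega> = s n} / ?g n) \<longlonglongrightarrow> 1"
    using tendsto_add[OF lo hi] by (auto elim: Lim_transform_eventually)
  let ?near = "\<lambda>h::real. \<lambda>n. {\<omega> \<in> space M. T {1..n} \<omega> = s n \<and> \<bar>real_of_int (partial_max X n \<omega> - x n)\<bar> \<le> h * x n}"
  define h where "h = min \<epsilon> (1/2)"
  have h: "0 < h" "h < 1" "h \<le> \<epsilon>" using \<epsilon> by (auto simp: h_def)
  show "(\<lambda>n. prob (?near \<epsilon> n) / ?g n) \<longlonglongrightarrow> 1"
  proof (rule tendsto_sandwich[OF _ _ near_max_asymp[OF h(1,2)] total])
    show "eventually (\<lambda>n. prob (?near h n) / ?g n \<le> prob (?near \<epsilon> n) / ?g n) sequentially"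
      using g eventually_x[of 0] eventually_ge_at_top[of 1]
    proof eventually_elim
      case (elim n)
      have "h * x n \<le> \<epsilon> * x n" using h(3) elim(2) by (rule mult_right_mono)
      then have "?near h n \<subseteq> ?near \<epsilon> n" by auto
      then show ?case using elim(1) by (intro divide_right_mono finite_measure_mono T_events(3)[OF elim(3)]) auto
    qed
    show "eventually (\<lambda>n. prob (?near \<epsilon> n) / ?g n \<le> prob {\<omega> \<in> space M. T {1..n} \<omega> = s n} / ?g n) sequentially"
      using g by eventually_elim (intro divide_right_mono finite_measure_mono T_events(2), auto)
  qed
qed

end

section \<open>The normalising sequence, linear growth and the threshold\<close>

context iid_regular
begin

text \<open>If \<open>a n\<close> stayed below \<open>K'\<close>, a nonzero \<open>V (a n)\<close>
  would be at least a fixed \<open>c > 0\<close>, and \<open>V (a n) / (a n)\<^sup>2\<close> could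
  not fall below \<open>c / K'\<^sup>2\<close>, although it tends to \<open>0\<close>.\<close>

lemma normalising_at_top:
  fixes a :: "nat \<Rightarrow> real"
  assumes a: "(\<lambda>n. V (a n) / (a n)\<^sup>2) \<sim>[sequentially] (\<lambda>n. 1 / real n)"
  shows "filterlim a at_top sequentially"
  unfolding filterlim_at_top
proof
  fix K :: real
  define K' where "K' = max K 1"
  obtain c where c: "c > 0" "\<And>y. y \<le> K' \<Longrightarrow> V y \<noteq> 0 \<Longrightarrow> c \<le> V y" using V_bounded_below[of K'] by auto
  have 1: "(\<lambda>n. V (a n) / (a n)\<^sup>2) \<longlonglongrightarrow> 0"
    using asymp_equiv_tendsto_transfer[OF asymp_equiv_symI[OF a] lim_1_over_n] .
  have "eventually (\<lambda>n. V (a n) / (a n)\<^sup>2 < c / K'\<^sup>2) sequentially"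
    using c(1) by (intro order_tendstoD(2)[OF 1]) (auto simp: K'_def)
  \<comment> \<open>Asymptotically equivalent sequences eventually have the same zeros; this rules
    out \<open>V (a n) = 0\<close> and also \<open>a n = 0\<close>, where the quotient has the
    default value \<open>0\<close>.\<close>
  moreover have "eventually (\<lambda>n. (V (a n) / (a n)\<^sup>2 = 0) = (1 / real n = 0)) sequentially"
    using asymp_equiv_eventually_zeros[OF a] by (auto elim: eventually_mono)
  ultimately show "eventually (\<lambda>n. K \<le> a n) sequentially" using eventually_gt_at_top[of 0]
  proof eventually_elim
    case (elim n)
    then have nz: "V (a n) \<noteq> 0" "a n \<noteq> 0" by auto
    then have pos: "a n > 0" using V_neg[of "a n"] by force
    show ?case
    proof (rule ccontr)
      assume "\<not> K \<le> a n"
      then have le: "a n \<le> K'" by (simp add: K'_def)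
      have "c / K'\<^sup>2 \<le> V (a n) / (a n)\<^sup>2"
        using c(1) c(2)[OF le nz(1)] le pos by (intro frac_le power_mono) auto
      then show False using elim(1) by simp
    qed
  qed
qed

lemma threshold_at_top:
  fixes r :: "real \<Rightarrow> real"
  assumes r: "(\<lambda>t. r t / V (r t)) \<sim>[at_top] (\<lambda>t. t)"
  shows "filterlim r at_top at_top"
  unfolding filterlim_at_top
proof
  fix K :: real
  obtain c where c: "c > 0" "\<And>y. y \<le> K \<Longrightarrow> V y \<noteq> 0 \<Longrightarrow> c \<le> V y" using V_bounded_below[of K] by auto
  have "filterlim (\<lambda>t. r t / V (r t)) at_top at_top"
    using asymp_equiv_at_top_transfer[OF asymp_equiv_symI[OF r] filterlim_ident] .
  \<comment> \<open>The \<open>1\<close> excludes \<open>V (r t) = 0\<close>, where the quotient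
    would be \<open>0\<close> by convention; the other bound exceeds what the quotient can be when
    \<open>r t \<le> K\<close> and \<open>V (r t) \<ge> c\<close>.\<close>
  then have "eventually (\<lambda>t. max 1 (\<bar>K\<bar> / c + 1) \<le> r t / V (r t)) at_top" unfolding filterlim_at_top by blast
  then show "eventually (\<lambda>t. K \<le> r t) at_top"
  proof eventually_elim
    case (elim t)
    then have nz: "V (r t) \<noteq> 0" by auto
    show ?case
    proof (rule ccontr)
      assume *: "\<not> K \<le> r t"
      have pos: "r t \<ge> 0" using V_neg[of "r t"] nz by force
      have cV: "c \<le> V (r t)" using c(2)[of "r t"] * nz by simp
      have "r t / V (r t) \<le> \<bar>K\<bar> / c" using * pos cV c(1) by (intro frac_le) auto
      then show False using elim by simp
    qed
  qed
qed

text \<open>As \<open>V(y)/y\<close> is almost decreasing and \<open>a \<le> x\<close> eventually,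
  \<open>n V(x) / x^2\<close> is at most \<open>2 * (n V(a) / a^2) * (a / x)\<close>; the middle
  factor tends to \<open>1\<close> and the last to \<open>0\<close>.\<close>

lemma large_deviation_of_normalising:
  fixes a :: "nat \<Rightarrow> real" and x :: "nat \<Rightarrow> int"
  assumes a: "(\<lambda>n. V (a n) / (a n)\<^sup>2) \<sim>[sequentially] (\<lambda>n. 1 / real n)"
    and xa: "filterlim (\<lambda>n. real_of_int (x n) / a n) at_top sequentially"
  shows "large_deviation M \<xi> X x"
proof
  have a_top: "filterlim a at_top sequentially" by (rule normalising_at_top[OF a])
  have "filterlim (\<lambda>n. real_of_int (x n) / a n * a n) at_top sequentially"
    by (rule filterlim_at_top_mult_at_top[OF xa a_top])
  moreover have apos: "eventually (\<lambda>n. 0 < a n) sequentially" using a_top by (simp add: filterlim_at_top_dense)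
  then have "eventually (\<lambda>n. real_of_int (x n) / a n * a n = real_of_int (x n)) sequentially"
    by eventually_elim simp
  ultimately show x_top: "filterlim (\<lambda>n. real_of_int (x n)) at_top sequentially"
    by (rule filterlim_cong[THEN iffD1, OF refl refl, rotated])
  obtain y0 where y0: "y0 > 0" "\<And>y y'. y0 \<le> y \<Longrightarrow> y \<le> y' \<Longrightarrow> V y' / y' \<le> 2 * (V y / y)"
    by (rule V_halving, rule that)
  have r1: "(\<lambda>n. V (a n) / (a n)\<^sup>2 / (1 / real n)) \<longlonglongrightarrow> 1"
    by (rule asymp_equivD_strong[OF a]) (rule eventually_mono[OF eventually_gt_at_top[of 0]], simp)
  have r2: "(\<lambda>n. 1 / (real_of_int (x n) / a n)) \<longlonglongrightarrow> 0"
    by (rule tendsto_divide_0[OF tendsto_const filterlim_at_top_imp_at_infinity[OF xa]])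
  show "(\<lambda>n. real n * V (x n) / (real_of_int (x n))\<^sup>2) \<longlonglongrightarrow> 0"
  proof (rule tendsto_sandwich[OF _ _ tendsto_const])
    show "(\<lambda>n. 2 * (V (a n) / (a n)\<^sup>2 / (1 / real n)) * (1 / (real_of_int (x n) / a n))) \<longlonglongrightarrow> 0"
      using tendsto_mult[OF tendsto_mult[OF tendsto_const[of 2] r1] r2] by simp
    show "eventually (\<lambda>n. 0 \<le> real n * V (x n) / (real_of_int (x n))\<^sup>2) sequentially"
      using V_nonneg by (intro always_eventually) auto
    have "eventually (\<lambda>n. y0 \<le> a n) sequentially" "eventually (\<lambda>n. 1 \<le> real_of_int (x n) / a n) sequentially"
      using a_top xa unfolding filterlim_at_top by blast+
    then show "eventually (\<lambda>n. real n * V (x n) / (real_of_int (x n))\<^sup>2 \<le> 2 * (V (a n) / (a n)\<^sup>2 / (1 / real n)) * (1 / (real_of_int (x n) / a n))) sequentially"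
    proof eventually_elim
      case (elim n)
      have ap: "a n > 0" using elim(1) y0(1) by linarith
      have ax: "a n \<le> x n" using elim(2) ap by (simp add: field_simps)
      have "real n * V (x n) / (real_of_int (x n))\<^sup>2 = real n / x n * (V (x n) / x n)" by (simp add: power2_eq_square)
      also have "\<dots> \<le> real n / x n * (2 * (V (a n) / a n))"
        using y0(2)[OF elim(1) ax] ap ax by (intro mult_left_mono) auto
      also have "\<dots> = 2 * (V (a n) / (a n)\<^sup>2 / (1 / real n)) * (1 / (real_of_int (x n) / a n))"
        using ap by (simp add: power2_eq_square field_simps)
      finally show ?case .
    qed
  qed
qed

text \<open>\<open>n / x\<close> stays bounded by \<open>1 / \<kappa>\<close>, while
  \<open>V(x) / x\<close> tends to \<open>0\<close> by integrability.\<close>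

lemma large_deviation_of_linear:
  fixes x :: "nat \<Rightarrow> int"
  assumes \<kappa>: "0 < \<kappa>" "eventually (\<lambda>n. \<kappa> * real n \<le> x n) sequentially"
  shows "large_deviation M \<xi> X x"
proof
  have "filterlim (\<lambda>n. \<kappa> * real n) at_top sequentially"
    by (rule filterlim_tendsto_pos_mult_at_top[OF tendsto_const \<kappa>(1) filterlim_real_sequentially])
  then show x_top: "filterlim (\<lambda>n. real_of_int (x n)) at_top sequentially" by (rule filterlim_at_top_mono[OF _ \<kappa>(2)])
  show "(\<lambda>n. real n * V (x n) / (real_of_int (x n))\<^sup>2) \<longlonglongrightarrow> 0"
  proof (rule tendsto_sandwich[OF _ _ tendsto_const])
    show "(\<lambda>n. 1 / \<kappa> * (V (x n) / x n)) \<longlonglongrightarrow> 0"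
      using tendsto_mult[OF tendsto_const[of "1/\<kappa>"] filterlim_compose[OF V_over_tendsto x_top]] by simp
    show "eventually (\<lambda>n. 0 \<le> real n * V (x n) / (real_of_int (x n))\<^sup>2) sequentially"
      using V_nonneg by (intro always_eventually) auto
    show "eventually (\<lambda>n. real n * V (x n) / (real_of_int (x n))\<^sup>2 \<le> 1 / \<kappa> * (V (x n) / x n)) sequentially"
      using \<kappa>(2) eventually_gt_at_top[of 0]
    proof eventually_elim
      case (elim n)
      have "0 < \<kappa> * real n" using \<kappa>(1) elim(2) by simp
      then have xp: "0 < real_of_int (x n)" using elim(1) by linarith
      have "real n / x n \<le> 1 / \<kappa>" using elim(1) xp \<kappa>(1) by (simp add: field_simps)
      then have "real n / x n * (V (x n) / x n) \<le> 1 / \<kappa> * (V (x n) / x n)"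
        using xp V_nonneg[of "x n"] by (intro mult_right_mono) auto
      then show ?case by (simp add: power2_eq_square)
    qed
  qed
qed

end

context large_deviation
begin

text \<open>By its definition \<open>r_n\<close> makes \<open>n V(r_n) / r_n\<close> asymptotic to
  \<open>x\<close>, hence between \<open>x/2\<close> and \<open>2 * x\<close>. The upper bound
  yields the cost condition at all larger levels; the lower bound forces \<open>r_n\<close> below
  \<open>x/2\<close>.\<close>

lemma threshold_asymp:
  fixes r :: "real \<Rightarrow> real"
  assumes r: "(\<lambda>t. r t / V (r t)) \<sim>[at_top] (\<lambda>t. t)" and xn: "(\<lambda>n. real_of_int (x n) / real n) \<longlonglongrightarrow> 0"
  shows "(\<lambda>n. prob {\<omega> \<in> space M. T {1..n} \<omega> = s n \<and> r (real n / x n) < partial_max X n \<omega>} / (real n * p (x n))) \<longlonglongrightarrow> 1"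
proof -
  define R where "R n = r (real n / x n)" for n
  have xpos: "eventually (\<lambda>n. 0 < real_of_int (x n) \<and> 0 < n) sequentially"
    using eventually_x[of 1] eventually_gt_at_top[of 0] by eventually_elim auto
  have t: "filterlim (\<lambda>n. real n / x n) at_top sequentially"
  proof -
    have "filterlim (\<lambda>n. inverse (real_of_int (x n) / real n)) at_top sequentially"
      by (rule filterlim_inverse_at_top[OF xn]) (use xpos in \<open>auto elim: eventually_mono\<close>)
    then show ?thesis by simp
  qed
  have R: "filterlim R at_top sequentially" unfolding R_def by (rule filterlim_compose[OF threshold_at_top[OF r] t])
  obtain y0 where y0: "y0 > 0" "\<And>y y'. y0 \<le> y \<Longrightarrow> y \<le> y' \<Longrightarrow> V y' / y' \<le> 2 * (V y / y)" "\<And>y. y0 \<le> y \<Longrightarrow> 0 < V y"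
    by (rule V_halving, rule that)
  have "((\<lambda>t. r t / V (r t) / t) \<longlongrightarrow> 1) at_top"
    by (rule asymp_equivD_strong[OF r]) (rule eventually_mono[OF eventually_gt_at_top[of 0]], simp)
  from filterlim_compose[OF this t] have lim: "(\<lambda>n. R n / V (R n) / (real n / x n)) \<longlonglongrightarrow> 1" by (simp add: R_def)
  have Ry0: "eventually (\<lambda>n. y0 \<le> R n) sequentially" using R unfolding filterlim_at_top by blast
  have "eventually (\<lambda>n. R n / V (R n) / (real n / x n) > 1/2 \<and> R n / V (R n) / (real n / x n) < 2) sequentially"
    using order_tendstoD[OF lim, of "1/2"] order_tendstoD[OF lim, of 2] by (auto intro: eventually_conj)
  with Ry0 xpos have key: "eventually (\<lambda>n. y0 \<le> R n \<and> 0 < real_of_int (x n) \<and>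
      real n * (V (R n) / R n) \<le> 2 * x n \<and> x n / 2 \<le> real n * (V (R n) / R n)) sequentially"
  proof eventually_elim
    case (elim n)
    have pos: "R n > 0" "V (R n) > 0" using elim(1) y0(1) y0(3)[of "R n"] by auto
    then show ?case using elim by (auto simp: field_simps)
  qed
  have cost: "eventually (\<lambda>n. \<forall>y\<ge>R n. real n * (V y / y) \<le> 4 * real_of_int (x n)) sequentially"
    using key
  proof eventually_elim
    case (elim n)
    show ?case
    proof (intro allI impI)
      fix y assume "R n \<le> y"
      then have "real n * (V y / y) \<le> real n * (2 * (V (R n) / R n))"
        using y0(2)[of "R n" y] elim by (intro mult_left_mono) auto
      also have "\<dots> = 2 * (real n * (V (R n) / R n))" by simp
      finally show "real n * (V y / y) \<le> 4 * real_of_int (x n)" using elim by linarith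
    qed
  qed
  \<comment> \<open>If \<open>R n \<ge> x/2\<close>, then
    \<open>x/2 \<le> n V(R) / R \<le> 4 * n V(x) / x\<close>, that is
    \<open>n V(x) / x^2 \<ge> 1/8\<close>; the bound \<open>1/8\<close> is chosen to contradict
    this.\<close>
  have "eventually (\<lambda>n. real n * V (x n) / (real_of_int (x n))\<^sup>2 < 1/8) sequentially"
    by (rule order_tendstoD(2)[OF x_large]) simp
  with key eventually_x[of "2 * y0"] have Rx: "eventually (\<lambda>n. R n < 1/2 * x n) sequentially"
  proof eventually_elim
    case (elim n)
    define u where "u = real_of_int (x n)"
    have u: "u > 0" "y0 \<le> 1/2 * u" using elim by (auto simp: u_def)
    show ?case
    proof (rule ccontr)
      assume "\<not> R n < 1/2 * x n"
      then have "1/2 * u \<le> R n" by (simp add: u_def)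
      then have "V (R n) / R n \<le> 2 * (V (1/2 * u) / (1/2 * u))" by (rule y0(2)[OF u(2)])
      also have "\<dots> = 4 * V (1/2 * u) / u" by simp
      also have "\<dots> \<le> 4 * V u / u" using u monoD[OF V_mono, of "1/2 * u" u] by (intro divide_right_mono) auto
      finally have "real n * (V (R n) / R n) \<le> real n * (4 * V u / u)" by (intro mult_left_mono) auto
      moreover have "u / 2 \<le> real n * (V (R n) / R n)" using elim(1) unfolding u_def by blast
      ultimately have "u / 2 \<le> real n * (4 * V u / u)" by linarith
      then have "1/8 \<le> real n * V u / u\<^sup>2" using u by (simp add: field_simps power2_eq_square)
      then show False using elim(3) by (simp add: u_def)
    qed
  qed
  show ?thesis using max_above_asymp[OF R cost Rx] by (simp add: R_def)
qed

end

theorem proposition2p16: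
  fixes M :: "'a measure"
    and \<xi> :: "'a \<Rightarrow> int"
    and X :: "nat \<Rightarrow> 'a \<Rightarrow> int"
    and a :: "nat \<Rightarrow> real"
    and r :: "real \<Rightarrow> real"
    and x :: "nat \<Rightarrow> int"
  defines "b \<equiv> (\<lambda>n. real n * mean M \<xi>)"
    and "S \<equiv> partial_sum X"
    and "Mx \<equiv> partial_max X"
    and "rr \<equiv> (\<lambda>n. r (real n / real_of_int (x n)))"
  assumes "prob_space M"
    and "\<xi> \<in> measurable M (count_space UNIV)"
    and "prob_space.indep_vars M (\<lambda>_. count_space UNIV) X {1..}"
    and "\<And>i. i \<ge> 1 \<Longrightarrow> distr M (count_space UNIV) (X i) = distr M (count_space UNIV) \<xi>"
    and "integrable M (\<lambda>\<omega>. real_of_int (\<xi> \<omega>))"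
    and "slowly_varying (trunc_var M \<xi>)"
    and "(\<lambda>n. trunc_var M \<xi> (a n) / (a n)\<^sup>2) \<sim>[sequentially] (\<lambda>n. 1 / real n)"
    and "\<And>t. t > 0 \<Longrightarrow> r t \<ge> 0"
    and "(\<lambda>t. r t / trunc_var M \<xi> (r t)) \<sim>[at_top] (\<lambda>t. t)"
    and "\<And>n. n \<ge> 1 \<Longrightarrow> x n > 0"
    and "intermediate_regularly_varying (\<lambda>u. \<P>(\<omega> in M. \<xi> \<omega> = \<lfloor>u\<rfloor>))"
    and "Limsup at_top (\<lambda>k::int. (SUP l\<in>{k..}. ereal (\<P>(\<omega> in M. \<xi> \<omega> = l))) /
                                   ereal (\<P>(\<omega> in M. \<xi> \<omega> = k))) < \<infinity>"
  shows
    "(filterlim (\<lambda>n. real_of_int (x n) / a n) at_top sequentially \<and>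
      (\<lambda>n. real_of_int (x n) / real n) \<longlonglongrightarrow> 0 \<longrightarrow>
        (\<forall>\<epsilon>. 0 < \<epsilon> \<and> \<epsilon> < 1 \<longrightarrow>
          (\<lambda>n. \<P>(\<omega> in M. S n \<omega> - \<lfloor>b n\<rfloor> = x n \<and> real_of_int (Mx n \<omega>) > rr n))
            \<sim>[sequentially]
          (\<lambda>n. \<P>(\<omega> in M. S n \<omega> - \<lfloor>b n\<rfloor> = x n \<and>
                 \<bar>real_of_int (Mx n \<omega>) - real_of_int (x n)\<bar> \<le> \<epsilon> * real_of_int (x n)))) \<and>
        (\<exists>\<delta> :: nat \<Rightarrow> real. \<delta> \<longlonglongrightarrow> 0 \<and>
          (\<forall>\<^sub>F n in sequentially.
            \<P>(\<omega> in M. S n \<omega> - \<lfloor>b n\<rfloor> = x n) =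
            \<P>(\<omega> in M. S n \<omega> - \<lfloor>b n\<rfloor> = x n \<and> real_of_int (Mx n \<omega>) \<le> rr n) +
            (1 + \<delta> n) * real n * \<P>(\<omega> in M. \<xi> \<omega> = x n)))) \<and>
     (Liminf sequentially (\<lambda>n. ereal (real_of_int (x n) / real n)) > 0 \<longrightarrow>
        (\<forall>\<epsilon>>0.
          (\<lambda>n. \<P>(\<omega> in M. S n \<omega> - \<lfloor>b n\<rfloor> = x n))
            \<sim>[sequentially]
          (\<lambda>n. \<P>(\<omega> in M. S n \<omega> - \<lfloor>b n\<rfloor> = x n \<and>
                 \<bar>real_of_int (Mx n \<omega>) - real_of_int (x n)\<bar> \<le> \<epsilon> * real_of_int (x n))) \<and>
          (\<lambda>n. \<P>(\<omega> in M. S n \<omega> - \<lfloor>b n\<rfloor> = x n \<and>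
                 \<bar>real_of_int (Mx n \<omega>) - real_of_int (x n)\<bar> \<le> \<epsilon> * real_of_int (x n)))
            \<sim>[sequentially]
          (\<lambda>n. real n * \<P>(\<omega> in M. \<xi> \<omega> = x n))))"
proof -
  interpret prob_space M by fact
  interpret iid_integers M \<xi> X
    by (intro iid_integers.intro iid_integers_axioms.intro) fact+
  have p: "p = (\<lambda>k. \<P>(\<omega> in M. \<xi> \<omega> = k))" by (simp add: p_def fun_eq_iff)
  interpret iid_regular M \<xi> X
    by unfold_locales (use assms in \<open>simp_all add: p V_def\<close>)
  \<comment> \<open>Probabilities are not compared with each other directly but through the common
    reference \<open>n p(x)\<close>.\<close>
  have lin: "f \<sim>[sequentially] h"
    if "(\<lambda>n. f n / g n) \<longlonglongrightarrow> 1" "(\<lambda>n. h n / g n) \<longlonglongrightarrow> 1" for f g h :: "nat \<Rightarrow> real"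
    using asymp_equiv_trans[OF asymp_equivI'[OF that(1)] asymp_equiv_symI[OF asymp_equivI'[OF that(2)]]] .
  have ev: "{\<omega> \<in> space M. S n \<omega> - \<lfloor>b n\<rfloor> = x n \<and> P (Mx n \<omega>)} =
      {\<omega> \<in> space M. T {1..n} \<omega> = x n + \<lfloor>real n * \<mu>\<rfloor> \<and> P (partial_max X n \<omega>)}" for n P
    by (auto simp: S_def partial_sum_def T_def b_def Mx_def \<mu>_def)
  have ev0: "{\<omega> \<in> space M. S n \<omega> - \<lfloor>b n\<rfloor> = x n} = {\<omega> \<in> space M. T {1..n} \<omega> = x n + \<lfloor>real n * \<mu>\<rfloor>}" for n
    using ev[of n "\<lambda>_. True"] by simp
  show ?thesis
  proof (intro conjI impI; (elim conjE)?)
    assume xa: "filterlim (\<lambda>n. real_of_int (x n) / a n) at_top sequentially" and xn: "(\<lambda>n. real_of_int (x n) / real n) \<longlonglongrightarrow> 0"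
    interpret large_deviation M \<xi> X x
      by (rule large_deviation_of_normalising[OF _ xa]) (use assms in \<open>simp add: V_def\<close>)
    have hi: "(\<lambda>n. \<P>(\<omega> in M. S n \<omega> - \<lfloor>b n\<rfloor> = x n \<and> real_of_int (Mx n \<omega>) > rr n) / (real n * p (x n))) \<longlonglongrightarrow> 1"
      using threshold_asymp[of r] assms(13) xn unfolding ev[of _ "\<lambda>m. real_of_int m > rr _"] by (simp add: s_def V_def rr_def)
    show "\<forall>\<epsilon>. 0 < \<epsilon> \<and> \<epsilon> < 1 \<longrightarrow>
          (\<lambda>n. \<P>(\<omega> in M. S n \<omega> - \<lfloor>b n\<rfloor> = x n \<and> real_of_int (Mx n \<omega>) > rr n))
            \<sim>[sequentially]
          (\<lambda>n. \<P>(\<omega> in M. S n \<omega> - \<lfloor>b n\<rfloor> = x n \<and>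
                 \<bar>real_of_int (Mx n \<omega>) - real_of_int (x n)\<bar> \<le> \<epsilon> * real_of_int (x n)))"
    proof (intro allI impI lin[OF hi])
      fix \<epsilon> :: real assume "0 < \<epsilon> \<and> \<epsilon> < 1"
      then show "(\<lambda>n. \<P>(\<omega> in M. S n \<omega> - \<lfloor>b n\<rfloor> = x n \<and>
                 \<bar>real_of_int (Mx n \<omega>) - real_of_int (x n)\<bar> \<le> \<epsilon> * real_of_int (x n)) / (real n * p (x n))) \<longlonglongrightarrow> 1"
        using near_max_asymp[of \<epsilon>] unfolding ev[of _ "\<lambda>m. \<bar>real_of_int m - real_of_int (x _)\<bar> \<le> \<epsilon> * real_of_int (x _)"] by (simp add: s_def)
    qed
    \<comment> \<open>The relative error itself is taken as witness, so the required identity holds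
      exactly whenever \<open>n p(x) > 0\<close>.\<close>
    define \<delta> where "\<delta> n = \<P>(\<omega> in M. S n \<omega> - \<lfloor>b n\<rfloor> = x n \<and> real_of_int (Mx n \<omega>) > rr n) / (real n * p (x n)) - 1" for n
    show "\<exists>\<delta> :: nat \<Rightarrow> real. \<delta> \<longlonglongrightarrow> 0 \<and>
          (\<forall>\<^sub>F n in sequentially.
            \<P>(\<omega> in M. S n \<omega> - \<lfloor>b n\<rfloor> = x n) =
            \<P>(\<omega> in M. S n \<omega> - \<lfloor>b n\<rfloor> = x n \<and> real_of_int (Mx n \<omega>) \<le> rr n) +
            (1 + \<delta> n) * real n * \<P>(\<omega> in M. \<xi> \<omega> = x n))"
    proof (intro exI[of _ \<delta>] conjI)
      show "\<delta> \<longlonglongrightarrow> 0" unfolding \<delta>_def using tendsto_diff[OF hi tendsto_const[of 1]] by simp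
      show "\<forall>\<^sub>F n in sequentially.
            \<P>(\<omega> in M. S n \<omega> - \<lfloor>b n\<rfloor> = x n) =
            \<P>(\<omega> in M. S n \<omega> - \<lfloor>b n\<rfloor> = x n \<and> real_of_int (Mx n \<omega>) \<le> rr n) +
            (1 + \<delta> n) * real n * \<P>(\<omega> in M. \<xi> \<omega> = x n)"
        using p_eventually_pos eventually_ge_at_top[of 1]
      proof eventually_elim
        case (elim n)
        have "{\<omega> \<in> space M. S n \<omega> - \<lfloor>b n\<rfloor> = x n} = {\<omega> \<in> space M. S n \<omega> - \<lfloor>b n\<rfloor> = x n \<and> real_of_int (Mx n \<omega>) \<le> rr n}
            \<union> {\<omega> \<in> space M. S n \<omega> - \<lfloor>b n\<rfloor> = x n \<and> real_of_int (Mx n \<omega>) > rr n}"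
          by auto
        then have "\<P>(\<omega> in M. S n \<omega> - \<lfloor>b n\<rfloor> = x n) = \<P>(\<omega> in M. S n \<omega> - \<lfloor>b n\<rfloor> = x n \<and> real_of_int (Mx n \<omega>) \<le> rr n)
            + \<P>(\<omega> in M. S n \<omega> - \<lfloor>b n\<rfloor> = x n \<and> real_of_int (Mx n \<omega>) > rr n)"
          by (simp only:) (rule finite_measure_Union, use T_events(3)[OF elim(2)] in \<open>auto simp: ev[of _ "\<lambda>m. real_of_int m > rr _"] ev[of _ "\<lambda>m. real_of_int m \<le> rr _"]\<close>)
        also have "\<P>(\<omega> in M. S n \<omega> - \<lfloor>b n\<rfloor> = x n \<and> real_of_int (Mx n \<omega>) > rr n) = (1 + \<delta> n) * real n * \<P>(\<omega> in M. \<xi> \<omega> = x n)"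
          using elim unfolding \<delta>_def p by (simp add: field_simps)
        finally show ?case .
      qed
    qed
  next
    assume "Liminf sequentially (\<lambda>n. ereal (real_of_int (x n) / real n)) > 0"
    then obtain \<kappa> where \<kappa>: "0 < ereal \<kappa>" "ereal \<kappa> < Liminf sequentially (\<lambda>n. ereal (real_of_int (x n) / real n))"
      using ereal_dense2 by blast
    have k1: "eventually (\<lambda>n. \<kappa> * real n \<le> x n) sequentially"
      using less_LiminfD[OF \<kappa>(2)] eventually_gt_at_top[of 0] by eventually_elim (simp add: field_simps)
    have k0: "0 < \<kappa>" using \<kappa>(1) by simp
    interpret large_deviation M \<xi> X x by (rule large_deviation_of_linear[OF k0 k1])
    show "\<forall>\<epsilon>>0.
          (\<lambda>n. \<P>(\<omega> in M. S n \<omega> - \<lfloor>b n\<rfloor> = x n))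
            \<sim>[sequentially]
          (\<lambda>n. \<P>(\<omega> in M. S n \<omega> - \<lfloor>b n\<rfloor> = x n \<and>
                 \<bar>real_of_int (Mx n \<omega>) - real_of_int (x n)\<bar> \<le> \<epsilon> * real_of_int (x n))) \<and>
          (\<lambda>n. \<P>(\<omega> in M. S n \<omega> - \<lfloor>b n\<rfloor> = x n \<and>
                 \<bar>real_of_int (Mx n \<omega>) - real_of_int (x n)\<bar> \<le> \<epsilon> * real_of_int (x n)))
            \<sim>[sequentially]
          (\<lambda>n. real n * \<P>(\<omega> in M. \<xi> \<omega> = x n))"
    proof (intro allI impI)
      fix \<epsilon> :: real assume \<epsilon>: "0 < \<epsilon>"
      have total: "(\<lambda>n. \<P>(\<omega> in M. S n \<omega> - \<lfloor>b n\<rfloor> = x n) / (real n * p (x n))) \<longlonglongrightarrow> 1"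
        using linear_regime_asymp(1)[OF k0 k1 \<epsilon>] unfolding ev0 by (simp add: s_def)
      have near: "(\<lambda>n. \<P>(\<omega> in M. S n \<omega> - \<lfloor>b n\<rfloor> = x n \<and>
                 \<bar>real_of_int (Mx n \<omega>) - real_of_int (x n)\<bar> \<le> \<epsilon> * real_of_int (x n)) / (real n * p (x n))) \<longlonglongrightarrow> 1"
        using linear_regime_asymp(2)[OF k0 k1 \<epsilon>]
        unfolding ev[of _ "\<lambda>m. \<bar>real_of_int m - real_of_int (x _)\<bar> \<le> \<epsilon> * real_of_int (x _)"] by (simp add: s_def)
      show "(\<lambda>n. \<P>(\<omega> in M. S n \<omega> - \<lfloor>b n\<rfloor> = x n))
            \<sim>[sequentially]
          (\<lambda>n. \<P>(\<omega> in M. S n \<omega> - \<lfloor>b n\<rfloor> = x n \<and>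
                 \<bar>real_of_int (Mx n \<omega>) - real_of_int (x n)\<bar> \<le> \<epsilon> * real_of_int (x n))) \<and>
          (\<lambda>n. \<P>(\<omega> in M. S n \<omega> - \<lfloor>b n\<rfloor> = x n \<and>
                 \<bar>real_of_int (Mx n \<omega>) - real_of_int (x n)\<bar> \<le> \<epsilon> * real_of_int (x n)))
            \<sim>[sequentially]
          (\<lambda>n. real n * \<P>(\<omega> in M. \<xi> \<omega> = x n))"
        using lin[OF total near] asymp_equivI'[OF near] unfolding p by blast
    qed
  qed
qed

end
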